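(* Let $n\ge 2$ and $m\ge 1$ be integers. The map $\Phi: w\emptyset \mapsto w^{-1}\mathcal{A}_0$, for $w$ a minimal length left coset representative of $\widehat{\mathcal{S}}_n/\mathcal{S}_n$ (i.e. $w$ is the element of minimal length in the coset $w\mathcal{S}_n$), induces a bijection between the set of partitions that are both $n$-cores and $(mn+1)$-cores and the set of $m$-minimal alcoves in the dominant chamber.
   Context: Geometry. Let $\varepsilon_1,\dots,\varepsilon_n$ be the standard basis of $\mathbb{R}^n$ with the standard inner product $\langle\cdot\mid\cdot\rangle$, and $V=\{(a_1,\dots,a_n)\in\mathbb{R}^n\mid \sum_i a_i=0\}$. Put $\alpha_i=\varepsilon_i-\varepsilon_{i+1}$ for $1\le i\le n-1$, $\theta=\alpha_1+\cdots+\alpha_{n-1}=\varepsilon_1-\varepsilon_n$, $\Delta=\{\varepsilon_i-\varepsilon_j\mid i\ne j\}$ and $\Delta^+=\{\varepsilon_i-\varepsilon_j\mid i<j\}$. For $\alpha\in\Delta$, $k\in\mathbb{Z}$ let $H_{\alpha,k}=\{v\in V\mid\langle v\mid\alpha\rangle=k\}$. The alcoves are the connected components of $V\setminus\bigcup_{\alpha\in\Delta^+,k\in\mathbb{Z}}H_{\alpha,k}$. The fundamental alcove is $\mathcal{A}_0=\{v\in V\mid \langle v\mid\alpha_i\rangle>0\ (1\le i\le n-1),\ \langle v\mid\theta\rangle<1\}$. The dominant chamber is $\{v\in V\mid\langle v\mid\alpha_i\rangle\ge0,\ 1\le i\le n-1\}$. Group. The affine symmetric group $\widehat{\mathcal{S}}_n$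 is the Coxeter group generated by $s_0,s_1,\dots,s_{n-1}$ with $s_i^2=1$, $s_is_j=s_js_i$ if $i\not\equiv j\pm1 \bmod n$, $s_is_js_i=s_js_is_j$ if $i\equiv j\pm1\bmod n$ (for $n>2$; for $n=2$ only $s_i^2=1$). $\mathcal{S}_n$ is the subgroup generated by $s_1,\dots,s_{n-1}$, and $\ell$ is Coxeter length. It acts on $V$ by affine transformations: for $i\neq0$, $s_i$ swaps the $i$-th and $(i+1)$-st coordinates, and $s_0(a_1,\dots,a_n)=(a_n+1,a_2,\dots,a_{n-1},a_1-1)$. This action is free and transitive on alcoves. $m$-minimal alcoves. The $m$-Shi arrangement is $\{H_{\alpha,k}\mid\alpha\in\Delta^+,\ -m<k\le m\}$; its regions are the connected components of the complement in $V$ of the union of these hyperplanes. Each region contains a unique alcove $w\mathcal{A}_0$ with $\ell(w)$ smallest among the alcoves in that region; such an alcove is called $m$-minimal. Cores. Partitions are identified with their Young diagrams $\{(i,j)\mid1\le j\le\lambda_i\}$. For a positive integer $t$, a partition is a $t$-core if none of its hook lengths is divisible by $t$. The residue of a box $(i,j)$ is $(j-i)\bmod n$; an $i$-box is a box of residue $i$. A box of $\lambda$ is removable if deleting it leaves a partition; a box not in $\lambda$ is addable if adding it gives a partition. An $n$-core never has both addable and removable $i$-boxes for the same $i$. $\widehat{\mathcal{S}}_n$ acts on the set of $n$-cores (transitively) by: $s_i\lambda$ is $\lambda$ with all addable $i$-boxes added if there is any addable $i$-box; $\lambda$ with all removable $i$-boxes removed if there is any removable $i$-box; and $\lambda$ otherwise.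 $\emptyset$ denotes the empty partition; every $n$-core is $w\emptyset$ for a unique minimal length left coset representative $w$ of $\widehat{\mathcal{S}}_n/\mathcal{S}_n$. *)

theory Defs
  imports
    "HOL-Analysis.Analysis"
    "HOL-Number_Theory.Cong"
    "HOL-Algebra.Coset"
    "HOL-Algebra.Generated_Groups"
begin

section \<open>Geometry\<close>

text \<open>
  A vector \<open>(a\<^sub>1, \<dots>, a\<^sub>n)\<close> of \<open>\<real>\<^sup>n\<close> is a function \<open>nat \<Rightarrow> real\<close> that vanishes outside \<open>{1..n}\<close>.
  The topology of \<open>nat \<Rightarrow> real\<close> is the product topology; on the subspace of functions vanishing
  outside \<open>{1..n}\<close> it is the Euclidean topology of \<open>\<real>\<^sup>n\<close>, so \<^const>\<open>components\<close> below yields the usual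
  connected components.
\<close>

type_synonym vec = "nat \<Rightarrow> real"

definition eps :: "nat \<Rightarrow> vec" where
  "eps i = (\<lambda>k. if k = i then 1 else 0)"

definition ip :: "nat \<Rightarrow> vec \<Rightarrow> vec \<Rightarrow> real" where
  "ip n u v = (\<Sum>i=1..n. u i * v i)"

definition V :: "nat \<Rightarrow> vec set" where
  "V n = {a. (\<forall>i. i \<notin> {1..n} \<longrightarrow> a i = 0) \<and> (\<Sum>i=1..n. a i) = 0}"

definition simple_root :: "nat \<Rightarrow> vec" where
  "simple_root i = eps i - eps (i + 1)"

definition theta :: "nat \<Rightarrow> vec" where
  "theta n = eps 1 - eps n"

definition positive_roots :: "nat \<Rightarrow> vec set" where
  "positive_roots n = {eps i - eps j | i j. 1 \<le> i \<and> i < j \<and> j \<le> n}"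

definition hyperplane :: "nat \<Rightarrow> vec \<Rightarrow> int \<Rightarrow> vec set" where
  "hyperplane n \<alpha> k = {v \<in> V n. ip n v \<alpha> = of_int k}"

definition alcoves :: "nat \<Rightarrow> vec set set" where
  "alcoves n = components (V n - (\<Union>\<alpha>\<in>positive_roots n. \<Union>k. hyperplane n \<alpha> k))"

definition fundamental_alcove :: "nat \<Rightarrow> vec set" where
  "fundamental_alcove n =
     {v \<in> V n. (\<forall>i\<in>{1..n-1}. ip n v (simple_root i) > 0) \<and> ip n v (theta n) < 1}"

definition dominant_chamber :: "nat \<Rightarrow> vec set" where
  "dominant_chamber n = {v \<in> V n. \<forall>i\<in>{1..n-1}. ip n v (simple_root i) \<ge> 0}"

definition shi_regions :: "nat \<Rightarrow> nat \<Rightarrow> vec set set" where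
  "shi_regions n m =
     components (V n - (\<Union>\<alpha>\<in>positive_roots n. \<Union>k\<in>{- int m<..int m}. hyperplane n \<alpha> k))"


section \<open>The affine symmetric group\<close>

text \<open>
  The group is given by its presentation. Words in the generators \<open>s\<^sub>0, \<dots>, s\<^sub>n\<^sub>-\<^sub>1\<close> are lists over \<open>{..<n}\<close>,
  and group elements are the classes of words modulo the least congruence containing the Coxeter
  relations. No letters for inverses are needed since every generator is an involution.
\<close>

definition neighbours :: "nat \<Rightarrow> nat \<Rightarrow> nat \<Rightarrow> bool" where
  "neighbours n i j \<longleftrightarrow> [int i = int j + 1] (mod int n) \<or> [int i = int j - 1] (mod int n)"

inductive coxeter_eq :: "nat \<Rightarrow> nat list \<Rightarrow> nat list \<Rightarrow> bool" for n where
  refl: "coxeter_eq n u u"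
| sym: "coxeter_eq n u v \<Longrightarrow> coxeter_eq n v u"
| trans: "coxeter_eq n u v \<Longrightarrow> coxeter_eq n v w \<Longrightarrow> coxeter_eq n u w"
| append: "coxeter_eq n u u' \<Longrightarrow> coxeter_eq n v v' \<Longrightarrow> coxeter_eq n (u @ v) (u' @ v')"
| square: "i < n \<Longrightarrow> coxeter_eq n [i, i] []"
| commute: "i < n \<Longrightarrow> j < n \<Longrightarrow> \<not> neighbours n i j \<Longrightarrow> coxeter_eq n [i, j] [j, i]"
| braid: "n > 2 \<Longrightarrow> i < n \<Longrightarrow> j < n \<Longrightarrow> neighbours n i j \<Longrightarrow> coxeter_eq n [i, j, i] [j, i, j]"

definition coxeter_rel :: "nat \<Rightarrow> (nat list \<times> nat list) set" where
  "coxeter_rel n = {(u, v). u \<in> lists {..<n} \<and> v \<in> lists {..<n} \<and> coxeter_eq n u v}"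

definition affine_sym :: "nat \<Rightarrow> nat list set monoid" where
  "affine_sym n =
     \<lparr> carrier = lists {..<n} // coxeter_rel n,
       mult = (\<lambda>A B. \<Union>u\<in>A. \<Union>v\<in>B. coxeter_rel n `` {u @ v}),
       one = coxeter_rel n `` {[]} \<rparr>"

definition gen :: "nat \<Rightarrow> nat \<Rightarrow> nat list set" where
  "gen n i = coxeter_rel n `` {[i]}"

definition finite_sym :: "nat \<Rightarrow> nat list set set" where
  "finite_sym n = generate (affine_sym n) (gen n ` {1..n-1})"

definition cox_length :: "nat list set \<Rightarrow> nat" where
  "cox_length w = (LEAST k. \<exists>u\<in>w. length u = k)"

definition min_coset_reps :: "nat \<Rightarrow> nat list set set" where
  "min_coset_reps n =
     {w \<in> carrier (affine_sym n).
        \<forall>u \<in> w <#\<^bsub>affine_sym n\<^esub> finite_sym n. cox_length w \<le> cox_length u}"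

text \<open>
  If the maps \<open>f i\<close> satisfy the Coxeter relations, they define an action in which the class of the
  word \<open>[i\<^sub>1, \<dots>, i\<^sub>k]\<close> acts as \<open>f i\<^sub>1 \<circ> \<dots> \<circ> f i\<^sub>k\<close>, whichever word is chosen from the class.
\<close>

definition induced_action :: "(nat \<Rightarrow> 'a \<Rightarrow> 'a) \<Rightarrow> nat list set \<Rightarrow> 'a \<Rightarrow> 'a" where
  "induced_action f w x = foldr f (SOME u. u \<in> w) x"

definition gen_vec :: "nat \<Rightarrow> nat \<Rightarrow> vec \<Rightarrow> vec" where
  "gen_vec n i a =
     (if i = 0 then a(1 := a n + 1, n := a 1 - 1) else a(i := a (i + 1), i + 1 := a i))"

definition act_vec :: "nat \<Rightarrow> nat list set \<Rightarrow> vec \<Rightarrow> vec" where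
  "act_vec n = induced_action (gen_vec n)"

lemma equiv_coxeter_rel: "equiv (lists {..<n}) (coxeter_rel n)"
proof (rule equivI)
  show "coxeter_rel n \<subseteq> lists {..<n} \<times> lists {..<n}"
    unfolding coxeter_rel_def by blast
  show "refl_on (lists {..<n}) (coxeter_rel n)"
    unfolding coxeter_rel_def by (rule refl_onI) (simp add: coxeter_eq.refl)
  show "sym (coxeter_rel n)"
    unfolding coxeter_rel_def by (rule symI) (simp add: coxeter_eq.sym)
  show "trans (coxeter_rel n)"
    unfolding coxeter_rel_def by (rule transI) (blast intro: coxeter_eq.trans)
qed

lemma affine_sym_mult:
  assumes "u \<in> lists {..<n}" "v \<in> lists {..<n}"
  shows "(coxeter_rel n `` {u}) \<otimes>\<^bsub>affine_sym n\<^esub> (coxeter_rel n `` {v}) = coxeter_rel n `` {u @ v}"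
proof -
  have class_eq: "coxeter_rel n `` {u' @ v'} = coxeter_rel n `` {u @ v}"
    if "u' \<in> coxeter_rel n `` {u}" "v' \<in> coxeter_rel n `` {v}" for u' v'
  proof (rule equiv_class_eq[OF equiv_coxeter_rel, symmetric])
    have "coxeter_eq n u u'" "coxeter_eq n v v'"
      using that by (simp_all add: coxeter_rel_def)
    then have "coxeter_eq n (u @ v) (u' @ v')"
      by (rule coxeter_eq.append)
    with that show "(u @ v, u' @ v') \<in> coxeter_rel n"
      by (simp add: coxeter_rel_def)
  qed
  have mem: "u \<in> coxeter_rel n `` {u}" "v \<in> coxeter_rel n `` {v}"
    using assms by (simp_all add: coxeter_rel_def coxeter_eq.refl)
  have "(\<Union>u'\<in>coxeter_rel n `` {u}. \<Union>v'\<in>coxeter_rel n `` {v}. coxeter_rel n `` {u' @ v'})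
      = (\<Union>u'\<in>coxeter_rel n `` {u}. \<Union>v'\<in>coxeter_rel n `` {v}. coxeter_rel n `` {u @ v})"
    by (rule SUP_cong[OF HOL.refl], rule SUP_cong[OF HOL.refl], rule class_eq)
  also have "\<dots> = coxeter_rel n `` {u @ v}"
    by (subst UN_constant, subst UN_constant) (use mem in \<open>metis empty_iff\<close>)
  finally show ?thesis
    by (simp only: affine_sym_def monoid.simps)
qed

lemma coxeter_eq_rev_append: "u \<in> lists {..<n} \<Longrightarrow> coxeter_eq n (rev u @ u) []"
proof (induction u)
  case Nil
  show ?case by (simp add: coxeter_eq.refl)
next
  case (Cons i u)
  then have i: "i < n" and u: "u \<in> lists {..<n}"
    by simp_all
  have "coxeter_eq n (rev u @ ([i, i] @ u)) (rev u @ ([] @ u))"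
    by (rule coxeter_eq.append[OF coxeter_eq.refl coxeter_eq.append[OF coxeter_eq.square[OF i] coxeter_eq.refl]])
  then have "coxeter_eq n (rev (i # u) @ (i # u)) (rev u @ u)"
    by simp
  then show ?case
    using Cons.IH[OF u] by (rule coxeter_eq.trans)
qed

lemma group_affine_sym: "group (affine_sym n)"
proof -
  let ?c = "\<lambda>u. coxeter_rel n `` {u}"
  have carr: "carrier (affine_sym n) = ?c ` lists {..<n}"
    unfolding affine_sym_def quotient_def by auto
  have one: "\<one>\<^bsub>affine_sym n\<^esub> = ?c []"
    by (simp add: affine_sym_def)
  have app: "u @ v \<in> lists {..<n}" if "u \<in> lists {..<n}" "v \<in> lists {..<n}" for u v
    using that by simp
  show ?thesis
  proof (rule groupI)
    fix x y assume "x \<in> carrier (affine_sym n)" "y \<in> carrier (affine_sym n)"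
    then obtain u v where uv: "u \<in> lists {..<n}" "x = ?c u" "v \<in> lists {..<n}" "y = ?c v"
      unfolding carr by blast
    show "x \<otimes>\<^bsub>affine_sym n\<^esub> y \<in> carrier (affine_sym n)"
      unfolding uv carr affine_sym_mult[OF uv(1,3)] using app[OF uv(1,3)] by (rule imageI)
    fix z assume "z \<in> carrier (affine_sym n)"
    then obtain w where w: "w \<in> lists {..<n}" "z = ?c w"
      unfolding carr by blast
    show "x \<otimes>\<^bsub>affine_sym n\<^esub> y \<otimes>\<^bsub>affine_sym n\<^esub> z = x \<otimes>\<^bsub>affine_sym n\<^esub> (y \<otimes>\<^bsub>affine_sym n\<^esub> z)"
      unfolding uv w affine_sym_mult[OF uv(1,3)] affine_sym_mult[OF uv(3) w(1)]
        affine_sym_mult[OF app[OF uv(1,3)] w(1)] affine_sym_mult[OF uv(1) app[OF uv(3) w(1)]]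
      by (simp only: append_assoc)
  next
    show "\<one>\<^bsub>affine_sym n\<^esub> \<in> carrier (affine_sym n)"
      unfolding one carr by (rule imageI) simp
  next
    fix x assume "x \<in> carrier (affine_sym n)"
    then obtain u where u: "u \<in> lists {..<n}" "x = ?c u"
      unfolding carr by blast
    have nil: "[] \<in> lists {..<n}" and r: "rev u \<in> lists {..<n}"
      using u(1) by (simp_all add: in_lists_conv_set)
    show "\<one>\<^bsub>affine_sym n\<^esub> \<otimes>\<^bsub>affine_sym n\<^esub> x = x"
      unfolding one u(2) affine_sym_mult[OF nil u(1)] by simp
    have "(rev u @ u, []) \<in> coxeter_rel n"
      using coxeter_eq_rev_append[OF u(1)] app[OF r u(1)] unfolding coxeter_rel_def by simp
    then have "?c (rev u) \<otimes>\<^bsub>affine_sym n\<^esub> x = \<one>\<^bsub>affine_sym n\<^esub>"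
      unfolding one u(2) affine_sym_mult[OF r u(1)] by (rule equiv_class_eq[OF equiv_coxeter_rel])
    then show "\<exists>y\<in>carrier (affine_sym n). y \<otimes>\<^bsub>affine_sym n\<^esub> x = \<one>\<^bsub>affine_sym n\<^esub>"
      unfolding carr using r by blast
  qed
qed


section \<open>m-minimal alcoves\<close>

text \<open>\<open>w\<close> has smallest length among all \<open>u\<close> whose alcove \<open>u\<A>\<^sub>0\<close> lies in the region of \<open>w\<A>\<^sub>0\<close>.\<close>

definition m_minimal_alcoves :: "nat \<Rightarrow> nat \<Rightarrow> vec set set" where
  "m_minimal_alcoves n m =
     {A \<in> alcoves n. \<exists>R\<in>shi_regions n m. \<exists>w\<in>carrier (affine_sym n).
        A = act_vec n w ` fundamental_alcove n \<and> A \<subseteq> R \<and>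
        (\<forall>u\<in>carrier (affine_sym n).
           act_vec n u ` fundamental_alcove n \<subseteq> R \<longrightarrow> cox_length w \<le> cox_length u)}"


section \<open>Cores\<close>

type_synonym box = "nat \<times> nat"

definition is_partition :: "nat list \<Rightarrow> bool" where
  "is_partition l \<longleftrightarrow> sorted_wrt (\<ge>) l \<and> 0 \<notin> set l"

definition young_diagram :: "nat list \<Rightarrow> box set" where
  "young_diagram l = {(i, j). 1 \<le> i \<and> i \<le> length l \<and> 1 \<le> j \<and> j \<le> l ! (i - 1)}"

definition partitions :: "box set set" where
  "partitions = young_diagram ` {l. is_partition l}"

definition hook_length :: "box set \<Rightarrow> box \<Rightarrow> nat" where
  "hook_length D b =
     card {c \<in> D. (fst c = fst b \<and> snd c \<ge> snd b) \<or> (snd c = snd b \<and> fst c \<ge> fst b)}"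

definition cores :: "nat \<Rightarrow> box set set" where
  "cores t = {D \<in> partitions. \<forall>b\<in>D. \<not> t dvd hook_length D b}"

definition residue :: "nat \<Rightarrow> box \<Rightarrow> nat" where
  "residue n b = nat ((int (snd b) - int (fst b)) mod int n)"

definition removable :: "box set \<Rightarrow> box \<Rightarrow> bool" where
  "removable D b \<longleftrightarrow> b \<in> D \<and> D - {b} \<in> partitions"

definition addable :: "box set \<Rightarrow> box \<Rightarrow> bool" where
  "addable D b \<longleftrightarrow> b \<notin> D \<and> insert b D \<in> partitions"

definition gen_core :: "nat \<Rightarrow> nat \<Rightarrow> box set \<Rightarrow> box set" where
  "gen_core n i D =
     (if \<exists>b. addable D b \<and> residue n b = i then D \<union> {b. addable D b \<and> residue n b = i}
      else if \<exists>b. removable D b \<and> residue n b = i then D - {b. removable D b \<and> residue n b = i}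
      else D)"

definition act_core :: "nat \<Rightarrow> nat list set \<Rightarrow> box set \<Rightarrow> box set" where
  "act_core n = induced_action (gen_core n)"


section \<open>The map \<open>w\<emptyset> \<mapsto> w\<^sup>-\<^sup>1\<A>\<^sub>0\<close>\<close>

text \<open>Every \<open>n\<close>-core is \<open>w\<emptyset>\<close> for exactly one minimal length left coset representative \<open>w\<close>.\<close>

definition min_rep :: "nat \<Rightarrow> box set \<Rightarrow> nat list set" where
  "min_rep n D = (THE w. w \<in> min_coset_reps n \<and> act_core n w {} = D)"

definition Phi :: "nat \<Rightarrow> box set \<Rightarrow> vec set" where
  "Phi n D = act_vec n (inv\<^bsub>affine_sym n\<^esub> (min_rep n D)) ` fundamental_alcove n"

end

theory Submission
  imports Defs
begin

text \<open>
  An element \<open>w\<close> of the affine symmetric group acts on \<open>V\<close> as \<open>v \<mapsto> u v + c\<close>, where \<open>u\<close> permutes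
  coordinates and \<open>c = w 0\<close> is an integer vector of coordinate sum zero. For a minimal coset
  representative \<open>w\<close> this vector determines both the core \<open>w\<emptyset>\<close> and the alcove \<open>w\<^sup>-\<^sup>1\<A>\<^sub>0\<close>, and the two
  properties to be compared become the same system of inequalities:
  \<open>c\<^sub>i\<^sub>+\<^sub>1 - c\<^sub>i \<le> m\<close> for \<open>1 \<le> i < n\<close>, and \<open>c\<^sub>1 - c\<^sub>n \<le> m + 1\<close>.

  \<^bold>\<open>Cores.\<close> The boundary of a Young diagram is a two-sided sequence of beads and gaps, indexed by
  contents, and the hook lengths are the differences between a bead and a gap to its left. So a
  partition is a \<open>t\<close>-core iff its set of beads is closed under subtracting \<open>t\<close>
  (\<open>core_iff_beads_closed\<close>). For an \<open>n\<close>-core the beads in each residue class modulo \<open>n\<close> form a ray; the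
  \<open>n\<close> end points of these rays are the entries of an integer vector, all such vectors of sum zero occur
  (\<open>core_of_inj\<close>, \<open>core_of_surj\<close>), and \<open>s\<^sub>i\<close> acts on the vectors by the same formula as on \<open>V\<close>
  (\<open>gen_core_core_of\<close>). Hence \<open>w\<emptyset>\<close> is the core of \<open>w 0\<close>. Comparing the ends of neighbouring rays turns
  closure under subtracting \<open>mn + 1\<close> into the inequalities above (\<open>core_of_simultaneous_core\<close>).

  \<^bold>\<open>Alcoves.\<close> Let \<open>p\<close> be the barycentre of \<open>\<A>\<^sub>0\<close>, whose coordinates descend in steps of \<open>1 / n\<close>.
  Every alcove contains exactly one point of the orbit of \<open>p\<close>, its centre. The number of hyperplanes
  that separate a centre from \<open>p\<close> changes by one under each generator, and it is the Coxeter length; the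
  usual argument on reduced words shows that two words with the same centre are equal in the
  presented group (\<open>coxeter_eq_iff_word_act\<close>). It follows that \<open>w\<close> is a minimal coset representative iff
  the centre \<open>q = w\<^sup>-\<^sup>1 p\<close> has decreasing coordinates, i.e. iff \<open>w\<^sup>-\<^sup>1\<A>\<^sub>0\<close> is dominant
  (\<open>min_coset_reps_iff\<close>). Because \<open>w\<^sup>-\<^sup>1 p = u\<^sup>-\<^sup>1 (p - c)\<close>, the coordinates of \<open>q\<close> are then those of
  \<open>p - c\<close> sorted decreasingly (\<open>inverse_act_image\<close>). So \<open>c\<close> and the minimal \<open>w\<close> determine each other.

  \<^bold>\<open>Minimality.\<close> The walls of the alcove with centre \<open>q\<close> lie on the hyperplanes \<open>x\<^sub>i - x\<^sub>j = k\<close> with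
  \<open>q\<^sub>i - q\<^sub>j = k + 1 / n\<close>. If \<open>q\<close> is dominant and some such \<open>k\<close> exceeds \<open>m\<close>, crossing that wall stays in the
  region and lowers the length. If all such \<open>k\<close> are at most \<open>m\<close>, then every \<open>\<lfloor>q\<^sub>i - q\<^sub>j\<rfloor> > m\<close> with \<open>i < j\<close>
  equals \<open>\<lfloor>q\<^sub>i - q\<^sub>l\<rfloor> + \<lfloor>q\<^sub>l - q\<^sub>j\<rfloor>\<close> for some \<open>l\<close> between \<open>i\<close> and \<open>j\<close> (\<open>floor_splits\<close>), so all floors of \<open>q\<close>
  are forced as lower bounds on the whole region by those that are at most \<open>m\<close>. For the coordinates of
  \<open>p - c\<close> the condition on the \<open>k\<close> is the system of inequalities above (\<open>steps_bounded_lattice\<close>).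
\<close>


section \<open>Young diagrams and their boundary profiles\<close>

text \<open>
  \<open>h z\<close> is the number of beads at positions \<open>\<ge> z\<close>; equivalently, the diagonal of content \<open>z\<close> ends in
  row \<open>h z\<close> (for an empty diagonal, in the row before its first box). The second clause says that far to the right there are no beads, far to the left there are
  only beads, and the total charge is zero; given the unit steps it is enough to ask for it cofinally.
\<close>

definition profile :: "(int \<Rightarrow> int) \<Rightarrow> bool" where
  "profile h \<longleftrightarrow> (\<forall>z. h z = h (z + 1) \<or> h z = h (z + 1) + 1) \<and>
     (\<forall>N. \<exists>M\<ge>N. h M = 0 \<and> h (- M) = M)"

definition bead :: "(int \<Rightarrow> int) \<Rightarrow> int \<Rightarrow> bool" where
  "bead h z \<longleftrightarrow> h z = h (z + 1) + 1"

text \<open>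
  A box of content \<open>z\<close> belongs to the diagram iff its row number is at most \<open>h z\<close>. On the negative
  diagonals the boxes in column \<open>\<le> 0\<close> are counted by \<open>h\<close> as well, which is why no case distinction on the
  sign of the content is needed.
\<close>

definition diagram :: "(int \<Rightarrow> int) \<Rightarrow> box set" where
  "diagram h = {(i, j). 1 \<le> i \<and> 1 \<le> j \<and> int i \<le> h (int j - int i)}"

lemma profile_step: "profile h \<Longrightarrow> h z = h (z + 1) + (if bead h z then 1 else 0)"
  unfolding profile_def bead_def by auto

lemma profile_step_minus: "profile h \<Longrightarrow> h (z - 1) = h z + (if bead h (z - 1) then 1 else 0)"
  using profile_step[of h "z - 1"] by simp

lemma profile_antimono:
  assumes "profile h" "a \<le> b" shows "h b \<le> h a"
  using assms(2)
proof (induction b rule: int_ge_induct)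
  case (step b)
  then show ?case using profile_step[OF assms(1), of b] by (auto split: if_splits)
qed simp

lemma profile_shift_mono:
  assumes "profile h" "a \<le> b" shows "h a + a \<le> h b + b"
  using assms(2)
proof (induction b rule: int_ge_induct)
  case (step b)
  then show ?case using profile_step[OF assms(1), of b] by (auto split: if_splits)
qed simp

lemma profile_nonneg:
  assumes "profile h" shows "0 \<le> h z"
proof -
  obtain M where "M \<ge> z" "h M = 0" using assms unfolding profile_def by blast
  then show ?thesis using profile_antimono[OF assms, of z M] by simp
qed

lemma profile_shift_nonneg:
  assumes "profile h" shows "0 \<le> h z + z"
proof -
  obtain M where "M \<ge> - z" "h (- M) = M" using assms unfolding profile_def by blast
  then show ?thesis using profile_shift_mono[OF assms, of "- M" z] by simp
qed

lemma profile_vanishes: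
  assumes "profile h" obtains M where "M \<ge> 0" "\<And>z. z \<ge> M \<Longrightarrow> h z = 0" "\<And>z. z \<ge> M \<Longrightarrow> h (- z) = z"
proof -
  obtain M where M: "M \<ge> 0" "h M = 0" "h (- M) = M"
    using assms unfolding profile_def by blast
  show ?thesis
  proof (rule that[OF M(1)])
    fix z assume z: "z \<ge> M"
    show "h z = 0" using profile_antimono[OF assms z] profile_nonneg[OF assms, of z] M by simp
    show "h (- z) = z"
      using profile_shift_mono[OF assms, of "- z" "- M"] profile_shift_nonneg[OF assms, of "- z"] M z
      by simp
  qed
qed

text \<open>
  Rows, columns and diagonals of an order ideal are initial segments, hence known from their size.
\<close>

lemma initial_segment:
  fixes S :: "nat set"
  assumes "finite S" "\<And>j. j \<in> S \<Longrightarrow> 1 \<le> j" "\<And>j. 1 \<le> j \<Longrightarrow> Suc j \<in> S \<Longrightarrow> j \<in> S"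
  shows "S = {1..card S}"
proof (cases "S = {}")
  case False
  have "{1..Max S} \<subseteq> S"
  proof
    fix j assume "j \<in> {1..Max S}"
    then have "j \<le> Max S" "1 \<le> j" by auto
    then show "j \<in> S"
    proof (induction j rule: inc_induct)
      case base
      then show ?case using Max_in[OF assms(1) False] by simp
    next
      case (step k)
      then have "1 \<le> k" "Suc k \<in> S" by simp_all
      then show ?case by (rule assms(3))
    qed
  qed
  moreover have "S \<subseteq> {1..Max S}" using assms(1,2) by auto
  ultimately have "S = {1..Max S}" by blast
  then show ?thesis by (metis card_atLeastAtMost diff_Suc_1)
qed simp

text \<open>
  Partitions are the finite order ideals of boxes: the row lengths of an order ideal decrease, and they
  recover the ideal. This form makes adding or deleting a single box easy to handle.
\<close>

lemma partitions_iff: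
  "D \<in> partitions \<longleftrightarrow> finite D \<and> (\<forall>i j. (i, j) \<in> D \<longrightarrow> 1 \<le> i \<and> 1 \<le> j) \<and>
     (\<forall>i j. 1 \<le> i \<longrightarrow> (Suc i, j) \<in> D \<longrightarrow> (i, j) \<in> D) \<and>
     (\<forall>i j. 1 \<le> j \<longrightarrow> (i, Suc j) \<in> D \<longrightarrow> (i, j) \<in> D)" (is "_ \<longleftrightarrow> ?R")
proof
  assume "D \<in> partitions"
  then obtain l where l: "is_partition l" and D: "D = young_diagram l"
    unfolding partitions_def by auto
  have sorted: "l ! b \<le> l ! a" if "a < b" "b < length l" for a b
    using l that unfolding is_partition_def by (auto simp: sorted_wrt_iff_nth_less)
  have "D \<subseteq> (SIGMA i:{1..length l}. {1..l ! (i - 1)})" unfolding D young_diagram_def by auto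
  then have "finite D" by (rule finite_subset) simp
  moreover have "(i, j) \<in> D" if "1 \<le> i" "(Suc i, j) \<in> D" for i j
    using that sorted[of "i - 1" i] unfolding D young_diagram_def by auto
  ultimately show ?R unfolding D young_diagram_def by auto
next
  assume R: ?R
  define f where "f i = card {j. (i, j) \<in> D}" for i
  define L where "L = card {i. (i, 1) \<in> D}"
  have finD: "finite D" using R by blast
  have fin: "finite {j. (i, j) \<in> D}" for i
    by (rule finite_subset[of _ "snd ` D"]) (use finD in \<open>auto intro: rev_image_eqI\<close>)
  have row: "{j. (i, j) \<in> D} = {1..f i}" for i
    unfolding f_def by (rule initial_segment[OF fin]) (use R in blast)+
  have "finite {i. (i, 1) \<in> D}"
    by (rule finite_subset[of _ "fst ` D"]) (use finD in \<open>auto intro: rev_image_eqI\<close>)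
  then have col: "{i. (i, 1) \<in> D} = {1..L}"
    unfolding L_def by (rule initial_segment) (use R in blast)+
  have mem: "(i, j) \<in> D \<longleftrightarrow> 1 \<le> j \<and> j \<le> f i" for i j
    using row[of i] by auto
  have pos: "1 \<le> f i \<longleftrightarrow> 1 \<le> i \<and> i \<le> L" for i
  proof -
    have "(i, 1) \<in> D \<longleftrightarrow> i \<in> {1..L}" using col by blast
    then show ?thesis using mem[of i 1] by simp
  qed
  have step: "f (Suc i) \<le> f i" if "1 \<le> i" for i
  proof (cases "f (Suc i)")
    case (Suc k)
    then have "(Suc i, f (Suc i)) \<in> D" using mem by simp
    then have "(i, f (Suc i)) \<in> D" using R that by blast
    then show ?thesis using mem by blast
  qed simp
  have anti: "f b \<le> f a" if "a \<le> b" "1 \<le> a" for a b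
    using that
  proof (induction b rule: dec_induct)
    case (step b)
    then show ?case using \<open>1 \<le> a\<close> \<open>a \<le> b\<close> \<open>\<And>i. 1 \<le> i \<Longrightarrow> f (Suc i) \<le> f i\<close>[of b] by simp
  qed simp
  define l where "l = map f [1..<Suc L]"
  have nth: "l ! k = f (Suc k)" if "k < L" for k
    unfolding l_def using that by (auto simp del: upt_Suc)
  have len: "length l = L" unfolding l_def by simp
  have "is_partition l"
    unfolding is_partition_def
  proof
    show "sorted_wrt (\<ge>) l"
      unfolding sorted_wrt_iff_nth_less using nth len anti by simp
    show "0 \<notin> set l"
    proof
      assume "0 \<in> set l"
      then obtain i where "1 \<le> i" "i \<le> L" "f i = 0" unfolding l_def by (auto simp del: upt_Suc)
      then show False using pos[of i] by simp
    qed
  qed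
  moreover have "young_diagram l = D"
  proof -
    have "(i, j) \<in> young_diagram l \<longleftrightarrow> (i, j) \<in> D" for i j
    proof (cases "1 \<le> i \<and> i \<le> L")
      case True
      then have "i - 1 < L" "Suc (i - 1) = i" by auto
      then show ?thesis unfolding young_diagram_def mem using nth[of "i - 1"] len True by simp
    next
      case False
      then have "\<not> 1 \<le> f i" using pos[of i] by blast
      then have "f i = 0" by simp
      then show ?thesis unfolding young_diagram_def mem using len False by auto
    qed
    then show ?thesis by auto
  qed
  ultimately show "D \<in> partitions"
    unfolding partitions_def by (intro image_eqI[of _ _ l]) simp_all
qed

lemma diagram_in_partitions:
  assumes h: "profile h" shows "diagram h \<in> partitions"
  unfolding partitions_iff
proof (intro conjI allI impI)
  obtain M where M: "M \<ge> 0" "\<And>z. z \<ge> M \<Longrightarrow> h z = 0" "\<And>z. z \<ge> M \<Longrightarrow> h (- z) = z"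
    by (rule profile_vanishes[OF h], blast)
  have "diagram h \<subseteq> {..nat M} \<times> {..nat (2 * M)}"
  proof clarify
    fix i j assume "(i, j) \<in> diagram h"
    then have ij: "1 \<le> i" "1 \<le> j" "int i \<le> h (int j - int i)" unfolding diagram_def by auto
    have lt: "int j - int i < M" using M(2)[of "int j - int i"] ij by fastforce
    have gt: "int j - int i > - M"
      using M(3)[of "int i - int j"] ij by fastforce
    have "h (int j - int i) \<le> h (- M)" using gt by (intro profile_antimono[OF h]) simp
    then have "int i \<le> M" using ij M(3)[of M] by simp
    then show "i \<in> {..nat M} \<and> j \<in> {..nat (2 * M)}" using lt by auto
  qed
  then show "finite (diagram h)" by (rule finite_subset) simp
next
  fix i j assume "(i, j) \<in> diagram h"
  then show "1 \<le> i" "1 \<le> j" unfolding diagram_def by auto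
next
  fix i j assume "1 \<le> i" "(Suc i, j) \<in> diagram h"
  moreover have "h (int j - int i - 1) \<le> h (int j - int i) + 1"
    using profile_step_minus[OF h, of "int j - int i"] by (auto split: if_splits)
  moreover have "int j - int (Suc i) = int j - int i - 1" by simp
  ultimately show "(i, j) \<in> diagram h"
    unfolding diagram_def by (auto simp del: of_nat_Suc)
next
  fix i j assume "1 \<le> j" "(i, Suc j) \<in> diagram h"
  moreover have "h (int (Suc j) - int i) \<le> h (int j - int i)"
    by (rule profile_antimono[OF h]) simp
  ultimately show "(i, j) \<in> diagram h"
    unfolding diagram_def by auto
qed

text \<open>
  The profile counts the rows \<open>i\<close> with \<open>\<lambda>\<^sub>i \<ge> i + z\<close>, i.e. the beads \<open>\<lambda>\<^sub>i - i\<close> that are \<open>\<ge> z\<close>.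
\<close>

lemma partition_is_diagram:
  assumes "D \<in> partitions"
  obtains h where "profile h" "D = diagram h"
proof -
  obtain l where l: "is_partition l" and D: "D = young_diagram l"
    using assms unfolding partitions_def by auto
  define lam where "lam i = (if 1 \<le> i \<and> i \<le> length l then l ! (i - 1) else 0)" for i
  have lam_step: "lam (Suc i) \<le> lam i" if "1 \<le> i" for i
    using l that unfolding is_partition_def lam_def by (auto simp: sorted_wrt_iff_nth_less)
  have lam_le: "lam i \<le> lam 1" if "1 \<le> i" for i
    using that
  proof (induction i rule: dec_induct)
    case (step i)
    then show ?case using lam_step[of i] by simp
  qed simp
  define S where "S z = {i. 1 \<le> i \<and> int i + z \<le> int (lam i)}" for z
  define h where "h z = int (card (S z))" for z
  have finS: "finite (S z)" for z
  proof (rule finite_subset)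
    show "S z \<subseteq> {..nat (int (lam 1) - z)}" unfolding S_def using lam_le by fastforce
  qed simp
  have S: "S z = {1..card (S z)}" for z
    by (rule initial_segment[OF finS]) (use lam_step in \<open>force simp: S_def\<close>)+
  have mem: "i \<in> S z \<longleftrightarrow> 1 \<le> i \<and> int i \<le> h z" for i z
  proof -
    have "i \<in> S z \<longleftrightarrow> i \<in> {1..card (S z)}" using S by blast
    then show ?thesis unfolding h_def by simp
  qed
  have "profile h"
    unfolding profile_def
  proof (intro conjI allI)
    fix z
    have "h (z + 1) \<le> h z"
    proof -
      have "S (z + 1) \<subseteq> S z" unfolding S_def by auto
      then show ?thesis unfolding h_def using finS by (simp add: card_mono)
    qed
    moreover have "h z \<le> h (z + 1) + 1"
    proof (cases "card (S z) \<ge> 2")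
      case True
      then obtain k where k: "card (S z) = Suc k" "1 \<le> k" by (cases "card (S z)") auto
      then have "Suc k \<in> S z" using mem[of "Suc k" z] unfolding h_def by simp
      then have "k \<in> S (z + 1)" using lam_step[of k] k unfolding S_def by auto
      then show ?thesis using mem[of k "z + 1"] k unfolding h_def by simp
    next
      case False
      then show ?thesis unfolding h_def by simp
    qed
    ultimately show "h z = h (z + 1) \<or> h z = h (z + 1) + 1" by linarith
  next
    fix N :: int
    \<comment> \<open>Beyond the first row there are no beads, and below the last row there are only beads.\<close>
    define M where "M = \<bar>N\<bar> + int (lam 1) + int (length l) + 1"
    have "S M = {}" unfolding S_def using lam_le by (fastforce simp: M_def)
    moreover have "S (- M) = {1..nat M}"
    proof -
      have "i \<in> S (- M) \<longleftrightarrow> i \<in> {1..nat M}" for i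
        unfolding S_def lam_def M_def by auto
      then show ?thesis by blast
    qed
    moreover have "M \<ge> N" "M \<ge> 0" unfolding M_def by auto
    ultimately show "\<exists>M\<ge>N. h M = 0 \<and> h (- M) = M" unfolding h_def by (intro exI[of _ M]) simp
  qed
  moreover have "D = diagram h"
  proof -
    have "(i, j) \<in> D \<longleftrightarrow> (i, j) \<in> diagram h" for i j
    proof -
      have "(i, j) \<in> diagram h \<longleftrightarrow> 1 \<le> j \<and> i \<in> S (int j - int i)"
        unfolding diagram_def mem by auto
      also have "\<dots> \<longleftrightarrow> 1 \<le> j \<and> 1 \<le> i \<and> j \<le> lam i" unfolding S_def by auto
      also have "\<dots> \<longleftrightarrow> (i, j) \<in> D"
        unfolding D young_diagram_def lam_def by (cases "1 \<le> i \<and> i \<le> length l") auto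
      finally show ?thesis by simp
    qed
    then show ?thesis by auto
  qed
  ultimately show ?thesis by (rule that)
qed

lemma diagram_inj:
  assumes h: "profile h" and h': "profile h'" and eq: "diagram h = diagram h'"
  shows "h = h'"
proof -
  have le: "f z \<le> g z" if f: "profile f" and g: "profile g" and sub: "diagram f = diagram g" for f g z
  proof (rule ccontr)
    assume "\<not> f z \<le> g z"
    then have gt: "g z < f z" by simp
    have "(nat (f z), nat (f z + z)) \<in> diagram f"
      using gt profile_nonneg[OF g, of z] profile_shift_nonneg[OF g, of z] unfolding diagram_def by auto
    moreover have "(nat (f z), nat (f z + z)) \<notin> diagram g"
      using gt profile_nonneg[OF g, of z] profile_shift_nonneg[OF g, of z] unfolding diagram_def by auto
    ultimately show False using sub by simp
  qed
  show ?thesis using le[OF h h' eq] le[OF h' h eq[symmetric]] by (intro ext) (simp add: order_antisym)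
qed

text \<open>
  The bead \<open>x\<close> is the end of the row \<open>h x\<close>, which consists of the boxes up to column \<open>h x + x\<close>. The gap
  \<open>y\<close> is the end of the column \<open>h y + y + 1\<close>, which consists of the boxes up to row \<open>h y\<close>. The arm and the
  leg of the box where they meet, together with the box, consist of \<open>x - y\<close> boxes.
\<close>

lemma hook_length_bead_gap:
  assumes h: "profile h" and x: "bead h x" and y: "\<not> bead h y" and yx: "y < x"
  shows "(nat (h x), nat (h y + y + 1)) \<in> diagram h"
    and "hook_length (diagram h) (nat (h x), nat (h y + y + 1)) = nat (x - y)"
proof -
  define i where "i = nat (h x)"
  define j where "j = nat (h y + y + 1)"
  have hx: "h x = h (x + 1) + 1" using x unfolding bead_def .
  have hy: "h (y + 1) = h y" using y profile_step[OF h, of y] by simp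
  have i: "int i = h x" "1 \<le> i" unfolding i_def using hx profile_nonneg[OF h, of "x + 1"] by auto
  have j: "int j = h y + y + 1" "1 \<le> j" unfolding j_def using profile_shift_nonneg[OF h, of y] by auto
  have row: "h x \<le> h z \<longleftrightarrow> z \<le> x" for z
    using profile_antimono[OF h, of z x] profile_antimono[OF h, of "x + 1" z] hx by fastforce
  have col: "h y + y + 1 \<le> h z + z \<longleftrightarrow> y < z" for z
    using profile_shift_mono[OF h, of "y + 1" z] profile_shift_mono[OF h, of z y] hy by fastforce
  have mem_row: "(i, j') \<in> diagram h \<longleftrightarrow> 1 \<le> j' \<and> int j' \<le> h x + x" for j'
    unfolding diagram_def using i row[of "int j' - int i"] by auto
  have mem_col: "(i', j) \<in> diagram h \<longleftrightarrow> 1 \<le> i' \<and> int i' \<le> h y" for i'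
    unfolding diagram_def using j col[of "int j - int i'"] by auto
  have jx: "int j \<le> h x + x" using col[of x] yx j by simp
  have iy: "int i \<le> h y" using row[of y] yx i by simp
  show "(nat (h x), nat (h y + y + 1)) \<in> diagram h"
    using mem_row[of j] j jx unfolding i_def j_def by simp
  let ?arm = "Pair i ` {j..nat (h x + x)}"
  let ?leg = "(\<lambda>i'. (i', j)) ` {i<..nat (h y)}"
  have "{c \<in> diagram h. (fst c = i \<and> snd c \<ge> j) \<or> (snd c = j \<and> fst c \<ge> i)} = ?arm \<union> ?leg" (is "?H = _")
  proof -
    have "(a, b) \<in> ?H \<longleftrightarrow> (a, b) \<in> ?arm \<union> ?leg" for a b
    proof -
      have "(a, b) \<in> ?H \<longleftrightarrow> (a = i \<and> j \<le> b \<and> (i, b) \<in> diagram h) \<or> (b = j \<and> i \<le> a \<and> (a, j) \<in> diagram h)"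
        by auto
      also have "\<dots> \<longleftrightarrow> (a = i \<and> j \<le> b \<and> int b \<le> h x + x) \<or> (b = j \<and> i \<le> a \<and> int a \<le> h y)"
        unfolding mem_row mem_col using i(2) j(2) by (meson le_trans)
      also have "\<dots> \<longleftrightarrow> (a = i \<and> j \<le> b \<and> b \<le> nat (h x + x)) \<or> (b = j \<and> i < a \<and> a \<le> nat (h y))"
        using jx iy j(2) i(2) by (cases "a = i") linarith+
      also have "\<dots> \<longleftrightarrow> (a, b) \<in> ?arm \<union> ?leg" by auto
      finally show ?thesis .
    qed
    then show ?thesis by (intro subset_antisym subrelI) blast+
  qed
  moreover have "card (?arm \<union> ?leg) = card ?arm + card ?leg"
    by (rule card_Un_disjoint) auto
  moreover have "card ?arm = Suc (nat (h x + x)) - j" by (subst card_image) (auto simp: inj_on_def)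
  moreover have "card ?leg = nat (h y) - i" by (subst card_image) (auto simp: inj_on_def)
  ultimately have "hook_length (diagram h) (i, j) = Suc (nat (h x + x)) - j + (nat (h y) - i)"
    unfolding hook_length_def fst_conv snd_conv by (simp only:)
  also have "\<dots> = nat (x - y)"
    using i(1) j(1) jx iy yx by linarith
  finally show "hook_length (diagram h) (nat (h x), nat (h y + y + 1)) = nat (x - y)"
    unfolding i_def j_def .
qed

lemma int_cut:
  fixes P :: "int \<Rightarrow> bool"
  assumes "P a" "\<not> P b" "a \<le> b"
  obtains z where "P z" "\<not> P (z + 1)" "a \<le> z" "z < b"
proof (rule ccontr)
  assume "\<not> thesis"
  then have step: "P z \<Longrightarrow> a \<le> z \<Longrightarrow> z < b \<Longrightarrow> P (z + 1)" for z using that by blast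
  have "c \<le> b \<longrightarrow> P c" if "a \<le> c" for c
    using that by (induction c rule: int_ge_induct) (use assms(1) step in auto)
  then show False using assms by blast
qed

lemma profile_crosses:
  assumes h: "profile h" and "1 \<le> k"
  obtains x where "bead h x" "h x = k"
proof -
  obtain M where M: "M \<ge> k" "h M = 0" "h (- M) = M" using h unfolding profile_def by blast
  obtain z where "k \<le> h z" "\<not> k \<le> h (z + 1)"
    by (rule int_cut[of "\<lambda>z. k \<le> h z" "- M" M]) (use M assms(2) in auto)
  then show ?thesis
    using profile_step[OF h, of z] by (intro that[of z]) (auto split: if_splits)
qed

lemma profile_crosses_gap:
  assumes h: "profile h" and "1 \<le> k"
  obtains y where "\<not> bead h y" "h y + y + 1 = k"
proof -
  obtain M where M: "M \<ge> k" "h M = 0" "h (- M) = M" using h unfolding profile_def by blast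
  obtain z where "h z + z < k" "\<not> h (z + 1) + (z + 1) < k"
    by (rule int_cut[of "\<lambda>z. h z + z < k" "- M" M]) (use M assms(2) in auto)
  then show ?thesis
    using profile_step[OF h, of z] by (intro that[of z]) (auto split: if_splits)
qed

text \<open>
  Every box arises as in the preceding count, since a profile takes all values between its extremes.
\<close>

lemma diagram_box_bead_gap:
  assumes h: "profile h" and b: "b \<in> diagram h"
  obtains x y where "bead h x" "\<not> bead h y" "y < x" "b = (nat (h x), nat (h y + y + 1))"
proof -
  obtain i j where ij: "b = (i, j)" by (cases b)
  have le: "1 \<le> i" "1 \<le> j" "int i \<le> h (int j - int i)"
    using b unfolding ij diagram_def by auto
  obtain x where x: "bead h x" "h x = int i" using profile_crosses[OF h, of "int i"] le by auto
  obtain y where y: "\<not> bead h y" "h y + y + 1 = int j" using profile_crosses_gap[OF h, of "int j"] le by auto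
  have "\<not> x \<le> y"
  proof
    assume xy: "x \<le> y"
    consider "int j - int i \<le> y" | "x + 1 \<le> int j - int i" using xy by linarith
    then show False
    proof cases
      case 1
      then show False using profile_shift_mono[OF h, of "int j - int i" y] le y by simp
    next
      case 2
      then show False using profile_antimono[OF h, of "x + 1" "int j - int i"] le x
        unfolding bead_def by simp
    qed
  qed
  then show ?thesis using x y ij by (intro that[of x y]) auto
qed

text \<open>
  A bead \<open>z\<close> with a gap at \<open>z - t\<close> gives a hook of length \<open>t\<close>. Conversely, if the beads are closed under
  subtracting \<open>t\<close>, then a hook whose length is a multiple of \<open>t\<close> would lead from a bead down to a gap.
\<close>

lemma core_iff_beads_closed:
  assumes h: "profile h" and t: "1 \<le> t"
  shows "diagram h \<in> cores t \<longleftrightarrow> (\<forall>z. bead h z \<longrightarrow> bead h (z - int t))"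
proof
  assume core: "diagram h \<in> cores t"
  show "\<forall>z. bead h z \<longrightarrow> bead h (z - int t)"
  proof (intro allI impI, rule ccontr)
    fix z assume z: "bead h z" "\<not> bead h (z - int t)"
    have "z - int t < z" using t by simp
    note hl = hook_length_bead_gap[OF h z this]
    have "\<not> t dvd nat (z - (z - int t))" using core hl unfolding cores_def by auto
    then show False by simp
  qed
next
  assume closed: "\<forall>z. bead h z \<longrightarrow> bead h (z - int t)"
  have iter: "bead h (z - int k * int t)" if "bead h z" for z k
  proof (induction k)
    case (Suc k)
    then have "bead h (z - int k * int t - int t)" using closed by blast
    then show ?case by (simp add: algebra_simps)
  qed (use that in simp)
  have "\<not> t dvd hook_length (diagram h) b" if "b \<in> diagram h" for b
  proof
    assume dvd: "t dvd hook_length (diagram h) b"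
    obtain x y where xy: "bead h x" "\<not> bead h y" "y < x" "b = (nat (h x), nat (h y + y + 1))"
      using diagram_box_bead_gap[OF h \<open>b \<in> diagram h\<close>] .
    then have "t dvd nat (x - y)" using dvd hook_length_bead_gap(2)[OF h xy(1-3)] by simp
    then obtain k where "nat (x - y) = t * k" by (elim dvdE)
    then have "x - y = int k * int t" using xy(3) by (metis int_nat_eq less_imp_le mult.commute of_nat_mult diff_ge_0_iff_ge)
    then have "y = x - int k * int t" by simp
    then show False using iter[OF xy(1), of k] xy(2) by simp
  qed
  then show "diagram h \<in> cores t" unfolding cores_def using diagram_in_partitions[OF h] by auto
qed

lemma profile_update:
  assumes h: "profile h" and right: "v = h (z + 1) \<or> v = h (z + 1) + 1"
    and left: "h (z - 1) = v \<or> h (z - 1) = v + 1"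
  shows "profile (h(z := v))"
  unfolding profile_def
proof (intro conjI allI)
  fix y
  show "(h(z := v)) y = (h(z := v)) (y + 1) \<or> (h(z := v)) y = (h(z := v)) (y + 1) + 1"
  proof (cases "y = z \<or> y = z - 1")
    case True
    then show ?thesis using right left by auto
  next
    case False
    then have "y \<noteq> z" "y + 1 \<noteq> z" by auto
    then show ?thesis using profile_step[OF h, of y] by auto
  qed
next
  fix N
  obtain M where "M \<ge> max N (\<bar>z\<bar> + 1)" "h M = 0" "h (- M) = M" using h unfolding profile_def by blast
  then show "\<exists>M\<ge>N. (h(z := v)) M = 0 \<and> (h(z := v)) (- M) = M" by (intro exI[of _ M]) auto
qed

text \<open>
  Moving a bead from \<open>z - 1\<close> to \<open>z\<close> changes the profile at \<open>z\<close> only and adds the next box on the diagonal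
  of content \<open>z\<close>.
\<close>

lemma diagram_bump:
  assumes h: "profile h" and z: "bead h (z - 1)" "\<not> bead h z"
  shows "profile (h(z := h z + 1))"
    and "diagram (h(z := h z + 1)) = insert (nat (h z + 1), nat (h z + z + 1)) (diagram h)"
    and "(nat (h z + 1), nat (h z + z + 1)) \<notin> diagram h"
proof -
  have hz: "h (z + 1) = h z" "h (z - 1) = h z + 1"
    using z profile_step[OF h, of z] profile_step_minus[OF h, of z] by auto
  have nn: "0 \<le> h z" "0 \<le> h z + z" using profile_nonneg[OF h] profile_shift_nonneg[OF h] by auto
  show "profile (h(z := h z + 1))" by (rule profile_update[OF h]) (use hz in auto)
  have "(i, j) \<in> diagram (h(z := h z + 1)) \<longleftrightarrow>
      (i, j) \<in> insert (nat (h z + 1), nat (h z + z + 1)) (diagram h)" for i j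
    unfolding diagram_def using nn by auto
  then show "diagram (h(z := h z + 1)) = insert (nat (h z + 1), nat (h z + z + 1)) (diagram h)" by auto
  show "(nat (h z + 1), nat (h z + z + 1)) \<notin> diagram h" unfolding diagram_def using nn by auto
qed

text \<open>
  A box can only be added at the end of its diagonal. The order ideal condition on its left and upper
  neighbours forces a bead at \<open>z - 1\<close> and a gap at \<open>z\<close>.
\<close>

lemma addable_diagram:
  assumes h: "profile h"
  shows "addable (diagram h) b \<longleftrightarrow>
    (\<exists>z. b = (nat (h z + 1), nat (h z + z + 1)) \<and> bead h (z - 1) \<and> \<not> bead h z)"
proof
  assume add: "addable (diagram h) b"
  obtain i j where b: "b = (i, j)" by (cases b)
  define z where "z = int j - int i"
  have ins: "insert (i, j) (diagram h) \<in> partitions" and notin: "(i, j) \<notin> diagram h"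
    using add unfolding addable_def b by auto
  have pos: "1 \<le> i" "1 \<le> j" using ins unfolding partitions_iff by blast+
  have gt: "h z < int i" using notin pos unfolding diagram_def z_def by auto
  have up: "int i \<le> h (z + 1) + 1"
  proof (cases "i = 1")
    case True
    then show ?thesis using profile_nonneg[OF h, of "z + 1"] by simp
  next
    case False
    then obtain k where k: "i = Suc k" "1 \<le> k" using pos by (cases i) auto
    then have "(k, j) \<in> insert (i, j) (diagram h)" using ins unfolding partitions_iff by blast
    then have "(k, j) \<in> diagram h" using k by simp
    then show ?thesis using k unfolding diagram_def z_def by (simp add: algebra_simps)
  qed
  have left: "int i \<le> h (z - 1)"
  proof (cases "j = 1")
    case True
    then show ?thesis using profile_shift_nonneg[OF h, of "z - 1"] unfolding z_def by simp
  next
    case False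
    then obtain k where k: "j = Suc k" "1 \<le> k" using pos by (cases j) auto
    then have "(i, k) \<in> insert (i, j) (diagram h)" using ins unfolding partitions_iff by blast
    then have "(i, k) \<in> diagram h" using k by simp
    then show ?thesis using k unfolding diagram_def z_def by (simp add: algebra_simps)
  qed
  have "h z = int i - 1" "bead h (z - 1)" "\<not> bead h z"
    using gt up left profile_step[OF h, of z] profile_step_minus[OF h, of z] by (auto split: if_splits)
  then show "\<exists>z. b = (nat (h z + 1), nat (h z + z + 1)) \<and> bead h (z - 1) \<and> \<not> bead h z"
    unfolding b using z_def by (intro exI[of _ z]) auto
next
  assume "\<exists>z. b = (nat (h z + 1), nat (h z + z + 1)) \<and> bead h (z - 1) \<and> \<not> bead h z"
  then obtain z where b: "b = (nat (h z + 1), nat (h z + z + 1))" and z: "bead h (z - 1)" "\<not> bead h z"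
    by blast
  show "addable (diagram h) b"
    unfolding addable_def b diagram_bump(2)[OF h z, symmetric]
    using diagram_bump(3)[OF h z] diagram_in_partitions[OF diagram_bump(1)[OF h z]] by blast
qed

lemma removable_diagram:
  assumes h: "profile h"
  shows "removable (diagram h) b \<longleftrightarrow>
    (\<exists>z. b = (nat (h z), nat (h z + z)) \<and> \<not> bead h (z - 1) \<and> bead h z)"
proof
  assume "removable (diagram h) b"
  then have b_in: "b \<in> diagram h" and "diagram h - {b} \<in> partitions" unfolding removable_def by auto
  then obtain h' where h': "profile h'" "diagram h - {b} = diagram h'" using partition_is_diagram by metis
  then have ins: "insert b (diagram h') = diagram h" using b_in by auto
  moreover have "b \<notin> diagram h'" using h'(2) by auto
  ultimately have "addable (diagram h') b" unfolding addable_def using diagram_in_partitions[OF h] by simp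
  then obtain z where b: "b = (nat (h' z + 1), nat (h' z + z + 1))" and z: "bead h' (z - 1)" "\<not> bead h' z"
    unfolding addable_diagram[OF h'(1)] by blast
  have hz: "h' (z + 1) = h' z" "h' (z - 1) = h' z + 1"
    using z profile_step[OF h'(1), of z] profile_step_minus[OF h'(1), of z] by auto
  have "diagram h = diagram (h'(z := h' z + 1))" using ins diagram_bump(2)[OF h'(1) z] unfolding b by simp
  then have "h = h'(z := h' z + 1)" by (rule diagram_inj[OF h diagram_bump(1)[OF h'(1) z]])
  then have "h z = h' z + 1" "h (z - 1) = h z" "h z = h (z + 1) + 1" using hz by auto
  then show "\<exists>z. b = (nat (h z), nat (h z + z)) \<and> \<not> bead h (z - 1) \<and> bead h z"
    unfolding b bead_def by (intro exI[of _ z]) (auto simp: algebra_simps)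
next
  assume "\<exists>z. b = (nat (h z), nat (h z + z)) \<and> \<not> bead h (z - 1) \<and> bead h z"
  then obtain z where b: "b = (nat (h z), nat (h z + z))" and z: "\<not> bead h (z - 1)" "bead h z" by blast
  have hz: "h z = h (z + 1) + 1" "h (z - 1) = h z"
    using z profile_step[OF h, of z] profile_step_minus[OF h, of z] by auto
  have nn: "1 \<le> h z" "1 \<le> h z + z"
    using hz profile_nonneg[OF h, of "z + 1"] profile_shift_nonneg[OF h, of "z - 1"] by auto
  define h' where "h' = h(z := h z - 1)"
  have "profile h'" unfolding h'_def by (rule profile_update[OF h]) (use hz in auto)
  moreover have "diagram h - {b} = diagram h'"
  proof -
    have "(i, j) \<in> diagram h - {b} \<longleftrightarrow> (i, j) \<in> diagram h'" for i j
      unfolding b diagram_def h'_def using nn by auto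
    then show ?thesis by auto
  qed
  ultimately have "diagram h - {b} \<in> partitions" using diagram_in_partitions by simp
  moreover have "b \<in> diagram h" unfolding b diagram_def using nn by auto
  ultimately show "removable (diagram h) b" unfolding removable_def by simp
qed


section \<open>Cores as integer vectors\<close>

definition int_lattice :: "nat \<Rightarrow> vec set" where
  "int_lattice n = {c \<in> V n. \<forall>i. c i \<in> \<int>}"

text \<open>
  The profile with beads exactly at the positions \<open>z\<close> with \<open>z div n < c\<^sub>r\<close>, where \<open>r = z mod n + 1\<close>. The
  \<open>r\<close>-th summand counts the integers \<open>t < c\<^sub>r\<close> with \<open>r - 1 + n t \<ge> z\<close>, the beads of the \<open>r\<close>-th residue class.
\<close>

definition height :: "nat \<Rightarrow> vec \<Rightarrow> int \<Rightarrow> int" where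
  "height n c z = (\<Sum>r=1..n. max 0 (\<lfloor>c r\<rfloor> + (int r - 1 - z) div int n))"

definition core_of :: "nat \<Rightarrow> vec \<Rightarrow> box set" where
  "core_of n c = diagram (height n c)"

lemma div_minus_one:
  fixes a n :: int
  assumes "0 < n"
  shows "(a - 1) div n = a div n - (if n dvd a then 1 else 0)"
proof (cases "n dvd a")
  case True
  then obtain k where "a = n * k" by (elim dvdE)
  moreover have "(n * k - 1) div n = k - 1"
    by (rule int_div_pos_eq[of _ _ _ "n - 1"]) (use assms in \<open>auto simp: algebra_simps\<close>)
  ultimately show ?thesis using assms by simp
next
  case False
  then have "0 < a mod n" using assms by (simp add: dvd_eq_mod_eq_0 order_less_le)
  moreover have "a mod n < n" using assms by simp
  moreover have "a = n * (a div n) + a mod n" by simp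
  ultimately have "(a - 1) div n = a div n"
    by (intro int_div_pos_eq[of _ _ _ "a mod n - 1"]) linarith+
  then show ?thesis using False by simp
qed

lemma residue_index:
  fixes z :: int
  assumes "1 \<le> r" "r \<le> n"
  shows "int n dvd int r - 1 - z \<longleftrightarrow> r = nat (z mod int n) + 1"
proof -
  have "int n dvd int r - 1 - z \<longleftrightarrow> (int r - 1) mod int n = z mod int n"
    by (simp add: mod_eq_dvd_iff)
  also have "(int r - 1) mod int n = int r - 1" using assms by simp
  finally show ?thesis using assms by (auto simp: nat_eq_iff)
qed

lemma height_step:
  assumes n: "1 \<le> n"
  shows "height n c z = height n c (z + 1) +
           (if z div int n < \<lfloor>c (nat (z mod int n) + 1)\<rfloor> then 1 else 0)"
proof -
  define q where "q = nat (z mod int n) + 1"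
  have "z mod int n < int n" "0 \<le> z mod int n" using n by auto
  then have q: "q \<in> {1..n}" "int q - 1 = z mod int n" unfolding q_def by auto
  let ?t = "\<lambda>z r. max 0 (\<lfloor>c r\<rfloor> + (int r - 1 - z) div int n)"
  have "?t (z + 1) r = ?t z r" if "r \<in> {1..n} - {q}" for r
    using div_minus_one[of "int n" "int r - 1 - z"] residue_index[of r n z] that n
    unfolding q_def by (auto simp: algebra_simps)
  then have "sum (?t (z + 1)) ({1..n} - {q}) = sum (?t z) ({1..n} - {q})"
    by (intro sum.cong HOL.refl) blast
  moreover have "?t z q = ?t (z + 1) q + (if z div int n < \<lfloor>c q\<rfloor> then 1 else 0)"
  proof -
    have e: "int q - 1 - z = - (z div int n) * int n"
      using q(2) by (simp add: minus_div_mult_eq_mod[symmetric])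
    have "- (z div int n) * int n div int n = - (z div int n)"
      by (rule nonzero_mult_div_cancel_right) (use n in simp)
    then have d: "(int q - 1 - z) div int n = - (z div int n)" "int n dvd int q - 1 - z"
      unfolding e by auto
    have "(int q - 1 - (z + 1)) div int n = - (z div int n) - 1"
      using div_minus_one[of "int n" "int q - 1 - z"] d n by (simp add: algebra_simps)
    with d show ?thesis by auto
  qed
  ultimately show ?thesis
    unfolding height_def q_def[symmetric] using q(1) by (simp add: sum.remove[of _ q])
qed

lemma bead_height:
  assumes "1 \<le> n"
  shows "bead (height n c) z \<longleftrightarrow> z div int n < \<lfloor>c (nat (z mod int n) + 1)\<rfloor>"
  unfolding bead_def using height_step[OF assms, of c z] by auto

lemma bead_height_index:
  assumes "1 \<le> n" "r \<in> {1..n}"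
  shows "bead (height n c) (int r - 1 + int n * t) \<longleftrightarrow> t < \<lfloor>c r\<rfloor>"
proof -
  have "(int r - 1 + int n * t) div int n = t" "(int r - 1 + int n * t) mod int n = int r - 1"
    using assms by simp_all
  then show ?thesis unfolding bead_height[OF assms(1)] using assms by (simp add: nat_diff_distrib)
qed

lemma height_bound:
  fixes c :: vec
  obtains K where "\<And>r. r \<in> {1..n} \<Longrightarrow> \<bar>\<lfloor>c r\<rfloor>\<bar> \<le> K" "0 \<le> (K :: int)"
proof -
  let ?K = "\<Sum>r=1..n. \<bar>\<lfloor>c r\<rfloor>\<bar>"
  have "\<bar>\<lfloor>c r\<rfloor>\<bar> \<le> ?K" if "r \<in> {1..n}" for r
    using that by (intro member_le_sum) auto
  then show ?thesis by (rule that) (auto intro: sum_nonneg)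
qed

lemma height_far_right:
  assumes n: "1 \<le> n"
  obtains M where "\<And>z. M \<le> z \<Longrightarrow> height n c z = 0"
proof -
  obtain K where K: "\<And>r. r \<in> {1..n} \<Longrightarrow> \<bar>\<lfloor>c r\<rfloor>\<bar> \<le> K" "0 \<le> K"
    using height_bound[of n c] by metis
  have "height n c z = 0" if z: "int n * (K + 1) \<le> z" for z
    unfolding height_def
  proof (intro sum.neutral ballI)
    fix r assume r: "r \<in> {1..n}"
    have "(int r - 1 - z) div int n \<le> (int n * (- K - 1) + (int n - 1)) div int n"
      using r z n by (intro zdiv_mono1) (auto simp: algebra_simps)
    also have "\<dots> = - K - 1" using n by simp
    finally show "max 0 (\<lfloor>c r\<rfloor> + (int r - 1 - z) div int n) = 0" using K(1)[OF r] by simp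
  qed
  then show ?thesis by (rule that)
qed

text \<open>
  At the multiples of \<open>n\<close> far to the left every maximum is attained by its second argument, so the sum
  of the entries of \<open>c\<close> is the charge of the bead configuration.
\<close>

lemma height_far_left:
  assumes n: "1 \<le> n"
  obtains K0 where "0 \<le> K0" "\<And>K. K0 \<le> K \<Longrightarrow> height n c (- (int n * K)) = int n * K + (\<Sum>r=1..n. \<lfloor>c r\<rfloor>)"
proof -
  obtain K0 where K0: "\<And>r. r \<in> {1..n} \<Longrightarrow> \<bar>\<lfloor>c r\<rfloor>\<bar> \<le> K0" "0 \<le> K0"
    using height_bound[of n c] by metis
  have "height n c (- (int n * K)) = int n * K + (\<Sum>r=1..n. \<lfloor>c r\<rfloor>)" if K: "K0 \<le> K" for K
  proof -
    have "height n c (- (int n * K)) = (\<Sum>r=1..n. \<lfloor>c r\<rfloor> + K)"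
      unfolding height_def
    proof (intro sum.cong HOL.refl)
      fix r assume r: "r \<in> {1..n}"
      have "(int r - 1 - - (int n * K)) div int n = K"
        using r n by simp
      then show "max 0 (\<lfloor>c r\<rfloor> + (int r - 1 - - (int n * K)) div int n) = \<lfloor>c r\<rfloor> + K"
        using K0(1)[OF r] K by simp
    qed
    then show ?thesis by (simp add: sum.distrib)
  qed
  then show ?thesis using K0(2) by (rule that[rotated])
qed

lemma profile_height_iff:
  assumes n: "1 \<le> n"
  shows "profile (height n c) \<longleftrightarrow> (\<Sum>r=1..n. \<lfloor>c r\<rfloor>) = 0"
proof -
  obtain K0 where K0: "0 \<le> K0" "\<And>K. K0 \<le> K \<Longrightarrow> height n c (- (int n * K)) = int n * K + (\<Sum>r=1..n. \<lfloor>c r\<rfloor>)"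
    using height_far_left[OF n] by metis
  obtain M where M: "\<And>z. M \<le> z \<Longrightarrow> height n c z = 0" using height_far_right[OF n] by metis
  have big: "\<exists>K\<ge>K0. N \<le> int n * K" for N
  proof (intro exI conjI)
    have "N \<le> 1 * (K0 + \<bar>N\<bar>)" using K0(1) by simp
    also have "\<dots> \<le> int n * (K0 + \<bar>N\<bar>)" using n K0(1) by (intro mult_right_mono) auto
    finally show "N \<le> int n * (K0 + \<bar>N\<bar>)" .
  qed simp
  show ?thesis
  proof
    assume p: "profile (height n c)"
    obtain N where N: "0 \<le> N" "\<And>z. N \<le> z \<Longrightarrow> height n c (- z) = z" using profile_vanishes[OF p] by metis
    obtain K where "K0 \<le> K" "N \<le> int n * K" using big by blast
    then show "(\<Sum>r=1..n. \<lfloor>c r\<rfloor>) = 0" using K0(2)[of K] N(2)[of "int n * K"] by simp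
  next
    assume 0: "(\<Sum>r=1..n. \<lfloor>c r\<rfloor>) = 0"
    show "profile (height n c)"
      unfolding profile_def
    proof (intro conjI allI)
      fix z
      show "height n c z = height n c (z + 1) \<or> height n c z = height n c (z + 1) + 1"
        using height_step[OF n, of c z] by auto
    next
      fix N
      obtain K where "K0 \<le> K" "max N M \<le> int n * K" using big by blast
      then show "\<exists>M\<ge>N. height n c M = 0 \<and> height n c (- M) = M"
        using K0(2)[of K] M[of "int n * K"] 0 by (intro exI[of _ "int n * K"]) simp
    qed
  qed
qed

lemma sum_floor_lattice:
  assumes "c \<in> int_lattice n" shows "(\<Sum>r=1..n. \<lfloor>c r\<rfloor>) = 0"
proof -
  have "real_of_int (\<Sum>r=1..n. \<lfloor>c r\<rfloor>) = (\<Sum>r=1..n. c r)"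
    using assms unfolding int_lattice_def by (auto intro!: sum.cong)
  also have "\<dots> = 0" using assms unfolding int_lattice_def V_def by simp
  finally show ?thesis by linarith
qed

lemma profile_height:
  assumes "1 \<le> n" "c \<in> int_lattice n" shows "profile (height n c)"
  using assms profile_height_iff sum_floor_lattice by simp

lemma height_beads_inj:
  assumes n: "1 \<le> n" and c: "c \<in> int_lattice n" "c' \<in> int_lattice n"
    and eq: "height n c = height n c'"
  shows "c = c'"
proof
  fix r
  have f: "c r = of_int \<lfloor>c r\<rfloor>" "c' r = of_int \<lfloor>c' r\<rfloor>"
    using c unfolding int_lattice_def by simp_all
  show "c r = c' r"
  proof (cases "r \<in> {1..n}")
    case True
    have "t < \<lfloor>c r\<rfloor> \<longleftrightarrow> t < \<lfloor>c' r\<rfloor>" for t 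
      using bead_height_index[OF n True, of c t] bead_height_index[OF n True, of c' t] eq by simp
    then have "\<lfloor>c r\<rfloor> = \<lfloor>c' r\<rfloor>" by (metis linorder_neqE order_less_irrefl)
    then show ?thesis using f by simp
  next
    case False
    then show ?thesis using c unfolding int_lattice_def V_def by simp
  qed
qed

lemma core_of_inj:
  assumes "1 \<le> n" shows "inj_on (core_of n) (int_lattice n)"
proof (rule inj_onI)
  fix c c' assume c: "c \<in> int_lattice n" "c' \<in> int_lattice n" "core_of n c = core_of n c'"
  then have "height n c = height n c'"
    unfolding core_of_def using diagram_inj profile_height[OF assms] by blast
  then show "c = c'" using height_beads_inj[OF assms] c by blast
qed

lemma core_of_in_cores:
  assumes n: "1 \<le> n" and c: "c \<in> int_lattice n"
  shows "core_of n c \<in> cores n"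
  unfolding core_of_def core_iff_beads_closed[OF profile_height[OF n c] n] bead_height[OF n]
proof (intro allI impI)
  fix z assume "z div int n < \<lfloor>c (nat (z mod int n) + 1)\<rfloor>"
  moreover have "(z - int n) div int n = z div int n - 1" using n div_add_self2[of "int n" "z - int n"] by simp
  ultimately show "(z - int n) div int n < \<lfloor>c (nat ((z - int n) mod int n) + 1)\<rfloor>" by simp
qed

text \<open>
  In each residue class the beads of an \<open>n\<close>-core are closed downwards, bounded above and not empty, so
  they form a ray; \<open>c\<close> collects the end points. Two profiles with the same beads that vanish far to the
  right are equal, and the sum of \<open>c\<close> is zero because the charge is.
\<close>

lemma core_of_surj:
  assumes n: "1 \<le> n" and D: "D \<in> cores n"
  shows "D \<in> core_of n ` int_lattice n"
proof -
  obtain h where h: "profile h" and Dh: "D = diagram h"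
    using D partition_is_diagram unfolding cores_def by blast
  have closed: "bead h (z - int n)" if "bead h z" for z
    using D that unfolding Dh core_iff_beads_closed[OF h n] by blast
  obtain M where M: "M \<ge> 0" "\<And>z. z \<ge> M \<Longrightarrow> h z = 0" "\<And>z. z \<ge> M \<Longrightarrow> h (- z) = z"
    by (rule profile_vanishes[OF h], blast)
  have "\<exists>d. \<forall>t. bead h (int r - 1 + int n * t) \<longleftrightarrow> t < d" if r: "r \<in> {1..n}" for r
  proof -
    let ?P = "\<lambda>t. bead h (int r - 1 + int n * t)"
    have down: "?P (t - 1)" if "?P t" for t
      using closed[OF that] by (simp add: algebra_simps)
    have le: "?P s" if "?P t" "s \<le> t" for s t
      using that(2,1) by (induction s rule: int_le_induct) (use down in auto)
    have "- (int r - 1 + int n * (- M - 2)) - 1 \<ge> M" 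
    proof -
      have "1 * M \<le> int n * M" using n M(1) by (intro mult_right_mono) auto
      then have "int n * (M + 2) \<ge> 1 * M + int n * 2" by (simp add: algebra_simps)
      then show ?thesis using r n by (auto simp: algebra_simps)
    qed
    then have low: "?P (- M - 2)"
      using M(3)[of "- (int r - 1 + int n * (- M - 2))"] M(3)[of "- (int r - 1 + int n * (- M - 2)) - 1"]
      unfolding bead_def by (simp add: algebra_simps)
    have "1 * M \<le> int n * M" using n M(1) by (intro mult_right_mono) auto
    then have "int r - 1 + int n * M \<ge> M" using r by simp
    then have high: "\<not> ?P M"
      using M(2)[of "int r - 1 + int n * M"] M(2)[of "int r - 1 + int n * M + 1"]
      unfolding bead_def by simp
    obtain d where d: "?P d" "\<not> ?P (d + 1)"
      by (rule int_cut[of ?P "- M - 2" M]) (use low high M(1) in auto)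
    have "?P t \<longleftrightarrow> t < d + 1" for t
      using le[of d t] le[of t "d + 1"] d by (cases "t \<le> d") auto
    then show ?thesis by blast
  qed
  then obtain d where d: "\<And>r t. r \<in> {1..n} \<Longrightarrow> bead h (int r - 1 + int n * t) \<longleftrightarrow> t < d r" by metis
  define c where "c r = (if r \<in> {1..n} then real_of_int (d r) else 0)" for r
  have bead_eq: "bead h z \<longleftrightarrow> bead (height n c) z" for z
  proof -
    define r where "r = nat (z mod int n) + 1"
    have "z mod int n < int n" "0 \<le> z mod int n" using n by auto
    then have r: "r \<in> {1..n}" "int r - 1 = z mod int n" unfolding r_def by auto
    then have "int r - 1 + int n * (z div int n) = z" by simp
    then show ?thesis
      using d[OF r(1), of "z div int n"] r(1) unfolding bead_height[OF n] r_def[symmetric] c_def by simp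
  qed
  obtain M' where M': "\<And>z. M' \<le> z \<Longrightarrow> height n c z = 0" using height_far_right[OF n] by metis
  have "h z = height n c z" for z
  proof (cases "max M M' \<le> z")
    case True
    then show ?thesis using M(2) M' by simp
  next
    case False
    then have "z \<le> max M M'" using le_cases[of z "max M M'"] by blast
    then show ?thesis
    proof (induction z rule: int_le_induct)
      case base
      then show ?case using M(2) M' by simp
    next
      case (step z)
      then show ?case
        using profile_step[OF h, of "z - 1"] height_step[OF n, of c "z - 1"] bead_eq[of "z - 1"]
        unfolding bead_height[OF n] by simp
    qed
  qed
  then have eq: "h = height n c" by blast
  then have "(\<Sum>r=1..n. \<lfloor>c r\<rfloor>) = 0" using profile_height_iff[OF n] h by simp
  moreover have "(\<Sum>r=1..n. \<lfloor>c r\<rfloor>) = (\<Sum>r=1..n. d r)"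
    by (rule sum.cong) (auto simp: c_def)
  ultimately have "(\<Sum>r=1..n. d r) = 0" by simp
  moreover have "(\<Sum>r=1..n. c r) = (\<Sum>r=1..n. real_of_int (d r))"
    by (rule sum.cong) (auto simp: c_def)
  ultimately have "(\<Sum>r=1..n. c r) = 0" by (simp flip: of_int_sum)
  then have "c \<in> int_lattice n" unfolding int_lattice_def V_def c_def by auto
  then show ?thesis unfolding Dh eq core_of_def by blast
qed

text \<open>
  Subtracting \<open>mn + 1\<close> moves a bead of class \<open>i + 1\<close> to class \<open>i\<close>, \<open>m\<close> steps down, but a bead of class \<open>1\<close> to
  class \<open>n\<close>, \<open>m + 1\<close> steps down. It suffices to look at the last bead of each class.
\<close>

lemma core_of_simultaneous_core:
  assumes n: "2 \<le> n" and c: "c \<in> int_lattice n"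
  shows "core_of n c \<in> cores (m * n + 1) \<longleftrightarrow>
    (\<forall>i\<in>{1..<n}. c (i + 1) - c i \<le> real m) \<and> c 1 - c n \<le> real m + 1"
proof -
  have n1: "1 \<le> n" using n by simp
  have f: "c r = of_int \<lfloor>c r\<rfloor>" for r using c unfolding int_lattice_def by simp
  note idx = bead_height_index[OF n1]
  have split: "\<exists>r\<in>{1..n}. \<exists>t. z = int r - 1 + int n * t" for z
    by (rule bexI[of _ "nat (z mod int n) + 1"], rule exI[of _ "z div int n"]) (use n in \<open>auto simp: nat_less_iff Suc_le_eq\<close>)
  have A: "(\<forall>t<\<lfloor>c (i + 1)\<rfloor>. bead (height n c) (int (i + 1) - 1 + int n * t - int (m * n + 1)))
      \<longleftrightarrow> c (i + 1) - c i \<le> real m" if i: "i \<in> {1..<n}" for i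
  proof -
    have e: "int (i + 1) - 1 + int n * t - int (m * n + 1) = int i - 1 + int n * (t - int m)" for t
      by (simp add: algebra_simps)
    have "(\<forall>t<\<lfloor>c (i + 1)\<rfloor>. bead (height n c) (int (i + 1) - 1 + int n * t - int (m * n + 1)))
      \<longleftrightarrow> (\<forall>t<\<lfloor>c (i + 1)\<rfloor>. t - int m < \<lfloor>c i\<rfloor>)" unfolding e by (subst idx) (use i in auto)
    also have "\<dots> \<longleftrightarrow> \<lfloor>c (i + 1)\<rfloor> - \<lfloor>c i\<rfloor> \<le> int m"
      by (auto dest: spec[of _ "\<lfloor>c (i + 1)\<rfloor> - 1"])
    also have "\<dots> \<longleftrightarrow> c (i + 1) - c i \<le> real m"
      by (subst (2) f, subst (2) f) linarith
    finally show ?thesis .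
  qed
  have B: "(\<forall>t<\<lfloor>c 1\<rfloor>. bead (height n c) (int 1 - 1 + int n * t - int (m * n + 1)))
      \<longleftrightarrow> c 1 - c n \<le> real m + 1"
  proof -
    have e: "int 1 - 1 + int n * t - int (m * n + 1) = int n - 1 + int n * (t - int m - 1)" for t
      by (simp add: algebra_simps)
    have "(\<forall>t<\<lfloor>c 1\<rfloor>. bead (height n c) (int 1 - 1 + int n * t - int (m * n + 1)))
      \<longleftrightarrow> (\<forall>t<\<lfloor>c 1\<rfloor>. t - int m - 1 < \<lfloor>c n\<rfloor>)" unfolding e by (subst idx) (use n in auto)
    also have "\<dots> \<longleftrightarrow> \<lfloor>c 1\<rfloor> - \<lfloor>c n\<rfloor> \<le> int m + 1"
      by (auto dest: spec[of _ "\<lfloor>c 1\<rfloor> - 1"])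
    also have "\<dots> \<longleftrightarrow> c 1 - c n \<le> real m + 1"
      by (subst (2) f, subst (2) f) linarith
    finally show ?thesis .
  qed
  have "core_of n c \<in> cores (m * n + 1) \<longleftrightarrow>
      (\<forall>z. bead (height n c) z \<longrightarrow> bead (height n c) (z - int (m * n + 1)))"
    unfolding core_of_def by (rule core_iff_beads_closed[OF profile_height[OF n1 c]]) simp
  also have "\<dots> \<longleftrightarrow> (\<forall>r\<in>{1..n}. \<forall>t<\<lfloor>c r\<rfloor>. bead (height n c) (int r - 1 + int n * t - int (m * n + 1)))"
    using idx split by metis
  also have "{1..n} = insert 1 ((\<lambda>i. i + 1) ` {1..<n})"
  proof -
    have "r \<in> insert 1 ((\<lambda>i. i + 1) ` {1..<n})" if "r \<in> {1..n}" for r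
      by (cases "r = 1") (use that in \<open>auto intro!: image_eqI[of _ _ "r - 1"]\<close>)
    then show ?thesis using n by auto
  qed
  also have "(\<forall>r\<in>\<dots>. \<forall>t<\<lfloor>c r\<rfloor>. bead (height n c) (int r - 1 + int n * t - int (m * n + 1)))
      \<longleftrightarrow> c 1 - c n \<le> real m + 1 \<and> (\<forall>i\<in>{1..<n}. c (i + 1) - c i \<le> real m)"
    unfolding ball_simps(7) bex_simps ball_simps using A B by simp
  finally show ?thesis by blast
qed


section \<open>The generators acting on cores\<close>

lemma sum_change_two:
  fixes f g :: "nat \<Rightarrow> 'a::comm_monoid_add"
  assumes xy: "x \<in> {1..n}" "y \<in> {1..n}" "x \<noteq> y" and two: "f x + f y = g x + g y"
    and other: "\<And>z. z \<noteq> x \<Longrightarrow> z \<noteq> y \<Longrightarrow> f z = g z"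
  shows "sum f {1..n} = sum g {1..n}"
proof -
  have split: "sum h {1..n} = h x + h y + sum h ({1..n} - {x} - {y})" for h :: "nat \<Rightarrow> 'a"
    using xy by (simp add: sum.remove[of _ x] sum.remove[of _ y] add.assoc)
  have "sum f ({1..n} - {x} - {y}) = sum g ({1..n} - {x} - {y})" by (rule sum.cong) (auto simp: other)
  then show ?thesis unfolding split[of f] split[of g] two by simp
qed

lemma gen_vec_simps:
  shows "gen_vec n 0 a = a(1 := a n + 1, n := a 1 - 1)"
    and "i \<noteq> 0 \<Longrightarrow> gen_vec n i a = a(i := a (i + 1), i + 1 := a i)"
  unfolding gen_vec_def by simp_all

text \<open>
  A generator rearranges two coordinates and, for \<open>i = 0\<close>, shifts them by opposite units.
\<close>

lemma gen_vec_V: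
  assumes n: "2 \<le> n" and i: "i < n" and a: "a \<in> V n"
  shows "gen_vec n i a \<in> V n"
proof -
  have "sum (gen_vec n i a) {1..n} = sum a {1..n}"
  proof (cases "i = 0")
    case True
    show ?thesis by (rule sum_change_two[of 1 n n]) (use n True in \<open>auto simp: gen_vec_simps\<close>)
  next
    case False
    show ?thesis by (rule sum_change_two[of i n "i + 1"]) (use i False in \<open>auto simp: gen_vec_simps\<close>)
  qed
  then show ?thesis using a n i unfolding V_def gen_vec_def by auto
qed

lemma gen_vec_int_lattice:
  assumes "2 \<le> n" "i < n" "c \<in> int_lattice n"
  shows "gen_vec n i c \<in> int_lattice n"
  using assms gen_vec_V[of n i c] unfolding int_lattice_def gen_vec_def by auto

text \<open>
  The generator exchanges beads between the positions \<open>z - 1\<close> and \<open>z\<close> with \<open>z \<equiv> i\<close>, so it only changes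
  the number of beads to the right of such \<open>z\<close>. In the sum that defines \<open>height\<close> two summands swap.
\<close>

lemma height_gen_vec_other:
  assumes n: "2 \<le> n" and i: "i < n" and z: "z mod int n \<noteq> int i"
  shows "height n (gen_vec n i c) z = height n c z"
proof -
  let ?t = "\<lambda>c r. max 0 (\<lfloor>c r\<rfloor> + (int r - 1 - z) div int n)"
  show ?thesis
  proof (cases "i = 0")
    case True
    have "\<not> int n dvd - z" using z True by (metis dvd_minus_iff dvd_imp_mod_0 of_nat_0)
    then have e: "(- z - 1) div int n = (- z) div int n" using div_minus_one[of "int n" "- z"] n by simp
    have "(int n - 1 - z) div int n = (- z - 1) div int n + 1"
      using n div_add_self2[of "int n" "- z - 1"] by (simp add: algebra_simps)
    then have d: "(int n - 1 - z) div int n = (- z) div int n + 1" using e by simp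
    have "sum (?t (gen_vec n i c)) {1..n} = sum (?t c) {1..n}"
      by (rule sum_change_two[of 1 n n]) (use True n d in \<open>auto simp: gen_vec_simps algebra_simps\<close>)
    then show ?thesis unfolding height_def .
  next
    case False
    have "\<not> int n dvd int (i + 1) - 1 - z"
      using residue_index[of "i + 1" n z] i z n by auto
    then have d: "(int i - 1 - z) div int n = (int (i + 1) - 1 - z) div int n"
      using div_minus_one[of "int n" "int (i + 1) - 1 - z"] n by (simp add: algebra_simps)
    have "sum (?t (gen_vec n i c)) {1..n} = sum (?t c) {1..n}"
    proof (rule sum_change_two[of i n "i + 1"])
      show "?t (gen_vec n i c) i + ?t (gen_vec n i c) (i + 1) = ?t c i + ?t c (i + 1)"
        unfolding d gen_vec_simps(2)[OF False] by simp
    qed (use i False in \<open>auto simp: gen_vec_simps\<close>)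
    then show ?thesis unfolding height_def .
  qed
qed

lemma bead_gen_vec:
  assumes n: "2 \<le> n" and i: "i < n" and z: "z mod int n = int i"
  shows "bead (height n (gen_vec n i c)) z \<longleftrightarrow> bead (height n c) (z - 1)"
proof -
  have n1: "1 \<le> n" using n by simp
  define q where "q = z div int n"
  have zq: "z = int i + int n * q" using z unfolding q_def by (metis mod_mult_div_eq)
  show ?thesis
  proof (cases "i = 0")
    case True
    have e: "z - 1 = (int n - 1) + int n * (q - 1)" using zq True by (simp add: algebra_simps)
    have "((int n - 1) + int n * (q - 1)) div int n = q - 1" using n by simp
    moreover have "((int n - 1) + int n * (q - 1)) mod int n = int n - 1"
      by (subst mod_mult_self2, rule mod_pos_pos_trivial) (use n in auto)
    ultimately have "(z - 1) div int n = q - 1" "nat ((z - 1) mod int n) + 1 = n"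
      unfolding e using n by (simp_all only:)
    then show ?thesis
      unfolding bead_height[OF n1] z q_def[symmetric] using True n by (auto simp: gen_vec_simps)
  next
    case False
    have e: "z - 1 = (int i - 1) + int n * q" using zq by simp
    have "((int i - 1) + int n * q) div int n = q" using i False n by simp
    moreover have "((int i - 1) + int n * q) mod int n = int i - 1" using i False n by simp
    ultimately have "(z - 1) div int n = q" "nat ((z - 1) mod int n) + 1 = i"
      unfolding e using False by simp_all
    then show ?thesis
      unfolding bead_height[OF n1] z q_def[symmetric] using False by (simp add: gen_vec_simps)
  qed
qed

lemma addable_diagram_box:
  assumes h: "profile h" and z: "z = int b - int a"
  shows "addable (diagram h) (a, b) \<longleftrightarrow> int a = h z + 1 \<and> bead h (z - 1) \<and> \<not> bead h z"
proof -
  have "(a, b) = (nat (h y + 1), nat (h y + y + 1)) \<longleftrightarrow> y = z \<and> int a = h z + 1" for y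
    using profile_nonneg[OF h, of y] profile_shift_nonneg[OF h, of y] z by auto
  then show ?thesis unfolding addable_diagram[OF h] by auto
qed

lemma bead_nonneg:
  assumes h: "profile h" "bead h z"
  shows "1 \<le> h z"
  using assms profile_nonneg[OF h(1), of "z + 1"] unfolding bead_def by simp

lemma gap_shift_nonneg:
  assumes h: "profile h" "\<not> bead h (z - 1)"
  shows "1 \<le> h z + z"
  using profile_shift_nonneg[OF h(1), of "z - 1"] profile_step_minus[OF h(1), of z] h(2) by simp

lemma removable_diagram_box:
  assumes h: "profile h" and z: "z = int b - int a"
  shows "removable (diagram h) (a, b) \<longleftrightarrow> int a = h z \<and> \<not> bead h (z - 1) \<and> bead h z"
proof -
  have "(a, b) = (nat (h y), nat (h y + y)) \<longleftrightarrow> y = z \<and> int a = h z" if "\<not> bead h (y - 1)" "bead h y" for y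
    using bead_nonneg[OF h that(2)] gap_shift_nonneg[OF h that(1)] z by auto
  moreover have "(a, b) = (nat (h z), nat (h z + z))" if "int a = h z" "\<not> bead h (z - 1)" "bead h z"
    using that z by auto
  ultimately show ?thesis unfolding removable_diagram[OF h] by blast
qed

text \<open>
  On the diagonals of content \<open>z \<equiv> i\<close> the new profile is \<open>h\<close> corrected by the bead at \<open>z - 1\<close> minus the bead
  at \<open>z\<close>: it grows by one at an addable box and drops by one at a removable box. Since the beads are
  closed under subtracting \<open>n\<close>, a bead at \<open>y - 1\<close> with a gap at \<open>y\<close> and a bead at \<open>z\<close> with a gap at \<open>z - 1\<close>
  cannot occur for \<open>y \<equiv> z\<close>; so addable and removable boxes of the same residue do not coexist, and the
  three cases in the definition of the action all give this profile.
\<close>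

lemma gen_core_diagram:
  assumes n: "1 \<le> n" and h: "profile h"
    and closed: "\<And>z. bead h z \<Longrightarrow> bead h (z - int n)"
    and other: "\<And>z. z mod int n \<noteq> int i \<Longrightarrow> h' z = h z"
    and same: "\<And>z. z mod int n = int i \<Longrightarrow> h' z = h (z + 1) + (if bead h (z - 1) then 1 else 0)"
  shows "gen_core n i (diagram h) = diagram h'"
proof -
  have res: "residue n (a, b) = i \<longleftrightarrow> (int b - int a) mod int n = int i" for a b
    using n unfolding residue_def by (auto simp: nat_eq_iff)
  have closed_iter: "bead h (z - int n * int k)" if "bead h z" for z k
  proof (induction k)
    case (Suc k)
    then show ?case using closed[of "z - int n * int k"] by (simp add: algebra_simps)
  qed (use that in simp)
  have closed_le: "bead h y" if bz: "bead h z" and yz: "y \<le> z" and m: "y mod int n = z mod int n" for y z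
  proof -
    obtain k where k: "z - y = int n * k" using m by (metis mod_eq_dvd_iff dvdE)
    then have "0 \<le> int n * k" using yz by simp
    then have "0 \<le> k" using n by (simp add: zero_le_mult_iff)
    moreover have "y = z - int n * k" using k by simp
    ultimately show ?thesis using closed_iter[OF bz, of "nat k"] by simp
  qed
  have excl: False if "bead h (y - 1)" "\<not> bead h y" "bead h z" "\<not> bead h (z - 1)"
    "y mod int n = z mod int n" for y z
  proof (cases "y \<le> z")
    case True
    then show ?thesis using closed_le[of z y] that by blast
  next
    case False
    have "(z - 1) mod int n = (y - 1) mod int n" using that(5) by (metis mod_diff_left_eq)
    then show ?thesis using closed_le[of "y - 1" "z - 1"] False that by simp
  qed
  have h'_eq: "h' z = h z + (if bead h (z - 1) then 1 else 0) - (if bead h z then 1 else 0)"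
    if "z mod int n = int i" for z
    using same[OF that] profile_step[OF h, of z] by simp
  note nn = profile_nonneg[OF h] profile_shift_nonneg[OF h]
  consider (add) "\<exists>b. addable (diagram h) b \<and> residue n b = i"
    | (rem) "\<not> (\<exists>b. addable (diagram h) b \<and> residue n b = i)" "\<exists>b. removable (diagram h) b \<and> residue n b = i"
    | (none) "\<not> (\<exists>b. addable (diagram h) b \<and> residue n b = i)" "\<not> (\<exists>b. removable (diagram h) b \<and> residue n b = i)"
    by blast
  then show ?thesis
  proof cases
    case add
    then obtain a0 b0 where ab0: "addable (diagram h) (a0, b0)" "residue n (a0, b0) = i" by auto
    define y where "y = int b0 - int a0"
    have y: "bead h (y - 1)" "\<not> bead h y" "y mod int n = int i"
      using ab0 addable_diagram_box[OF h y_def] res[of a0 b0] unfolding y_def by auto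
    have "(a, b) \<in> diagram h \<union> {b. addable (diagram h) b \<and> residue n b = i} \<longleftrightarrow> (a, b) \<in> diagram h'" for a b
    proof -
      define z where "z = int b - int a"
      show ?thesis
      proof (cases "z mod int n = int i")
        case True
        have "bead h z \<Longrightarrow> bead h (z - 1)" using excl[OF y(1,2), of z] y(3) True by auto
        then have "h' z = h z + (if bead h (z - 1) \<and> \<not> bead h z then 1 else 0)" using h'_eq[OF True] by simp
        then show ?thesis
          using addable_diagram_box[OF h z_def] res[of a b] True nn[of z]
          unfolding diagram_def z_def[symmetric] by (auto simp: z_def)
      next
        case False
        then show ?thesis using other[OF False] res[of a b] unfolding diagram_def z_def by simp
      qed
    qed
    then show ?thesis unfolding gen_core_def using add by auto
  next
    case rem
    then obtain a0 b0 where ab0: "removable (diagram h) (a0, b0)" "residue n (a0, b0) = i" by auto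
    define y where "y = int b0 - int a0"
    have y: "\<not> bead h (y - 1)" "bead h y" "y mod int n = int i"
      using ab0 removable_diagram_box[OF h y_def] res[of a0 b0] unfolding y_def by auto
    have "(a, b) \<in> diagram h - {b. removable (diagram h) b \<and> residue n b = i} \<longleftrightarrow> (a, b) \<in> diagram h'" for a b
    proof -
      define z where "z = int b - int a"
      show ?thesis
      proof (cases "z mod int n = int i")
        case True
        have "bead h (z - 1) \<Longrightarrow> bead h z" using excl[of z y] y True by auto
        then have "h' z = h z - (if bead h z \<and> \<not> bead h (z - 1) then 1 else 0)" using h'_eq[OF True] by auto
        then show ?thesis
          using removable_diagram_box[OF h z_def] res[of a b] True nn[of z]
          unfolding diagram_def z_def[symmetric] by (auto simp: z_def)
      next
        case False
        then show ?thesis using other[OF False] res[of a b] unfolding diagram_def z_def by simp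
      qed
    qed
    then show ?thesis unfolding gen_core_def if_not_P[OF rem(1)] if_P[OF rem(2)] by auto
  next
    case none
    have "h' z = h z" for z
    proof (cases "z mod int n = int i")
      case True
      have "\<not> (bead h (z - 1) \<and> \<not> bead h z)"
      proof
        assume b: "bead h (z - 1) \<and> \<not> bead h z"
        have e: "z = int (nat (h z + 1 + z)) - int (nat (h z + 1))" using nn[of z] by simp
        have "addable (diagram h) (nat (h z + 1), nat (h z + 1 + z))" using addable_diagram_box[OF h e] b nn[of z] by simp
        moreover have "residue n (nat (h z + 1), nat (h z + 1 + z)) = i" unfolding res e[symmetric] by (rule True)
        ultimately show False using none(1) by blast
      qed
      moreover have "\<not> (\<not> bead h (z - 1) \<and> bead h z)"
      proof
        assume b: "\<not> bead h (z - 1) \<and> bead h z"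
        have e: "z = int (nat (h z + z)) - int (nat (h z))" using nn[of z] by simp
        have "removable (diagram h) (nat (h z), nat (h z + z))" using removable_diagram_box[OF h e] b nn[of z] by simp
        moreover have "residue n (nat (h z), nat (h z + z)) = i" unfolding res e[symmetric] by (rule True)
        ultimately show False using none(2) by blast
      qed
      ultimately show ?thesis using h'_eq[OF True] by auto
    qed (rule other)
    then have "h' = h" by blast
    then show ?thesis unfolding gen_core_def using none by auto
  qed
qed

lemma gen_core_core_of:
  assumes n: "2 \<le> n" and i: "i < n" and c: "c \<in> int_lattice n"
  shows "gen_core n i (core_of n c) = core_of n (gen_vec n i c)"
  unfolding core_of_def
proof (rule gen_core_diagram)
  show n1: "1 \<le> n" using n by simp
  show p: "profile (height n c)" by (rule profile_height[OF n1 c])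
  show "bead (height n c) (z - int n)" if "bead (height n c) z" for z
    using core_of_in_cores[OF n1 c] that unfolding core_of_def core_iff_beads_closed[OF p n1] by blast
  show "height n (gen_vec n i c) z = height n c z" if "z mod int n \<noteq> int i" for z
    by (rule height_gen_vec_other[OF n i that])
  show "height n (gen_vec n i c) z = height n c (z + 1) + (if bead (height n c) (z - 1) then 1 else 0)"
    if z: "z mod int n = int i" for z
  proof -
    have p': "profile (height n (gen_vec n i c))"
      by (rule profile_height[OF n1 gen_vec_int_lattice[OF n i c]])
    have "(z + 1) mod int n \<noteq> int i"
    proof
      assume "(z + 1) mod int n = int i"
      then have "int n dvd (z + 1) - z" using z by (metis mod_eq_dvd_iff)
      then show False using n by simp
    qed
    then show ?thesis
      using profile_step[OF p', of z] bead_gen_vec[OF n i z, of c] height_gen_vec_other[OF n i, of "z + 1" c]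
      by simp
  qed
qed

lemma core_of_zero: "1 \<le> n \<Longrightarrow> core_of n (\<lambda>_. 0) = {}"
proof -
  assume n: "1 \<le> n"
  have z: "(\<lambda>_. 0) \<in> int_lattice n" unfolding int_lattice_def V_def by simp
  have "\<not> int a \<le> height n (\<lambda>_. 0) (int b - int a)" if "1 \<le> a" "1 \<le> b" for a b
  proof (cases "int b - int a \<ge> 0")
    case True
    have "height n (\<lambda>_. 0) (int b - int a) = 0"
      unfolding height_def
    proof (intro sum.neutral ballI)
      fix r assume "r \<in> {1..n}"
      then have "(int r - 1 - (int b - int a)) div int n \<le> (int n - 1) div int n"
        using True by (intro zdiv_mono1) auto
      then show "max 0 (\<lfloor>0\<rfloor> + (int r - 1 - (int b - int a)) div int n) = 0" using n by simp
    qed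
    then show ?thesis using that by simp
  next
    case False
    have p: "profile (height n (\<lambda>_. 0))" by (rule profile_height[OF n z])
    have "bead (height n (\<lambda>_. 0)) y" if "y < 0" for y
      unfolding bead_height[OF n] using that n by (simp add: pos_imp_zdiv_neg_iff)
    have "height n (\<lambda>_. 0) (- int k) = int k" for k
    proof (induction k)
      case 0
      have "(int r - 1) div int n \<le> 0" if "r \<in> {1..n}" for r using that by simp
      then show ?case unfolding height_def by (auto intro!: sum.neutral)
    next
      case (Suc k)
      have e: "- int (Suc k) = - int k - 1" by simp
      show ?case
        unfolding e using Suc profile_step_minus[OF p, of "- int k"] \<open>\<And>y. y < 0 \<Longrightarrow> bead _ y\<close>[of "- int k - 1"] by simp
    qed
    from this[of "nat (int a - int b)"] show ?thesis using False that by simp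
  qed
  then show ?thesis unfolding core_of_def diagram_def by auto
qed


section \<open>Centres of alcoves and separating hyperplanes\<close>

lemma neighbours_iff:
  assumes "2 \<le> n" "i < n" "j < n"
  shows "neighbours n i j \<longleftrightarrow> i = j + 1 \<or> j = i + 1 \<or> i = 0 \<and> j = n - 1 \<or> j = 0 \<and> i = n - 1"
proof -
  have *: "[int a = int b + 1] (mod int n) \<longleftrightarrow> a = b + 1 \<or> a = 0 \<and> b = n - 1" if "a < n" "b < n" for a b
  proof
    assume "[int a = int b + 1] (mod int n)"
    then have dvd: "int n dvd int a - int b - 1" by (simp add: cong_iff_dvd_diff algebra_simps)
    consider "int a - int b - 1 = 0" | "0 < int a - int b - 1" | "0 < int b + 1 - int a" by linarith
    then show "a = b + 1 \<or> a = 0 \<and> b = n - 1"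
    proof cases
      case 2
      then show ?thesis using zdvd_imp_le[OF dvd] that by simp
    next
      case 3
      have "int n dvd int b + 1 - int a" using dvd by (metis diff_diff_eq minus_diff_eq dvd_minus_iff add.commute)
      then have "int n \<le> int b + 1 - int a" using 3 by (rule zdvd_imp_le)
      then show ?thesis using that by linarith
    qed simp
  next
    assume "a = b + 1 \<or> a = 0 \<and> b = n - 1"
    then show "[int a = int b + 1] (mod int n)"
      using assms(1) by (auto simp: cong_iff_dvd_diff of_nat_diff)
  qed
  have "[int i = int j - 1] (mod int n) \<longleftrightarrow> [int j = int i + 1] (mod int n)"
    unfolding cong_iff_dvd_diff by (metis add.commute add_diff_eq diff_diff_eq2 dvd_minus_iff minus_diff_eq diff_add_eq)
  then show ?thesis
    unfolding neighbours_def using *[OF assms(2,3)] *[OF assms(3,2)] by auto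
qed

lemma gen_vec_involution:
  assumes "2 \<le> n" shows "gen_vec n i (gen_vec n i a) = a"
  using assms unfolding gen_vec_def by (auto simp: fun_eq_iff)

lemma gen_vec_commute:
  assumes "2 \<le> n" "i < n" "j < n" "\<not> neighbours n i j"
  shows "gen_vec n i (gen_vec n j a) = gen_vec n j (gen_vec n i a)"
  using assms(4) unfolding neighbours_iff[OF assms(1-3)]
  using assms(1-3) unfolding gen_vec_def by (auto simp: fun_eq_iff)

lemma gen_vec_braid:
  assumes "2 < n" "i < n" "j < n" "neighbours n i j"
  shows "gen_vec n i (gen_vec n j (gen_vec n i a)) = gen_vec n j (gen_vec n i (gen_vec n j a))"
proof -
  have "2 \<le> n" using assms by simp
  show ?thesis
    using assms(4) unfolding neighbours_iff[OF \<open>2 \<le> n\<close> assms(2,3)]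
    using assms(1-3) unfolding gen_vec_def by (elim disjE conjE) (auto simp: fun_eq_iff)
qed

lemma coxeter_eq_foldr_gen_vec:
  assumes "coxeter_eq n u v" "2 \<le> n"
  shows "foldr (gen_vec n) u a = foldr (gen_vec n) v a"
  using assms(1)
proof (induction arbitrary: a)
  case (square i)
  then show ?case using gen_vec_involution[OF assms(2)] by simp
next
  case (commute i j)
  then show ?case using gen_vec_commute[OF assms(2)] by simp
next
  case (braid i j)
  then show ?case using gen_vec_braid[of n i j a] by simp
qed simp_all

text \<open>
  \<open>s\<^sub>i\<close> is a descent of \<open>a\<close> if the wall of \<open>\<A>\<^sub>0\<close> belonging to \<open>s\<^sub>i\<close> separates \<open>a\<close> from \<open>\<A>\<^sub>0\<close>.
\<close>

definition descent :: "nat \<Rightarrow> nat \<Rightarrow> vec \<Rightarrow> bool" where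
  "descent n i a \<longleftrightarrow> (if i = 0 then a n + 1 < a 1 else a i < a (i + 1))"

lemma descent_gen_vec:
  assumes "2 \<le> n" "descent n i a" shows "\<not> descent n i (gen_vec n i a)"
  using assms unfolding descent_def gen_vec_def by (auto split: if_splits)

lemma descents_commute:
  assumes "2 \<le> n" "i < n" "j < n" "i \<noteq> j" "\<not> neighbours n i j" "descent n j a"
  shows "descent n j (gen_vec n i a)"
  using assms(5) unfolding neighbours_iff[OF assms(1-3)]
  using assms(1-4,6) unfolding gen_vec_def descent_def by auto

lemma descents_braid:
  assumes "2 \<le> n" "i < n" "j < n" "neighbours n i j" "descent n i a" "descent n j a"
  shows "2 < n" "descent n j (gen_vec n i a)" "descent n i (gen_vec n j (gen_vec n i a))"
proof -
  show n: "2 < n"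
  proof (rule ccontr)
    assume "\<not> 2 < n"
    then have n: "n = 2" using assms(1) by simp
    have "i \<noteq> j" using assms(4) unfolding neighbours_iff[OF assms(1-3)] using n by auto
    then have "i = 0 \<and> j = 1 \<or> i = 1 \<and> j = 0" using assms(2,3) n by linarith
    then show False
      using assms(5,6) unfolding descent_def n by (auto simp: numeral_2_eq_2)
  qed
  show "descent n j (gen_vec n i a)" "descent n i (gen_vec n j (gen_vec n i a))"
    using assms(4) unfolding neighbours_iff[OF assms(1-3)]
    using assms(2,3,5,6) n unfolding gen_vec_def descent_def
    by (elim disjE conjE; auto split: if_splits)+
qed

text \<open>
  The points of \<open>V\<close> that lie in some alcove.
\<close>

definition regular :: "nat \<Rightarrow> vec set" where
  "regular n = {a \<in> V n. \<forall>x\<in>{1..n}. \<forall>y\<in>{1..n}. x \<noteq> y \<longrightarrow> a x - a y \<notin> \<int>}"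

text \<open>
  The regular points whose coordinate differences are multiples of \<open>1 / n\<close>. This set is the orbit of
  the base point, and it meets every alcove exactly once.
\<close>

definition centres :: "nat \<Rightarrow> vec set" where
  "centres n = {a \<in> regular n. \<forall>x\<in>{1..n}. \<forall>y\<in>{1..n}. real n * (a x - a y) \<in> \<int>}"

definition base_point :: "nat \<Rightarrow> vec" where
  "base_point n i = (if i \<in> {1..n} then ((real n + 1) / 2 - real i) / real n else 0)"

definition pairs :: "nat \<Rightarrow> (nat \<times> nat) set" where
  "pairs n = {(x, y). 1 \<le> x \<and> x < y \<and> y \<le> n}"

text \<open>
  The number of hyperplanes that separate a regular point \<open>a\<close> from \<open>\<A>\<^sub>0\<close>: for \<open>x < y\<close> the differences
  \<open>v\<^sub>x - v\<^sub>y\<close> lie in \<open>(0, 1)\<close> on \<open>\<A>\<^sub>0\<close>, and \<open>\<bar>\<lfloor>a\<^sub>x - a\<^sub>y\<rfloor>\<bar>\<close> integers lie between this interval and \<open>a\<^sub>x - a\<^sub>y\<close>.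
\<close>

definition depth :: "nat \<Rightarrow> vec \<Rightarrow> nat" where
  "depth n a = (\<Sum>(x, y)\<in>pairs n. nat \<bar>\<lfloor>a x - a y\<rfloor>\<bar>)"

lemma finite_pairs: "finite (pairs n)"
  by (rule finite_subset[of _ "{1..n} \<times> {1..n}"]) (auto simp: pairs_def)

text \<open>
  A generator permutes coordinates up to integer shifts that do not depend on the vector; hence it
  preserves everything that is phrased in terms of coordinate differences modulo integers.
\<close>

lemma gen_vec_coordinates:
  assumes "2 \<le> n" "i < n"
  obtains \<tau> :: "nat \<Rightarrow> nat" and \<kappa> :: "nat \<Rightarrow> int"
  where "\<tau> ` {1..n} \<subseteq> {1..n}" "inj_on \<tau> {1..n}" "\<And>a x. gen_vec n i a x = a (\<tau> x) + of_int (\<kappa> x)"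
proof (cases "i = 0")
  case True
  show ?thesis
    by (rule that[of "id(1 := n, n := 1)" "(\<lambda>_. 0)(1 := 1, n := - 1)"])
      (use assms True in \<open>auto simp: gen_vec_def inj_on_def\<close>)
next
  case False
  show ?thesis
    by (rule that[of "id(i := i + 1, i + 1 := i)" "\<lambda>_. 0"])
      (use assms False in \<open>auto simp: gen_vec_def inj_on_def\<close>)
qed

lemma regular_reindex:
  assumes a: "a \<in> regular n" and b: "b \<in> V n"
    and \<tau>: "\<tau> ` {1..n} \<subseteq> {1..n}" "inj_on \<tau> {1..n}"
    and shift: "\<And>x. x \<in> {1..n} \<Longrightarrow> b x - a (\<tau> x) \<in> \<int>"
  shows "b \<in> regular n"
proof -
  have "b x - b y \<notin> \<int>" if xy: "x \<in> {1..n}" "y \<in> {1..n}" "x \<noteq> y" for x y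
  proof
    assume int: "b x - b y \<in> \<int>"
    have "a (\<tau> x) - a (\<tau> y) \<in> \<int>"
      using Ints_add[OF Ints_diff[OF int shift[OF xy(1)]] shift[OF xy(2)]] by simp
    moreover have "\<tau> x \<noteq> \<tau> y" using inj_on_eq_iff[OF \<tau>(2) xy(1,2)] xy(3) by blast
    moreover have "\<tau> x \<in> {1..n}" "\<tau> y \<in> {1..n}" using \<tau>(1) xy by blast+
    ultimately show False using a unfolding regular_def by blast
  qed
  then show ?thesis using b unfolding regular_def by blast
qed

lemma centres_reindex:
  assumes a: "a \<in> centres n" and b: "b \<in> V n"
    and \<tau>: "\<tau> ` {1..n} \<subseteq> {1..n}" "inj_on \<tau> {1..n}"
    and shift: "\<And>x. x \<in> {1..n} \<Longrightarrow> b x - a (\<tau> x) \<in> \<int>"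
  shows "b \<in> centres n"
proof -
  have "real n * (b x - b y) \<in> \<int>" if xy: "x \<in> {1..n}" "y \<in> {1..n}" for x y
  proof -
    have "\<tau> x \<in> {1..n}" "\<tau> y \<in> {1..n}" using \<tau>(1) xy by blast+
    then have "real n * (a (\<tau> x) - a (\<tau> y)) \<in> \<int>"
      using a unfolding centres_def by blast
    then have "real n * (a (\<tau> x) - a (\<tau> y)) + real n * (b x - a (\<tau> x)) - real n * (b y - a (\<tau> y)) \<in> \<int>"
      using Ints_mult[OF Ints_of_nat shift[OF xy(1)], of n] Ints_mult[OF Ints_of_nat shift[OF xy(2)], of n]
      by (rule Ints_diff[OF Ints_add])
    then show ?thesis by (simp add: algebra_simps)
  qed
  moreover have "a \<in> regular n" using a unfolding centres_def by blast
  ultimately show ?thesis using regular_reindex[OF _ b \<tau> shift] unfolding centres_def by blast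
qed

lemma gen_vec_regular:
  assumes n: "2 \<le> n" and i: "i < n" and a: "a \<in> regular n"
  shows "gen_vec n i a \<in> regular n"
proof -
  obtain \<tau> :: "nat \<Rightarrow> nat" and \<kappa> :: "nat \<Rightarrow> int" where t: "\<tau> ` {1..n} \<subseteq> {1..n}" "inj_on \<tau> {1..n}"
    "\<And>a x. gen_vec n i a x = a (\<tau> x) + of_int (\<kappa> x)"
    using gen_vec_coordinates[OF n i] by blast
  have "gen_vec n i a \<in> V n" using a gen_vec_V[OF n i] unfolding regular_def by blast
  then show ?thesis by (rule regular_reindex[OF a _ t(1,2)]) (simp add: t(3))
qed

lemma gen_vec_centres:
  assumes n: "2 \<le> n" and i: "i < n" and a: "a \<in> centres n"
  shows "gen_vec n i a \<in> centres n"
proof -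
  obtain \<tau> :: "nat \<Rightarrow> nat" and \<kappa> :: "nat \<Rightarrow> int" where t: "\<tau> ` {1..n} \<subseteq> {1..n}" "inj_on \<tau> {1..n}"
    "\<And>a x. gen_vec n i a x = a (\<tau> x) + of_int (\<kappa> x)"
    using gen_vec_coordinates[OF n i] by blast
  have "gen_vec n i a \<in> V n" using a gen_vec_V[OF n i] unfolding centres_def regular_def by blast
  then show ?thesis by (rule centres_reindex[OF a _ t(1,2)]) (simp add: t(3))
qed

lemma floor_minus_not_int:
  fixes x :: real
  assumes "x \<notin> \<int>" shows "\<lfloor>- x\<rfloor> = - \<lfloor>x\<rfloor> - 1"
proof -
  have "x \<noteq> of_int \<lfloor>x\<rfloor>" using assms by (metis Ints_of_int)
  then have "\<lceil>x\<rceil> = \<lfloor>x\<rfloor> + 1" by (simp add: ceiling_altdef)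
  then show ?thesis by (simp add: floor_minus)
qed

text \<open>
  The hyperplanes separating \<open>s\<^sub>i a\<close> from \<open>\<A>\<^sub>0\<close> are the images of those separating \<open>a\<close>, and in addition the wall
  of \<open>s\<^sub>i\<close>. In coordinates, \<open>s\<^sub>i\<close> permutes the remaining pairs and keeps their absolute floors. For \<open>i = 0\<close>
  the pairs \<open>(1, j)\<close> and \<open>(j, n)\<close> are exchanged, and \<open>\<lfloor>1 - d\<rfloor> = - \<lfloor>d\<rfloor>\<close> for a non-integer \<open>d\<close>.
\<close>

lemma depth_gen_vec_ascent:
  assumes n: "2 \<le> n" and i: "i < n" and a: "a \<in> regular n" and asc: "\<not> descent n i a"
  shows "depth n (gen_vec n i a) = depth n a + 1"
proof -
  let ?b = "gen_vec n i a"
  let ?f = "\<lambda>a (x, y). nat \<bar>\<lfloor>a x - a y\<rfloor>\<bar>"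
  have nonint: "a x - a y \<notin> \<int>" if "x \<in> {1..n}" "y \<in> {1..n}" "x \<noteq> y" for x y
    using a that unfolding regular_def by blast
  \<comment> \<open>The pair of coordinates whose difference is tested by the wall of \<open>s\<^sub>i\<close>.\<close>
  define w where "w = (if i = 0 then (1, n) else (i, i + 1))"
  have w: "w \<in> pairs n" unfolding w_def pairs_def using n i by auto
  have "sum (?f ?b) (pairs n - {w}) = sum (?f a) (pairs n - {w})"
  proof (cases "i = 0")
    case True
    define g where "g = (\<lambda>(x, y). if x = 1 then (y, n) else if y = n then (1, x) else (x, y :: nat))"
    show ?thesis
    proof (rule sum.reindex_bij_witness[of _ g g])
      fix t assume t: "t \<in> pairs n - {w}"
      show "g (g t) = t" "g t \<in> pairs n - {w}" using t True unfolding g_def pairs_def w_def by (auto split: if_splits)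
      show "?f a (g t) = ?f ?b t"
      proof -
        obtain x y where xy: "t = (x, y)" "1 \<le> x" "x < y" "y \<le> n" "\<not> (x = 1 \<and> y = n)"
          using t True unfolding pairs_def w_def by auto
        have flip: "\<bar>\<lfloor>1 - d\<rfloor>\<bar> = \<bar>\<lfloor>d\<rfloor>\<bar>" if "d \<notin> \<int>" for d :: real
          using floor_minus_not_int[OF that] floor_add_int[of "- d" 1] by (simp add: add.commute)
        consider "x = 1" "y < n" | "1 < x" "y = n" | "1 < x" "y < n" using xy by linarith
        then show ?thesis
        proof cases
          case 1
          then have "gen_vec n i a x - gen_vec n i a y = 1 - (a y - a n)" using True xy n by (simp add: gen_vec_simps)
          then show ?thesis using flip[OF nonint[of y n]] 1 xy unfolding g_def by simp
        next
          case 2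
          then have "gen_vec n i a x - gen_vec n i a y = 1 - (a 1 - a x)" using True xy n by (simp add: gen_vec_simps)
          then show ?thesis using flip[OF nonint[of 1 x]] 2 xy unfolding g_def by simp
        next
          case 3
          then show ?thesis using True xy unfolding g_def by (simp add: gen_vec_simps)
        qed
      qed
    qed (use True in \<open>auto simp: g_def pairs_def w_def split: if_splits\<close>)
  next
    case False
    define \<tau> where "\<tau> = id(i := i + 1, i + 1 := i)"
    define g where "g = (\<lambda>(x, y). (\<tau> x, \<tau> y))"
    show ?thesis
    proof (rule sum.reindex_bij_witness[of _ g g])
      fix t assume t: "t \<in> pairs n - {w}"
      show "g (g t) = t" "g t \<in> pairs n - {w}"
        using t False i unfolding g_def \<tau>_def pairs_def w_def by (auto split: if_splits)
      show "?f a (g t) = ?f ?b t"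
      proof -
        have "?b x = a (\<tau> x)" for x unfolding \<tau>_def using False by (simp add: gen_vec_simps)
        then show ?thesis unfolding g_def by (simp split: prod.splits)
      qed
    qed (use False i in \<open>auto simp: g_def \<tau>_def pairs_def w_def split: if_splits\<close>)
  qed
  moreover have "?f ?b w = ?f a w + 1"
  proof (cases "i = 0")
    case True
    have d: "a 1 - a n \<notin> \<int>" using nonint[of 1 n] n by simp
    have "a 1 - a n \<noteq> 1" using d by (metis Ints_1)
    then have lt: "a 1 - a n < 1" using asc True unfolding descent_def by simp
    have "\<lfloor>?b 1 - ?b n\<rfloor> = 1 - \<lfloor>a 1 - a n\<rfloor>"
    proof -
      have "?b 1 - ?b n = - (a 1 - a n) + of_int 2" using True n by (simp add: gen_vec_simps)
      then show ?thesis using floor_minus_not_int[OF d] by (simp only: floor_add_int[symmetric])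
    qed
    moreover have "nat \<bar>1 - k\<bar> = nat \<bar>k\<bar> + 1" if "k \<le> 0" for k :: int using that by linarith
    moreover have "\<lfloor>a 1 - a n\<rfloor> \<le> 0" using lt by linarith
    ultimately show ?thesis unfolding w_def if_P[OF True] prod.case by (simp only:)
  next
    case False
    have d: "a i - a (i + 1) \<notin> \<int>" using nonint[of i "i + 1"] i False by simp
    have "a i - a (i + 1) \<noteq> 0" using d by (metis Ints_0)
    then have lt: "0 < a i - a (i + 1)" using asc False unfolding descent_def by simp
    have "\<lfloor>?b i - ?b (i + 1)\<rfloor> = - \<lfloor>a i - a (i + 1)\<rfloor> - 1"
      using floor_minus_not_int[OF d] False by (simp add: gen_vec_simps)
    moreover have "nat \<bar>- k - 1\<bar> = nat \<bar>k\<bar> + 1" if "0 \<le> k" for k :: int using that by linarith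
    moreover have "0 \<le> \<lfloor>a i - a (i + 1)\<rfloor>" using lt by linarith
    ultimately show ?thesis unfolding w_def if_not_P[OF False] prod.case by (simp only:)
  qed
  ultimately show ?thesis
    unfolding depth_def using sum.remove[OF finite_pairs w, of "?f ?b"] sum.remove[OF finite_pairs w, of "?f a"]
    by simp
qed

lemma depth_gen_vec_descent:
  assumes n: "2 \<le> n" and i: "i < n" and a: "a \<in> regular n" and d: "descent n i a"
  shows "depth n a = depth n (gen_vec n i a) + 1"
  using depth_gen_vec_ascent[OF n i gen_vec_regular[OF n i a] descent_gen_vec[OF n d]]
    gen_vec_involution[OF n] by simp

lemma sum_base: "(\<Sum>i=1..n. base_point n i) = 0"
proof -
  have *: "(\<Sum>i=1..k. (x - real i)) = real k * x - real k * (real k + 1) / 2" for k x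
    by (induction k) (auto simp: field_simps)
  have "(\<Sum>i=1..n. base_point n i) = (\<Sum>i=1..n. ((real n + 1) / 2 - real i)) / real n"
    unfolding sum_divide_distrib by (intro sum.cong HOL.refl) (simp add: base_point_def)
  also have "\<dots> = 0" unfolding * by simp
  finally show ?thesis .
qed

lemma base_diff:
  assumes "x \<in> {1..n}" "y \<in> {1..n}" shows "base_point n x - base_point n y = (real y - real x) / real n"
  using assms unfolding base_point_def by (simp add: diff_divide_distrib)

lemma base_centre:
  assumes n: "1 \<le> n" shows "base_point n \<in> centres n"
proof -
  have "base_point n x - base_point n y \<notin> \<int>" if xy: "x \<in> {1..n}" "y \<in> {1..n}" "x \<noteq> y" for x y
  proof
    assume "base_point n x - base_point n y \<in> \<int>"
    then obtain k :: int where "(real y - real x) / real n = real_of_int k"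
      using base_diff[OF xy(1,2)] by (auto elim: Ints_cases)
    then have "real y - real x = real_of_int (int n * k)" using n by (simp add: field_simps)
    then have "int y - int x = int n * k" by linarith
    then have "int n dvd int y - int x" by simp
    then have "\<bar>int n\<bar> \<le> \<bar>int y - int x\<bar>" using xy(3) by (intro dvd_imp_le_int) auto
    then show False using xy by auto
  qed
  moreover have "real n * (base_point n x - base_point n y) \<in> \<int>" if "x \<in> {1..n}" "y \<in> {1..n}" for x y
    using base_diff[OF that] n by simp
  moreover have "base_point n \<in> V n" using sum_base[of n] unfolding V_def by (auto simp: base_point_def)
  ultimately show ?thesis unfolding centres_def regular_def by blast
qed

lemma floor_base_diff:
  assumes "(x, y) \<in> pairs n" shows "\<lfloor>base_point n x - base_point n y\<rfloor> = 0"
proof -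
  have "x \<in> {1..n}" "y \<in> {1..n}" "x < y" using assms unfolding pairs_def by auto
  then show ?thesis unfolding floor_eq_iff base_diff[OF \<open>x \<in> _\<close> \<open>y \<in> _\<close>] by (auto simp: field_simps)
qed

lemma depth_base: "depth n (base_point n) = 0"
  unfolding depth_def by (auto intro!: sum.neutral simp: floor_base_diff)

text \<open>
  Without descents the \<open>n\<close> numbers \<open>a\<^sub>1 - a\<^sub>2, \<dots>, a\<^sub>n\<^sub>-\<^sub>1 - a\<^sub>n, a\<^sub>n - a\<^sub>1 + 1\<close> are positive multiples of \<open>1 / n\<close>.
  They sum to \<open>1\<close>, so each of them equals \<open>1 / n\<close>.
\<close>

lemma centre_without_descent:
  assumes n: "2 \<le> n" and a: "a \<in> centres n" and asc: "\<And>i. i < n \<Longrightarrow> \<not> descent n i a"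
  shows "a = base_point n"
proof -
  have int: "real n * (a x - a y) \<in> \<int>" if "x \<in> {1..n}" "y \<in> {1..n}" for x y
    using a that unfolding centres_def by blast
  have nonint: "a x - a y \<notin> \<int>" if "x \<in> {1..n}" "y \<in> {1..n}" "x \<noteq> y" for x y
    using a that unfolding centres_def regular_def by blast
  have gap: "1 / real n \<le> d" if int_d: "real n * d \<in> \<int>" and d: "d \<notin> \<int>" "0 \<le> d" for d
  proof -
    have "d \<noteq> 0" using d(1) by (metis Ints_0)
    then have "0 < real n * d" using d(2) n by simp
    moreover obtain k :: int where "real n * d = of_int k" using int_d by (auto elim: Ints_cases)
    ultimately have "1 \<le> real n * d" by simp
    then show ?thesis using n by (simp add: field_simps)
  qed
  have step: "1 / real n \<le> a i - a (i + 1)" if "1 \<le> i" "i < n" for i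
    using that asc[of i] by (intro gap int nonint) (auto simp: descent_def)
  have "1 / real n \<le> a n - a 1 + 1"
  proof (rule gap)
    show "real n * (a n - a 1 + 1) \<in> \<int>"
    proof -
      have "real n * (a n - a 1) + real n \<in> \<int>" using int[of n 1] n by (intro Ints_add) auto
      then show ?thesis by (simp add: algebra_simps)
    qed
    show "a n - a 1 + 1 \<notin> \<int>"
    proof
      assume "a n - a 1 + 1 \<in> \<int>"
      then have "a n - a 1 + 1 - 1 \<in> \<int>" by (intro Ints_diff) auto
      then show False using nonint[of n 1] n by simp
    qed
    show "0 \<le> a n - a 1 + 1" using asc[of 0] n unfolding descent_def by simp
  qed
  then have last: "a 1 - a n \<le> (real n - 1) / real n" using n by (simp add: field_simps)
  have drop: "(real y - real x) / real n \<le> a x - a y" if "1 \<le> x" "x \<le> y" "y \<le> n" for x y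
    using that(2,3)
  proof (induction y rule: dec_induct)
    case (step y)
    then show ?case using \<open>\<And>i. 1 \<le> i \<Longrightarrow> i < n \<Longrightarrow> _\<close>[of y] that(1) by (simp add: field_simps)
  qed simp
  have eq: "a x - base_point n x = a 1 - base_point n 1" if x: "x \<in> {1..n}" for x
  proof -
    have "(real x - real 1) / real n \<le> a 1 - a x" "(real n - real x) / real n \<le> a x - a n"
      using drop[of 1 x] drop[of x n] x by auto
    then have "a 1 - a x = (real x - 1) / real n" using last by (simp add: diff_divide_distrib)
    moreover have "base_point n 1 - base_point n x = (real x - 1) / real n" using base_diff[of 1 n x] x n by simp
    ultimately show ?thesis by simp
  qed
  have "(\<Sum>x=1..n. a x - base_point n x) = (\<Sum>x=1..n. a 1 - base_point n 1)"
    by (rule sum.cong[OF HOL.refl]) (rule eq)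
  moreover have "(\<Sum>x=1..n. a x) = 0" using a unfolding centres_def regular_def V_def by simp
  ultimately have "a 1 = base_point n 1" using sum_base[of n] n by (simp add: sum_subtractf)
  then have "a x = base_point n x" if "x \<in> {1..n}" for x using eq[OF that] by simp
  moreover have "a x = base_point n x" if "x \<notin> {1..n}" for x
    using a that unfolding centres_def regular_def V_def base_point_def by auto
  ultimately show ?thesis by blast
qed


section \<open>The word problem of the affine symmetric group\<close>

abbreviation word_act :: "nat \<Rightarrow> nat list \<Rightarrow> vec \<Rightarrow> vec" where
  "word_act n \<equiv> foldr (gen_vec n)"

lemma word_act_regular:
  assumes "2 \<le> n" "u \<in> lists {..<n}" "a \<in> regular n" shows "word_act n u a \<in> regular n"
  using assms(2) by (induction u) (use assms gen_vec_regular in auto)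

lemma word_act_centres:
  assumes "2 \<le> n" "u \<in> lists {..<n}" "a \<in> centres n" shows "word_act n u a \<in> centres n"
  using assms(2) by (induction u) (use assms gen_vec_centres in auto)

lemma centres_regular: "a \<in> centres n \<Longrightarrow> a \<in> regular n"
  unfolding centres_def by blast

lemma regular_V: "a \<in> regular n \<Longrightarrow> a \<in> V n"
  unfolding regular_def by blast

lemma word_act_base_centre:
  assumes "2 \<le> n" "u \<in> lists {..<n}" shows "word_act n u (base_point n) \<in> centres n"
  using word_act_centres[OF assms base_centre] assms(1) by simp

lemma depth_gen_vec_le:
  assumes n: "2 \<le> n" and i: "i < n" and a: "a \<in> regular n"
  shows "depth n (gen_vec n i a) \<le> depth n a + 1"
  using depth_gen_vec_ascent[OF n i a] depth_gen_vec_descent[OF n i a] by (cases "descent n i a") auto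

lemma depth_word_act_le:
  assumes n: "2 \<le> n" and u: "u \<in> lists {..<n}"
  shows "depth n (word_act n u (base_point n)) \<le> length u"
  using u
proof (induction u)
  case (Cons i u)
  then have "i < n" "u \<in> lists {..<n}" by auto
  then show ?case
    using depth_gen_vec_le[OF n \<open>i < n\<close> centres_regular[OF word_act_base_centre[OF n \<open>u \<in> _\<close>]]] Cons.IH by simp
qed (simp add: depth_base)

text \<open>
  Walking down along descents must end at the base point, and each step lowers the depth by one.
\<close>

lemma centre_has_reduced_word:
  assumes n: "2 \<le> n" and a: "a \<in> centres n"
  obtains u where "u \<in> lists {..<n}" "word_act n u (base_point n) = a" "length u = depth n a"
proof -
  have "\<exists>u\<in>lists {..<n}. word_act n u (base_point n) = a \<and> length u = depth n a"
    using a
  proof (induction "depth n a" arbitrary: a rule: less_induct)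
    case (less a)
    show ?case
    proof (cases "\<exists>i<n. descent n i a")
      case True
      then obtain i where i: "i < n" "descent n i a" by blast
      have d: "depth n a = depth n (gen_vec n i a) + 1"
        by (rule depth_gen_vec_descent[OF n i(1) centres_regular[OF less.prems] i(2)])
      then obtain u where u: "u \<in> lists {..<n}" "word_act n u (base_point n) = gen_vec n i a"
        "length u = depth n (gen_vec n i a)"
        using less.hyps[of "gen_vec n i a"] gen_vec_centres[OF n i(1) less.prems] by auto
      then show ?thesis
        using d i gen_vec_involution[OF n] by (intro bexI[of _ "i # u"]) auto
    next
      case False
      then have "a = base_point n" using centre_without_descent[OF n less.prems] by blast
      then show ?thesis using depth_base by (intro bexI[of _ "[]"]) auto
    qed
  qed
  then show ?thesis using that by blast
qed

text \<open>
  The standard induction on the length. The first letters \<open>i\<close> and \<open>j\<close> of the two words are both descents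
  of the common centre. If they differ, then the centre also has a reduced word that starts with \<open>ij\<close>
  or \<open>iji\<close>, depending on whether \<open>s\<^sub>i\<close> and \<open>s\<^sub>j\<close> commute; one commutation or braid relation
  turns it into one that starts with \<open>ji\<close> or \<open>jij\<close>, and the induction hypothesis applies on both sides.
\<close>

lemma reduced_words_equivalent:
  assumes n: "2 \<le> n"
    and "u \<in> lists {..<n}" "v \<in> lists {..<n}"
    and "word_act n u (base_point n) = word_act n v (base_point n)"
    and "length u = depth n (word_act n u (base_point n))" "length v = length u"
  shows "coxeter_eq n u v"
  using assms(2-)
proof (induction "length u" arbitrary: u v)
  case 0
  then show ?case by (simp add: coxeter_eq.refl)
next
  case (Suc k)
  obtain i u' where u: "u = i # u'" using Suc.hyps(2) by (cases u) auto
  obtain j v' where v: "v = j # v'" using Suc.hyps(2) Suc.prems(5) by (cases v) auto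
  have i: "i < n" "u' \<in> lists {..<n}" and j: "j < n" "v' \<in> lists {..<n}"
    using Suc.prems(1,2) unfolding u v by auto
  have len: "length u' = k" "length v' = k" using Suc.hyps(2) Suc.prems(5) unfolding u v by auto
  define a where "a = word_act n u (base_point n)"
  have a: "a \<in> centres n" unfolding a_def by (rule word_act_base_centre[OF n Suc.prems(1)])
  have da: "depth n a = Suc k" using Suc.prems(4) Suc.hyps(2) unfolding a_def by simp
  have u'a: "word_act n u' (base_point n) = gen_vec n i a"
    unfolding a_def u using gen_vec_involution[OF n] by simp
  have v'a: "word_act n v' (base_point n) = gen_vec n j a"
    using Suc.prems(3) gen_vec_involution[OF n] unfolding a_def v by simp
  have desc: "descent n l a \<and> depth n (gen_vec n l a) = k"
    if l: "l < n" "w \<in> lists {..<n}" "length w = k" "word_act n w (base_point n) = gen_vec n l a" for l w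
  proof -
    have le: "depth n (gen_vec n l a) \<le> k" using depth_word_act_le[OF n l(2)] l(3,4) by simp
    then have "descent n l a"
      using depth_gen_vec_ascent[OF n l(1) centres_regular[OF a]] da by (cases "descent n l a") auto
    then show ?thesis using depth_gen_vec_descent[OF n l(1) centres_regular[OF a]] da by simp
  qed
  have di: "descent n i a" "depth n (gen_vec n i a) = k"
    using desc[OF i len(1) u'a] by auto
  have dj: "descent n j a" "depth n (gen_vec n j a) = k"
    using desc[OF j len(2) v'a] by auto
  have ai: "gen_vec n i a \<in> centres n" and aj: "gen_vec n j a \<in> centres n"
    using gen_vec_centres[OF n _ a] i j by auto
  have IH: "coxeter_eq n x y" if "x \<in> lists {..<n}" "y \<in> lists {..<n}" "length x = k" "length y = k"
    "word_act n x (base_point n) = word_act n y (base_point n)" "depth n (word_act n x (base_point n)) = k" for x y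
    using Suc.hyps(1)[of x y] that by simp
  have pre: "coxeter_eq n (w @ x) (w @ y)" if "coxeter_eq n x y" for w x y
    using that by (intro coxeter_eq.append coxeter_eq.refl)
  have post: "coxeter_eq n (x @ w) (y @ w)" if "coxeter_eq n x y" for w x y
    using that by (intro coxeter_eq.append coxeter_eq.refl)
  consider "i = j" | "i \<noteq> j" "\<not> neighbours n i j" | "neighbours n i j" by blast
  then show ?case
  proof cases
    case 1
    then have "coxeter_eq n u' v'" using IH[of u' v'] i j len u'a v'a di by simp
    then show ?thesis using pre[of u' v' "[i]"] 1 unfolding u v by simp
  next
    case 2
    have "descent n j (gen_vec n i a)" by (rule descents_commute[OF n i(1) j(1) 2 dj(1)])
    then have "k = depth n (gen_vec n j (gen_vec n i a)) + 1"
      using depth_gen_vec_descent[OF n j(1) centres_regular[OF ai]] di(2) by simp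
    moreover obtain t where t: "t \<in> lists {..<n}" "word_act n t (base_point n) = gen_vec n j (gen_vec n i a)"
      "length t = depth n (gen_vec n j (gen_vec n i a))"
      using centre_has_reduced_word[OF n gen_vec_centres[OF n j(1) ai]] by metis
    ultimately have lt: "Suc (length t) = k" by simp
    have jt: "word_act n (j # t) (base_point n) = gen_vec n i a" using t(2) gen_vec_involution[OF n] by simp
    have it: "word_act n (i # t) (base_point n) = gen_vec n j a"
      using t(2) gen_vec_involution[OF n] gen_vec_commute[OF n i(1) j(1) 2(2)] by simp
    have "coxeter_eq n u' (j # t)" using IH[of u' "j # t"] i j len u'a jt di t lt by simp
    then have "coxeter_eq n u ([i, j] @ t)" using pre[of u' "j # t" "[i]"] unfolding u by simp
    moreover have "coxeter_eq n ([i, j] @ t) ([j, i] @ t)"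
      by (intro post coxeter_eq.commute i j 2)
    moreover have "coxeter_eq n v' (i # t)" using IH[of v' "i # t"] i j len v'a it dj t lt by simp
    then have "coxeter_eq n v ([j, i] @ t)" using pre[of v' "i # t" "[j]"] unfolding v by simp
    ultimately show ?thesis by (meson coxeter_eq.trans coxeter_eq.sym)
  next
    case 3
    note br = descents_braid[OF n i(1) j(1) 3 di(1) dj(1)]
    have aji: "gen_vec n j (gen_vec n i a) \<in> centres n" by (rule gen_vec_centres[OF n j(1) ai])
    define b where "b = gen_vec n i (gen_vec n j (gen_vec n i a))"
    have b: "b \<in> centres n" unfolding b_def by (rule gen_vec_centres[OF n i(1) aji])
    have b': "b = gen_vec n j (gen_vec n i (gen_vec n j a))"
      unfolding b_def by (rule gen_vec_braid[OF br(1) i(1) j(1) 3])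
    have "k = depth n b + 2"
      using depth_gen_vec_descent[OF n j(1) centres_regular[OF ai] br(2)]
        depth_gen_vec_descent[OF n i(1) centres_regular[OF aji] br(3)] di(2) unfolding b_def by simp
    moreover obtain t where t: "t \<in> lists {..<n}" "word_act n t (base_point n) = b" "length t = depth n b"
      using centre_has_reduced_word[OF n b] by metis
    ultimately have lt: "Suc (Suc (length t)) = k" by simp
    have jit: "word_act n (j # i # t) (base_point n) = gen_vec n i a"
      using t(2) gen_vec_involution[OF n] unfolding b_def by simp
    have ijt: "word_act n (i # j # t) (base_point n) = gen_vec n j a"
      using t(2) gen_vec_involution[OF n] unfolding b' by simp
    have "coxeter_eq n u' (j # i # t)" using IH[of u' "j # i # t"] i j len u'a jit di t lt by simp
    then have "coxeter_eq n u ([i, j, i] @ t)" using pre[of u' "j # i # t" "[i]"] unfolding u by simp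
    moreover have "coxeter_eq n ([i, j, i] @ t) ([j, i, j] @ t)"
      by (intro post coxeter_eq.braid br(1) i j 3)
    moreover have "coxeter_eq n v' (i # j # t)" using IH[of v' "i # j # t"] i j len v'a ijt dj t lt by simp
    then have "coxeter_eq n v ([j, i, j] @ t)" using pre[of v' "i # j # t" "[j]"] unfolding v by simp
    ultimately show ?thesis by (meson coxeter_eq.trans coxeter_eq.sym)
  qed
qed

text \<open>
  Prefixing a letter \<open>i\<close> to a reduced word stays reduced unless \<open>i\<close> is a descent. In that case the
  reduced word can be replaced by one that starts with \<open>i\<close>, and the two letters cancel.
\<close>

lemma word_reduces:
  assumes n: "2 \<le> n" and u: "u \<in> lists {..<n}"
  obtains t where "t \<in> lists {..<n}" "coxeter_eq n u t" "length t = depth n (word_act n t (base_point n))"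
proof -
  have "\<exists>t\<in>lists {..<n}. coxeter_eq n u t \<and> length t = depth n (word_act n t (base_point n))"
    using u
  proof (induction u)
    case Nil
    show ?case by (rule bexI[of _ "[]"]) (simp_all add: depth_base coxeter_eq.refl)
  next
    case (Cons i u)
    then have i: "i < n" "u \<in> lists {..<n}" by auto
    then obtain t where t: "t \<in> lists {..<n}" "coxeter_eq n u t" "length t = depth n (word_act n t (base_point n))"
      using Cons.IH by blast
    define a where "a = word_act n t (base_point n)"
    have a: "a \<in> centres n" unfolding a_def by (rule word_act_base_centre[OF n t(1)])
    have it: "coxeter_eq n (i # u) (i # t)"
      using coxeter_eq.append[OF coxeter_eq.refl[of n "[i]"] t(2)] by simp
    show ?case
    proof (cases "descent n i a")
      case False
      have "depth n (gen_vec n i a) = depth n a + 1"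
        by (rule depth_gen_vec_ascent[OF n i(1) centres_regular[OF a] False])
      then have "length (i # t) = depth n (word_act n (i # t) (base_point n))" using t(3) unfolding a_def by simp
      then show ?thesis using it t(1) i by (intro bexI[of _ "i # t"]) auto
    next
      case True
      have d: "depth n a = depth n (gen_vec n i a) + 1"
        by (rule depth_gen_vec_descent[OF n i(1) centres_regular[OF a] True])
      obtain s where s: "s \<in> lists {..<n}" "word_act n s (base_point n) = gen_vec n i a"
        "length s = depth n (gen_vec n i a)"
        using centre_has_reduced_word[OF n gen_vec_centres[OF n i(1) a]] by metis
      have "coxeter_eq n t (i # s)"
        by (rule reduced_words_equivalent[OF n t(1)])
          (use s i t(3) d gen_vec_involution[OF n] in \<open>simp_all add: a_def\<close>)
      then have "coxeter_eq n ([i] @ t) ([i] @ (i # s))" by (intro coxeter_eq.append coxeter_eq.refl)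
      moreover have "coxeter_eq n ([i, i] @ s) ([] @ s)"
        by (intro coxeter_eq.append coxeter_eq.refl coxeter_eq.square i)
      ultimately have "coxeter_eq n (i # u) s" using it by (simp del: append_Nil) (metis append_Nil coxeter_eq.trans)
      then show ?thesis using s by (intro bexI[of _ s]) auto
    qed
  qed
  then show ?thesis using that by blast
qed

text \<open>
  The presented group acts faithfully: an element is known from the image of the base point.
\<close>

lemma coxeter_eq_iff_word_act:
  assumes n: "2 \<le> n" and u: "u \<in> lists {..<n}" and v: "v \<in> lists {..<n}"
  shows "coxeter_eq n u v \<longleftrightarrow> word_act n u (base_point n) = word_act n v (base_point n)"
proof
  assume eq: "word_act n u (base_point n) = word_act n v (base_point n)"
  obtain s where s: "s \<in> lists {..<n}" "coxeter_eq n u s" "length s = depth n (word_act n s (base_point n))"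
    by (rule word_reduces[OF n u])
  obtain t where t: "t \<in> lists {..<n}" "coxeter_eq n v t" "length t = depth n (word_act n t (base_point n))"
    by (rule word_reduces[OF n v])
  have "word_act n s (base_point n) = word_act n t (base_point n)"
    using eq coxeter_eq_foldr_gen_vec[OF s(2) n] coxeter_eq_foldr_gen_vec[OF t(2) n] by simp
  then have "coxeter_eq n s t" using reduced_words_equivalent[OF n s(1) t(1)] s(3) t(3) by simp
  then show "coxeter_eq n u v" using s(2) t(2) by (meson coxeter_eq.trans coxeter_eq.sym)
qed (rule coxeter_eq_foldr_gen_vec[OF _ n])

lemma carrier_affine_sym: "carrier (affine_sym n) = (\<lambda>u. coxeter_rel n `` {u}) ` lists {..<n}"
  unfolding affine_sym_def quotient_def by auto

lemma word_class_iff: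
  assumes "u \<in> lists {..<n}"
  shows "v \<in> coxeter_rel n `` {u} \<longleftrightarrow> v \<in> lists {..<n} \<and> coxeter_eq n u v"
  using assms unfolding coxeter_rel_def by auto

lemma some_word:
  assumes "g \<in> carrier (affine_sym n)"
  shows "(SOME u. u \<in> g) \<in> lists {..<n}" "g = coxeter_rel n `` {SOME u. u \<in> g}"
proof -
  obtain u where u: "u \<in> lists {..<n}" "g = coxeter_rel n `` {u}" using assms unfolding carrier_affine_sym by blast
  then have "u \<in> g" using word_class_iff[OF u(1)] coxeter_eq.refl by simp
  then have v: "(SOME u. u \<in> g) \<in> g" by (rule someI)
  then show "(SOME u. u \<in> g) \<in> lists {..<n}" using word_class_iff[OF u(1)] u(2) by blast
  have "(u, SOME u. u \<in> g) \<in> coxeter_rel n" using v u(2) by simp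
  then have "coxeter_rel n `` {u} = coxeter_rel n `` {SOME u. u \<in> g}"
    by (rule equiv_class_eq[OF equiv_coxeter_rel])
  then show "g = coxeter_rel n `` {SOME u. u \<in> g}" by (rule HOL.trans[OF u(2)])
qed

lemma act_vec_class:
  assumes n: "2 \<le> n" and u: "u \<in> lists {..<n}"
  shows "act_vec n (coxeter_rel n `` {u}) a = word_act n u a"
proof -
  let ?g = "coxeter_rel n `` {u}"
  have g: "?g \<in> carrier (affine_sym n)" unfolding carrier_affine_sym using u by blast
  have "u \<in> ?g" using word_class_iff[OF u] u coxeter_eq.refl by simp
  then have "(SOME u. u \<in> ?g) \<in> ?g" by (rule someI)
  then have "coxeter_eq n u (SOME u. u \<in> ?g)" using word_class_iff[OF u] by simp
  then show ?thesis
    unfolding act_vec_def induced_action_def using coxeter_eq_foldr_gen_vec[OF _ n] by simp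
qed

lemma act_vec_mult:
  assumes n: "2 \<le> n" and g: "g \<in> carrier (affine_sym n)" and h: "h \<in> carrier (affine_sym n)"
  shows "act_vec n (g \<otimes>\<^bsub>affine_sym n\<^esub> h) a = act_vec n g (act_vec n h a)"
proof -
  obtain u v where uv: "u \<in> lists {..<n}" "g = coxeter_rel n `` {u}" "v \<in> lists {..<n}" "h = coxeter_rel n `` {v}"
    using g h unfolding carrier_affine_sym by blast
  show ?thesis
    unfolding uv(2,4) affine_sym_mult[OF uv(1,3)] act_vec_class[OF n uv(1)] act_vec_class[OF n uv(3)]
    by (subst act_vec_class[OF n]) (use uv in auto)
qed

lemma act_vec_one:
  assumes n: "2 \<le> n" shows "act_vec n \<one>\<^bsub>affine_sym n\<^esub> a = a"
  using act_vec_class[OF n, of "[]" a] by (simp add: affine_sym_def)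

lemma act_vec_inv:
  assumes n: "2 \<le> n" and g: "g \<in> carrier (affine_sym n)"
  shows "act_vec n (inv\<^bsub>affine_sym n\<^esub> g) (act_vec n g a) = a"
    and "act_vec n g (act_vec n (inv\<^bsub>affine_sym n\<^esub> g) a) = a"
  using act_vec_mult[OF n group.inv_closed[OF group_affine_sym g] g, of a, symmetric]
    act_vec_mult[OF n g group.inv_closed[OF group_affine_sym g], of a, symmetric]
    group.l_inv[OF group_affine_sym g] group.r_inv[OF group_affine_sym g] act_vec_one[OF n] by simp_all

lemma inv_class:
  assumes u: "u \<in> lists {..<n}"
  shows "inv\<^bsub>affine_sym n\<^esub> (coxeter_rel n `` {u}) = coxeter_rel n `` {rev u}"
proof -
  have r: "rev u \<in> lists {..<n}" using u by (simp add: in_lists_conv_set)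
  have "coxeter_rel n `` {rev u} \<otimes>\<^bsub>affine_sym n\<^esub> coxeter_rel n `` {u} = coxeter_rel n `` {[]}"
    unfolding affine_sym_mult[OF r u]
    by (rule equiv_class_eq[OF equiv_coxeter_rel])
      (use u r coxeter_eq_rev_append[OF u] in \<open>simp add: coxeter_rel_def\<close>)
  then have "coxeter_rel n `` {rev u} \<otimes>\<^bsub>affine_sym n\<^esub> coxeter_rel n `` {u} = \<one>\<^bsub>affine_sym n\<^esub>"
    by (simp add: affine_sym_def)
  then show ?thesis
    by (rule group.inv_equality[OF group_affine_sym]) (use u r in \<open>auto simp: carrier_affine_sym\<close>)
qed

lemma act_vec_centres:
  assumes n: "2 \<le> n" and g: "g \<in> carrier (affine_sym n)" and a: "a \<in> centres n"
  shows "act_vec n g a \<in> centres n"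
proof -
  obtain u where u: "u \<in> lists {..<n}" "g = coxeter_rel n `` {u}" using g unfolding carrier_affine_sym by blast
  show ?thesis unfolding u(2) act_vec_class[OF n u(1)] by (rule word_act_centres[OF n u(1) a])
qed

lemma act_vec_base_centre:
  assumes "2 \<le> n" "g \<in> carrier (affine_sym n)" shows "act_vec n g (base_point n) \<in> centres n"
  using act_vec_centres[OF assms base_centre] assms(1) by simp

lemma act_vec_base_inj:
  assumes n: "2 \<le> n" and g: "g \<in> carrier (affine_sym n)" and h: "h \<in> carrier (affine_sym n)"
    and eq: "act_vec n g (base_point n) = act_vec n h (base_point n)"
  shows "g = h"
proof -
  obtain u v where uv: "u \<in> lists {..<n}" "g = coxeter_rel n `` {u}" "v \<in> lists {..<n}" "h = coxeter_rel n `` {v}"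
    using g h unfolding carrier_affine_sym by blast
  have "coxeter_eq n u v"
    using eq unfolding coxeter_eq_iff_word_act[OF n uv(1,3)] uv(2,4) act_vec_class[OF n uv(1)] act_vec_class[OF n uv(3)] .
  then have "(u, v) \<in> coxeter_rel n" using uv unfolding coxeter_rel_def by simp
  then show ?thesis unfolding uv(2,4) by (rule equiv_class_eq[OF equiv_coxeter_rel])
qed

lemma act_vec_base_surj:
  assumes n: "2 \<le> n" and a: "a \<in> centres n"
  obtains g where "g \<in> carrier (affine_sym n)" "act_vec n g (base_point n) = a"
proof -
  obtain u where u: "u \<in> lists {..<n}" "word_act n u (base_point n) = a"
    by (rule centre_has_reduced_word[OF n a])
  show ?thesis
    by (rule that[of "coxeter_rel n `` {u}"]) (use u act_vec_class[OF n u(1)] in \<open>auto simp: carrier_affine_sym\<close>)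
qed

lemma cox_length_eq_depth:
  assumes n: "2 \<le> n" and g: "g \<in> carrier (affine_sym n)"
  shows "cox_length g = depth n (act_vec n g (base_point n))"
proof -
  obtain u where u: "u \<in> lists {..<n}" "g = coxeter_rel n `` {u}" using g unfolding carrier_affine_sym by blast
  obtain t where t: "t \<in> lists {..<n}" "coxeter_eq n u t" "length t = depth n (word_act n t (base_point n))"
    by (rule word_reduces[OF n u(1)])
  have eq: "word_act n v (base_point n) = act_vec n g (base_point n)" if "coxeter_eq n u v" for v
    unfolding u(2) act_vec_class[OF n u(1)] using coxeter_eq_foldr_gen_vec[OF that n] by simp
  show ?thesis
    unfolding cox_length_def
  proof (rule Least_equality)
    show "\<exists>v\<in>g. length v = depth n (act_vec n g (base_point n))"
      using t eq[OF t(2)] word_class_iff[OF u(1), of t] unfolding u(2) by (intro bexI[of _ t]) auto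
    fix k assume "\<exists>v\<in>g. length v = k"
    then obtain v where v: "v \<in> g" "length v = k" by blast
    then have "v \<in> lists {..<n}" "coxeter_eq n u v" using word_class_iff[OF u(1)] u(2) by auto
    then show "depth n (act_vec n g (base_point n)) \<le> k"
      using depth_word_act_le[OF n, of v] eq[of v] v(2) by simp
  qed
qed

text \<open>
  The reversed word represents the inverse.
\<close>

lemma cox_length_inv_le:
  assumes n: "2 \<le> n" and g: "g \<in> carrier (affine_sym n)"
  shows "cox_length (inv\<^bsub>affine_sym n\<^esub> g) \<le> cox_length g"
proof -
  obtain u where u: "u \<in> lists {..<n}" "g = coxeter_rel n `` {u}" using g unfolding carrier_affine_sym by blast
  have "\<exists>v\<in>g. length v = cox_length g"
    unfolding cox_length_def by (rule LeastI[of _ "length u"]) (use word_class_iff[OF u(1), of u] u coxeter_eq.refl in auto)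
  then obtain v where v: "v \<in> g" "length v = cox_length g" by blast
  then have v': "v \<in> lists {..<n}" "(u, v) \<in> coxeter_rel n" using word_class_iff[OF u(1)] u(2) by auto
  then have "g = coxeter_rel n `` {v}" using equiv_class_eq[OF equiv_coxeter_rel v'(2)] u(2) by simp
  then have inv: "inv\<^bsub>affine_sym n\<^esub> g = coxeter_rel n `` {rev v}" using inv_class[OF v'(1)] by simp
  have r: "rev v \<in> lists {..<n}" using v'(1) by (simp add: in_lists_conv_set)
  have "\<exists>w\<in>inv\<^bsub>affine_sym n\<^esub> g. length w = length v"
    unfolding inv using word_class_iff[OF r, of "rev v"] r coxeter_eq.refl by (intro bexI[of _ "rev v"]) auto
  then show ?thesis unfolding cox_length_def[of "inv\<^bsub>affine_sym n\<^esub> g"] v(2)[symmetric] by (rule Least_le)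
qed

lemma cox_length_inv:
  assumes n: "2 \<le> n" and g: "g \<in> carrier (affine_sym n)"
  shows "cox_length (inv\<^bsub>affine_sym n\<^esub> g) = cox_length g"
  using cox_length_inv_le[OF n g] cox_length_inv_le[OF n group.inv_closed[OF group_affine_sym g]]
    group.inv_inv[OF group_affine_sym g] by simp


section \<open>Minimal coset representatives and dominance\<close>

text \<open>
  For a regular point this says that it lies in the dominant chamber.
\<close>

definition decreasing :: "nat \<Rightarrow> vec \<Rightarrow> bool" where
  "decreasing n a \<longleftrightarrow> (\<forall>i\<in>{1..<n}. a (i + 1) < a i)"

lemma decreasing_less:
  assumes "decreasing n a" "1 \<le> x" "x < y" "y \<le> n" shows "a y < a x"
proof -
  have "Suc x \<le> y" using assms(3) by simp
  then show ?thesis using assms(4)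
  proof (induction y rule: dec_induct)
    case base
    then show ?case using assms(1,2) unfolding decreasing_def by auto
  next
    case (step y)
    then have "a (Suc y) < a y" using assms(1,2) unfolding decreasing_def by auto
    then show ?case using step by simp
  qed
qed

lemma decreasing_less_iff:
  assumes "decreasing n a" "x \<in> {1..n}" "y \<in> {1..n}" shows "a y < a x \<longleftrightarrow> x < y"
  using decreasing_less[OF assms(1), of x y] decreasing_less[OF assms(1), of y x] assms(2,3)
  by (cases x y rule: linorder_cases) auto

lemma decreasing_rank:
  assumes "decreasing n a" "x \<in> {1..n}"
  shows "card {s \<in> a ` {1..n}. a x \<le> s} = x"
proof -
  have inj: "inj_on a {1..n}"
    by (rule inj_onI) (metis decreasing_less_iff[OF assms(1)] linorder_neqE_nat order_less_irrefl)
  have le: "a x \<le> a y \<longleftrightarrow> y \<le> x" if "y \<in> {1..n}" for y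
    using decreasing_less_iff[OF assms(1,2) that] by (meson not_le)
  have "{s \<in> a ` {1..n}. a x \<le> s} = a ` {1..x}" using le assms(2) by auto
  moreover have "inj_on a {1..x}" by (rule inj_on_subset[OF inj]) (use assms(2) in auto)
  ultimately show ?thesis by (simp add: card_image)
qed

text \<open>
  In a decreasing vector each entry is determined by its rank in the set of entries.
\<close>

lemma decreasing_unique:
  assumes a: "decreasing n a" "a \<in> V n" and b: "decreasing n b" "b \<in> V n"
    and img: "a ` {1..n} = b ` {1..n}"
  shows "a = b"
proof
  fix x
  have not_less: "\<not> f x < g x" if f: "decreasing n f" and g: "decreasing n g"
    and fg: "f ` {1..n} = g ` {1..n}" and x: "x \<in> {1..n}" for f g
  proof
    assume lt: "f x < g x"
    have "f x \<in> {s \<in> f ` {1..n}. f x \<le> s}" "f x \<notin> {s \<in> g ` {1..n}. g x \<le> s}" using lt x by auto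
    moreover have "{s \<in> g ` {1..n}. g x \<le> s} \<subseteq> {s \<in> f ` {1..n}. f x \<le> s}"
      using lt unfolding fg by auto
    ultimately have "{s \<in> g ` {1..n}. g x \<le> s} \<subset> {s \<in> f ` {1..n}. f x \<le> s}" by blast
    then have "card {s \<in> g ` {1..n}. g x \<le> s} < card {s \<in> f ` {1..n}. f x \<le> s}"
      by (intro psubset_card_mono) auto
    then show False using decreasing_rank[OF f x] decreasing_rank[OF g x] by simp
  qed
  show "a x = b x"
  proof (cases "x \<in> {1..n}")
    case True
    then show ?thesis using not_less[OF a(1) b(1) img] not_less[OF b(1) a(1) img[symmetric]] by (meson linorder_neqE)
  next
    case False
    then show ?thesis using a(2) b(2) unfolding V_def by auto
  qed
qed

lemma not_decreasing_descent:
  assumes a: "a \<in> regular n" and nd: "\<not> decreasing n a"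
  obtains i where "1 \<le> i" "i < n" "descent n i a"
proof -
  obtain i where i: "i \<in> {1..<n}" "\<not> a (i + 1) < a i" using nd unfolding decreasing_def by blast
  have "a i - a (i + 1) \<notin> \<int>" using a i(1) unfolding regular_def by auto
  then have "a i \<noteq> a (i + 1)" by (metis Ints_0 diff_self)
  then show ?thesis using i by (intro that[of i]) (auto simp: descent_def)
qed

lemma gen_vec_image:
  assumes "1 \<le> i" "i < n" shows "gen_vec n i a ` {1..n} = a ` {1..n}"
proof -
  define \<tau> where "\<tau> = id(i := i + 1, i + 1 := i)"
  have "gen_vec n i a = a \<circ> \<tau>" using assms unfolding \<tau>_def gen_vec_def by (auto simp: fun_eq_iff)
  moreover have "\<tau> ` {1..n} = {1..n}"
  proof
    show sub: "\<tau> ` {1..n} \<subseteq> {1..n}" using assms unfolding \<tau>_def by auto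
    have inv: "\<tau> (\<tau> x) = x" for x unfolding \<tau>_def by auto
    show "{1..n} \<subseteq> \<tau> ` {1..n}"
    proof
      fix x assume "x \<in> {1..n}"
      then have "\<tau> x \<in> {1..n}" using sub by blast
      then show "x \<in> \<tau> ` {1..n}" using inv[of x] by (intro image_eqI[of _ _ "\<tau> x"]) simp_all
    qed
  qed
  ultimately show ?thesis by (metis image_comp)
qed

text \<open>
  Sorting by adjacent transpositions at descents lowers the depth in each step and ends at the only
  decreasing rearrangement.
\<close>

lemma depth_decreasing_minimal:
  assumes n: "2 \<le> n" and a: "decreasing n a" "a \<in> V n"
    and b: "b \<in> regular n" and img: "b ` {1..n} = a ` {1..n}"
  shows "depth n a \<le> depth n b"
  using b img
proof (induction "depth n b" arbitrary: b rule: less_induct)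
  case (less b)
  show ?case
  proof (cases "decreasing n b")
    case True
    then have "b = a" using decreasing_unique[OF _ regular_V a less.prems(2)] less.prems(1) by simp
    then show ?thesis by simp
  next
    case False
    then obtain i where i: "1 \<le> i" "i < n" "descent n i b" using not_decreasing_descent[OF less.prems(1)] by blast
    have "depth n b = depth n (gen_vec n i b) + 1"
      by (rule depth_gen_vec_descent[OF n i(2) less.prems(1) i(3)])
    then show ?thesis
      using less.hyps[of "gen_vec n i b"] gen_vec_regular[OF n i(2) less.prems(1)]
        gen_vec_image[OF i(1,2)] less.prems(2) by simp
  qed
qed

lemma gen_carrier: "i < n \<Longrightarrow> gen n i \<in> carrier (affine_sym n)"
  unfolding gen_def carrier_affine_sym by auto

lemma act_vec_gen:
  assumes "2 \<le> n" "i < n" shows "act_vec n (gen n i) a = gen_vec n i a"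
  unfolding gen_def using act_vec_class[OF assms(1), of "[i]"] assms(2) by simp

lemma inv_gen: "i < n \<Longrightarrow> inv\<^bsub>affine_sym n\<^esub> (gen n i) = gen n i"
  unfolding gen_def using inv_class[of "[i]" n] by simp

lemma gen_in_finite_sym: "i \<in> {1..n - 1} \<Longrightarrow> gen n i \<in> finite_sym n"
  unfolding finite_sym_def by (rule generate.incl) simp

text \<open>
  The finite group permutes coordinates; all that matters below is that it preserves the set of
  coordinates and fixes the origin.
\<close>

lemma finite_sym_act:
  assumes n: "2 \<le> n" and s: "s \<in> finite_sym n"
  shows "s \<in> carrier (affine_sym n)" "\<And>a. act_vec n s a ` {1..n} = a ` {1..n}"
    "act_vec n s (\<lambda>_. 0) = (\<lambda>_. 0)"
proof -
  let ?P = "\<lambda>s. s \<in> carrier (affine_sym n) \<and> (\<forall>a. act_vec n s a ` {1..n} = a ` {1..n}) \<and>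
    act_vec n s (\<lambda>_. 0) = (\<lambda>_. 0)"
  have g: "?P (gen n i)" if "i \<in> {1..n - 1}" for i
  proof -
    have i: "1 \<le> i" "i < n" using that n by auto
    show ?thesis
      using gen_carrier[OF i(2)] act_vec_gen[OF n i(2)] gen_vec_image[OF i] i
      by (auto simp: gen_vec_def fun_eq_iff)
  qed
  have "?P s"
    using s unfolding finite_sym_def
  proof (induction rule: generate.induct)
    case one
    then show ?case
      using group.is_monoid[OF group_affine_sym] by (simp add: act_vec_one[OF n] monoid.one_closed)
  next
    case (incl h)
    then show ?case using g by blast
  next
    case (inv h)
    then obtain i where i: "i \<in> {1..n - 1}" "h = gen n i" by blast
    then have "i < n" using n by auto
    then show ?case using g[OF i(1)] inv_gen[of i n] i(2) by simp
  next
    case (eng h1 h2)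
    have m: "act_vec n (h1 \<otimes>\<^bsub>affine_sym n\<^esub> h2) a = act_vec n h1 (act_vec n h2 a)" for a
      by (rule act_vec_mult[OF n]) (use eng.IH in blast)+
    have "h1 \<otimes>\<^bsub>affine_sym n\<^esub> h2 \<in> carrier (affine_sym n)"
      using group.is_monoid[OF group_affine_sym] eng.IH by (simp add: monoid.m_closed)
    then show ?case using eng.IH by (simp add: m)
  qed
  then show "s \<in> carrier (affine_sym n)" "\<And>a. act_vec n s a ` {1..n} = a ` {1..n}"
    "act_vec n s (\<lambda>_. 0) = (\<lambda>_. 0)" by blast+
qed

text \<open>
  The lengths of the elements \<open>g s\<close> of the coset are the depths of the points \<open>s\<^sup>-\<^sup>1 q\<close> with \<open>q = g\<^sup>-\<^sup>1 p\<close>,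
  and these points are rearrangements of \<open>q\<close>. The depth is smallest at the decreasing one.
\<close>

lemma min_coset_reps_iff:
  assumes n: "2 \<le> n"
  shows "g \<in> min_coset_reps n \<longleftrightarrow> g \<in> carrier (affine_sym n) \<and>
    decreasing n (act_vec n (inv\<^bsub>affine_sym n\<^esub> g) (base_point n))"
proof (cases "g \<in> carrier (affine_sym n)")
  case g: True
  let ?G = "affine_sym n"
  define q where "q = act_vec n (inv\<^bsub>?G\<^esub> g) (base_point n)"
  note gr = group_affine_sym[of n]
  have q: "q \<in> centres n"
    unfolding q_def by (rule act_vec_base_centre[OF n group.inv_closed[OF gr g]])
  have len: "cox_length u = depth n (act_vec n (inv\<^bsub>?G\<^esub> u) (base_point n))" if "u \<in> carrier ?G" for u
    using cox_length_eq_depth[OF n group.inv_closed[OF gr that]] cox_length_inv[OF n that] by simp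
  have coset: "cox_length (g \<otimes>\<^bsub>?G\<^esub> s) = depth n (act_vec n (inv\<^bsub>?G\<^esub> s) q)" if s: "s \<in> carrier ?G" for s
  proof -
    have gs: "g \<otimes>\<^bsub>?G\<^esub> s \<in> carrier ?G" using gr g s by (simp add: group.is_monoid monoid.m_closed)
    have "inv\<^bsub>?G\<^esub> (g \<otimes>\<^bsub>?G\<^esub> s) = inv\<^bsub>?G\<^esub> s \<otimes>\<^bsub>?G\<^esub> inv\<^bsub>?G\<^esub> g" by (rule group.inv_mult_group[OF gr g s])
    then show ?thesis
      unfolding len[OF gs] q_def
      using act_vec_mult[OF n group.inv_closed[OF gr s] group.inv_closed[OF gr g]] by simp
  qed
  have inv_s: "inv\<^bsub>?G\<^esub> s \<in> finite_sym n" if "s \<in> finite_sym n" for s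
    using that unfolding finite_sym_def
    by (intro group.generate_m_inv_closed[OF gr]) (use gen_carrier n in auto)
  show ?thesis
  proof
    assume "g \<in> min_coset_reps n"
    then have min: "cox_length g \<le> cox_length u" if "u \<in> g <#\<^bsub>?G\<^esub> finite_sym n" for u
      using that unfolding min_coset_reps_def by blast
    have "decreasing n q"
    proof (rule ccontr)
      assume "\<not> decreasing n q"
      then obtain i where i: "1 \<le> i" "i < n" "descent n i q"
        using not_decreasing_descent[OF centres_regular[OF q]] by blast
      have "gen n i \<in> finite_sym n" using i by (intro gen_in_finite_sym) auto
      then have "g \<otimes>\<^bsub>?G\<^esub> gen n i \<in> g <#\<^bsub>?G\<^esub> finite_sym n" unfolding l_coset_def by blast
      then have "cox_length g \<le> cox_length (g \<otimes>\<^bsub>?G\<^esub> gen n i)" by (rule min)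
      also have "\<dots> = depth n (gen_vec n i q)"
        using coset[OF gen_carrier[OF i(2)]] inv_gen[OF i(2)] act_vec_gen[OF n i(2)] by simp
      finally show False
        using depth_gen_vec_descent[OF n i(2) centres_regular[OF q] i(3)] len[OF g] unfolding q_def by simp
    qed
    then show "g \<in> carrier ?G \<and> decreasing n (act_vec n (inv\<^bsub>?G\<^esub> g) (base_point n))" using g unfolding q_def by blast
  next
    assume "g \<in> carrier ?G \<and> decreasing n (act_vec n (inv\<^bsub>?G\<^esub> g) (base_point n))"
    then have dec: "decreasing n q" unfolding q_def by blast
    have "cox_length g \<le> cox_length u" if u: "u \<in> g <#\<^bsub>?G\<^esub> finite_sym n" for u
    proof -
      obtain s where s: "s \<in> finite_sym n" "u = g \<otimes>\<^bsub>?G\<^esub> s" using u unfolding l_coset_def by blast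
      note fs = finite_sym_act[OF n inv_s[OF s(1)]]
      have "depth n q \<le> depth n (act_vec n (inv\<^bsub>?G\<^esub> s) q)"
        by (rule depth_decreasing_minimal[OF n dec regular_V[OF centres_regular[OF q]]
              centres_regular[OF act_vec_centres[OF n fs(1) q]] fs(2)])
      then show ?thesis
        using coset[OF finite_sym_act(1)[OF n s(1)]] len[OF g] unfolding s(2) q_def by simp
    qed
    then show "g \<in> min_coset_reps n" unfolding min_coset_reps_def using g by blast
  qed
qed (simp add: min_coset_reps_def)

lemma gen_vec_diff_image:
  assumes n: "2 \<le> n" and i: "i < n"
  shows "(\<lambda>k. gen_vec n i x k - c k) ` {1..n} = (\<lambda>k. x k - gen_vec n i c k) ` {1..n}"
proof -
  define \<tau> where "\<tau> = (if i = 0 then id(1 := n, n := 1) else id(i := i + 1, i + 1 := i))"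
  have inv: "\<tau> (\<tau> k) = k" for k unfolding \<tau>_def by auto
  have sub: "\<tau> k \<in> {1..n}" if "k \<in> {1..n}" for k using that n i unfolding \<tau>_def by auto
  have eq: "gen_vec n i x k - c k = x (\<tau> k) - gen_vec n i c (\<tau> k)" for k
    using n unfolding \<tau>_def gen_vec_def by auto
  show ?thesis
  proof
    show "(\<lambda>k. gen_vec n i x k - c k) ` {1..n} \<subseteq> (\<lambda>k. x k - gen_vec n i c k) ` {1..n}"
      using eq sub by blast
    show "(\<lambda>k. x k - gen_vec n i c k) ` {1..n} \<subseteq> (\<lambda>k. gen_vec n i x k - c k) ` {1..n}"
    proof
      fix y assume "y \<in> (\<lambda>k. x k - gen_vec n i c k) ` {1..n}"
      then obtain k where "k \<in> {1..n}" "y = x k - gen_vec n i c k" by blast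
      then show "y \<in> (\<lambda>k. gen_vec n i x k - c k) ` {1..n}"
        using eq[of "\<tau> k"] inv[of k] sub[of k] by (intro image_eqI[of _ _ "\<tau> k"]) simp_all
    qed
  qed
qed

text \<open>
  If \<open>g\<close> is \<open>v \<mapsto> u v + c\<close>, then \<open>g\<^sup>-\<^sup>1 x = u\<^sup>-\<^sup>1 (x - c)\<close>, whose coordinates are those of \<open>x - c\<close> in
  another order.
\<close>

lemma inverse_act_image:
  assumes n: "2 \<le> n" and g: "g \<in> carrier (affine_sym n)"
  shows "act_vec n (inv\<^bsub>affine_sym n\<^esub> g) x ` {1..n} = (\<lambda>k. x k - act_vec n g (\<lambda>_. 0) k) ` {1..n}"
proof -
  obtain u where u: "u \<in> lists {..<n}" "g = coxeter_rel n `` {u}" using g unfolding carrier_affine_sym by blast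
  have r: "rev u \<in> lists {..<n}" using u(1) by (simp add: in_lists_conv_set)
  have "word_act n (rev u) x ` {1..n} = (\<lambda>k. x k - word_act n u (\<lambda>_. 0) k) ` {1..n}"
    using u(1)
  proof (induction u arbitrary: x)
    case (Cons i u)
    then show ?case using gen_vec_diff_image[OF n, of i x "word_act n u (\<lambda>_. 0)"] by simp
  qed simp
  then show ?thesis unfolding u(2) inv_class[OF u(1)] act_vec_class[OF n u(1)] act_vec_class[OF n r] .
qed

lemma zero_int_lattice: "(\<lambda>_. 0) \<in> int_lattice n"
  unfolding int_lattice_def V_def by simp

lemma act_vec_int_lattice:
  assumes n: "2 \<le> n" and g: "g \<in> carrier (affine_sym n)" and c: "c \<in> int_lattice n"
  shows "act_vec n g c \<in> int_lattice n"
proof -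
  obtain u where u: "u \<in> lists {..<n}" "g = coxeter_rel n `` {u}" using g unfolding carrier_affine_sym by blast
  have "word_act n u c \<in> int_lattice n"
    using u(1) by (induction u) (use c gen_vec_int_lattice[OF n] in auto)
  then show ?thesis unfolding u(2) act_vec_class[OF n u(1)] .
qed

text \<open>
  The centre \<open>g\<^sup>-\<^sup>1 p\<close> is the decreasing rearrangement of \<open>p - g 0\<close>, and it determines \<open>g\<close>.
\<close>

lemma min_coset_rep_unique:
  assumes n: "2 \<le> n" and g: "g \<in> min_coset_reps n" and h: "h \<in> min_coset_reps n"
    and eq: "act_vec n g (\<lambda>_. 0) = act_vec n h (\<lambda>_. 0)"
  shows "g = h"
proof -
  let ?G = "affine_sym n"
  have gc: "g \<in> carrier ?G" and gd: "decreasing n (act_vec n (inv\<^bsub>?G\<^esub> g) (base_point n))"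
    using g min_coset_reps_iff[OF n] by auto
  have hc: "h \<in> carrier ?G" and hd: "decreasing n (act_vec n (inv\<^bsub>?G\<^esub> h) (base_point n))"
    using h min_coset_reps_iff[OF n] by auto
  note inv = group.inv_closed[OF group_affine_sym]
  have V: "act_vec n (inv\<^bsub>?G\<^esub> w) (base_point n) \<in> V n" if "w \<in> carrier ?G" for w
    using act_vec_base_centre[OF n inv[OF that]] by (intro regular_V centres_regular)
  have "act_vec n (inv\<^bsub>?G\<^esub> g) (base_point n) = act_vec n (inv\<^bsub>?G\<^esub> h) (base_point n)"
    by (rule decreasing_unique[OF gd V[OF gc] hd V[OF hc]])
      (simp only: inverse_act_image[OF n gc] inverse_act_image[OF n hc] eq)
  then have "inv\<^bsub>?G\<^esub> g = inv\<^bsub>?G\<^esub> h" by (rule act_vec_base_inj[OF n inv[OF gc] inv[OF hc]])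
  then show ?thesis using group.inv_inv[OF group_affine_sym] gc hc by metis
qed

lemma base_minus_lattice_centre:
  assumes n: "2 \<le> n" and c: "c \<in> int_lattice n"
  shows "(\<lambda>k. base_point n k - c k) \<in> centres n"
proof -
  have b: "base_point n \<in> centres n" using base_centre n by simp
  have cZ: "c k \<in> \<int>" for k using c unfolding int_lattice_def by blast
  have "(\<Sum>k=1..n. base_point n k - c k) = 0"
    using sum_base[of n] c unfolding int_lattice_def V_def by (simp add: sum_subtractf)
  then have "(\<lambda>k. base_point n k - c k) \<in> V n" using c unfolding int_lattice_def V_def by (auto simp: base_point_def)
  moreover have "base_point n x - c x - (base_point n y - c y) \<notin> \<int>" if xy: "x \<in> {1..n}" "y \<in> {1..n}" "x \<noteq> y" for x y
  proof
    assume "base_point n x - c x - (base_point n y - c y) \<in> \<int>"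
    from Ints_add[OF this Ints_diff[OF cZ[of x] cZ[of y]]] have "base_point n x - base_point n y \<in> \<int>" by simp
    then show False using b xy unfolding centres_def regular_def by blast
  qed
  moreover have "real n * (base_point n x - c x - (base_point n y - c y)) \<in> \<int>" if xy: "x \<in> {1..n}" "y \<in> {1..n}" for x y
  proof -
    have "real n * (base_point n x - base_point n y) \<in> \<int>" using b xy unfolding centres_def by blast
    from Ints_diff[OF this Ints_mult[OF Ints_of_nat Ints_diff[OF cZ[of x] cZ[of y]]], of n]
    show ?thesis by (simp add: algebra_simps)
  qed
  ultimately show ?thesis unfolding centres_def regular_def by blast
qed

text \<open>
  The point \<open>p - c\<close> is a centre, say \<open>w\<^sup>-\<^sup>1 p\<close>. The coordinates of \<open>p\<close> are distinct modulo integers, so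
  \<open>w 0\<close> can be read off from \<open>w\<^sup>-\<^sup>1 p\<close> and equals \<open>c\<close>; all elements of the coset of \<open>w\<close> map \<open>0\<close> to \<open>c\<close>.
\<close>

lemma min_coset_rep_exists:
  assumes n: "2 \<le> n" and c: "c \<in> int_lattice n"
  obtains g where "g \<in> min_coset_reps n" "act_vec n g (\<lambda>_. 0) = c"
proof -
  let ?G = "affine_sym n"
  note gr = group_affine_sym[of n]
  obtain k where k: "k \<in> carrier ?G" "act_vec n k (base_point n) = (\<lambda>k. base_point n k - c k)"
    by (rule act_vec_base_surj[OF n base_minus_lattice_centre[OF n c]])
  define w where "w = inv\<^bsub>?G\<^esub> k"
  have w: "w \<in> carrier ?G" and invw: "inv\<^bsub>?G\<^esub> w = k"
    unfolding w_def using group.inv_closed[OF gr k(1)] group.inv_inv[OF gr k(1)] by simp_all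
  define d where "d = act_vec n w (\<lambda>_. 0)"
  have d: "d \<in> int_lattice n" unfolding d_def by (rule act_vec_int_lattice[OF n w zero_int_lattice])
  have img: "(\<lambda>k. base_point n k - c k) ` {1..n} = (\<lambda>k. base_point n k - d k) ` {1..n}"
    using inverse_act_image[OF n w, of "base_point n"] unfolding invw k(2) d_def .
  have "d x = c x" for x
  proof (cases "x \<in> {1..n}")
    case True
    then have "base_point n x - d x \<in> (\<lambda>k. base_point n k - c k) ` {1..n}" unfolding img by blast
    then obtain y where y: "y \<in> {1..n}" "base_point n x - d x = base_point n y - c y" by auto
    have "d x - c y \<in> \<int>" using d c unfolding int_lattice_def by (intro Ints_diff) auto
    moreover have "base_point n x - base_point n y = d x - c y" using y(2) by simp
    ultimately have "base_point n x - base_point n y \<in> \<int>" by simp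
    moreover have "base_point n \<in> regular n" using base_centre[of n] n by (intro centres_regular) simp
    ultimately have "x = y" using True y(1) unfolding regular_def by blast
    then show ?thesis using y by simp
  next
    case False
    then show ?thesis using c d unfolding int_lattice_def V_def by auto
  qed
  then have wc: "act_vec n w (\<lambda>_. 0) = c" unfolding d_def by blast
  have one: "\<one>\<^bsub>?G\<^esub> \<in> finite_sym n" unfolding finite_sym_def by (rule generate.one)
  have "w \<in> w <#\<^bsub>?G\<^esub> finite_sym n"
    unfolding l_coset_def using one gr w by (auto simp: group.is_monoid monoid.r_one intro!: bexI[of _ "\<one>\<^bsub>?G\<^esub>"])
  then obtain g where g: "g \<in> w <#\<^bsub>?G\<^esub> finite_sym n"
    and min: "\<And>u. u \<in> w <#\<^bsub>?G\<^esub> finite_sym n \<Longrightarrow> cox_length g \<le> cox_length u"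
    using ex_has_least_nat[of "\<lambda>u. u \<in> w <#\<^bsub>?G\<^esub> finite_sym n" w cox_length] by blast
  obtain s where s: "s \<in> finite_sym n" "g = w \<otimes>\<^bsub>?G\<^esub> s" using g unfolding l_coset_def by blast
  note sc = finite_sym_act(1)[OF n s(1)]
  have gc: "g \<in> carrier ?G" unfolding s(2) using gr w sc by (simp add: group.is_monoid monoid.m_closed)
  have "g \<in> min_coset_reps n"
    unfolding min_coset_reps_def
  proof (intro CollectI conjI gc ballI)
    fix u assume "u \<in> g <#\<^bsub>?G\<^esub> finite_sym n"
    then obtain t where t: "t \<in> finite_sym n" "u = g \<otimes>\<^bsub>?G\<^esub> t" unfolding l_coset_def by blast
    have "s \<otimes>\<^bsub>?G\<^esub> t \<in> finite_sym n" using s(1) t(1) unfolding finite_sym_def by (rule generate.eng)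
    moreover have "u = w \<otimes>\<^bsub>?G\<^esub> (s \<otimes>\<^bsub>?G\<^esub> t)"
      unfolding t(2) s(2) using gr w sc finite_sym_act(1)[OF n t(1)] by (simp add: group.is_monoid monoid.m_assoc)
    ultimately have "u \<in> w <#\<^bsub>?G\<^esub> finite_sym n" unfolding l_coset_def by blast
    then show "cox_length g \<le> cox_length u" by (rule min)
  qed
  moreover have "act_vec n g (\<lambda>_. 0) = c"
    unfolding s(2) act_vec_mult[OF n w sc] finite_sym_act(3)[OF n s(1)] by (rule wc)
  ultimately show ?thesis by (rule that)
qed


section \<open>Alcoves and Shi regions as sign cells\<close>

definition arrangement_complement :: "nat \<Rightarrow> int set \<Rightarrow> vec set" where
  "arrangement_complement n K = {v \<in> V n. \<forall>(x, y)\<in>pairs n. \<forall>k\<in>K. v x - v y \<noteq> of_int k}"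

text \<open>
  The points on the same side as \<open>a\<close> of every hyperplane \<open>x\<^sub>i - x\<^sub>j = k\<close> with \<open>k \<in> K\<close>. Alcoves are the case
  \<open>K = UNIV\<close>; for Shi regions \<open>K\<close> is the interval \<open>{- m<..m}\<close>.
\<close>

definition cell :: "nat \<Rightarrow> int set \<Rightarrow> vec \<Rightarrow> vec set" where
  "cell n K a = {v \<in> arrangement_complement n K. \<forall>(x, y)\<in>pairs n. \<forall>k\<in>K. of_int k < v x - v y \<longleftrightarrow> of_int k < a x - a y}"

lemma ip_eps_diff:
  assumes "x \<in> {1..n}" "y \<in> {1..n}" shows "ip n v (eps x - eps y) = v x - v y"
proof -
  have "ip n v (eps x - eps y) = (\<Sum>i=1..n. v i * (if i = x then 1 else 0)) - (\<Sum>i=1..n. v i * (if i = y then 1 else 0))"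
    unfolding ip_def eps_def by (simp add: right_diff_distrib sum_subtractf)
  then show ?thesis using assms by (simp add: if_distrib cong: if_cong)
qed

lemma complement_eq: "V n - (\<Union>\<alpha>\<in>positive_roots n. \<Union>k\<in>K. hyperplane n \<alpha> k) = arrangement_complement n K"
proof -
  have "v \<in> (\<Union>\<alpha>\<in>positive_roots n. \<Union>k\<in>K. hyperplane n \<alpha> k) \<longleftrightarrow>
      v \<in> V n \<and> (\<exists>(x, y)\<in>pairs n. \<exists>k\<in>K. v x - v y = of_int k)" for v
  proof -
    have roots: "positive_roots n = (\<lambda>(x, y). eps x - eps y) ` pairs n"
      unfolding positive_roots_def pairs_def by auto
    have "ip n v (eps x - eps y) = v x - v y" if "(x, y) \<in> pairs n" for x y
      by (rule ip_eps_diff) (use that in \<open>auto simp: pairs_def\<close>)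
    then have "(\<exists>(x, y)\<in>pairs n. \<exists>k\<in>K. ip n v (eps x - eps y) = of_int k) \<longleftrightarrow>
        (\<exists>(x, y)\<in>pairs n. \<exists>k\<in>K. v x - v y = of_int k)"
      by (intro bex_cong HOL.refl) auto
    moreover have "v \<in> (\<Union>\<alpha>\<in>positive_roots n. \<Union>k\<in>K. hyperplane n \<alpha> k) \<longleftrightarrow>
        v \<in> V n \<and> (\<exists>(x, y)\<in>pairs n. \<exists>k\<in>K. ip n v (eps x - eps y) = of_int k)"
      unfolding roots hyperplane_def by (auto simp: case_prod_unfold)
    ultimately show ?thesis by blast
  qed
  then have "v \<in> V n - (\<Union>\<alpha>\<in>positive_roots n. \<Union>k\<in>K. hyperplane n \<alpha> k) \<longleftrightarrow> v \<in> arrangement_complement n K" for v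
    unfolding arrangement_complement_def by (simp only: Diff_iff mem_Collect_eq) blast
  then show ?thesis by blast
qed

text \<open>
  A connected set that avoids a hyperplane stays on one side of it; conversely a cell is convex, so its
  points are joined by segments.
\<close>

lemma connected_component_complement:
  assumes a: "a \<in> arrangement_complement n K"
  shows "connected_component_set (arrangement_complement n K) a = cell n K a"
proof
  show "connected_component_set (arrangement_complement n K) a \<subseteq> cell n K a"
  proof
    fix b assume "b \<in> connected_component_set (arrangement_complement n K) a"
    then obtain T where T: "connected T" "T \<subseteq> arrangement_complement n K" "a \<in> T" "b \<in> T"
      unfolding connected_component_def by auto
    have "of_int k < b x - b y \<longleftrightarrow> of_int k < a x - a y" if xy: "(x, y) \<in> pairs n" "k \<in> K" for x y k
    proof -
      have con: "connected ((\<lambda>v. v x - v y) ` T)"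
        by (rule connected_continuous_image[OF _ T(1)]) (intro continuous_on_diff continuous_on_subset[OF continuous_on_product_coordinates] subset_UNIV)
      have avoid: "of_int k \<notin> (\<lambda>v. v x - v y) ` T"
        using T(2) xy unfolding arrangement_complement_def by force
      \<comment> \<open>Otherwise the values on \<open>T\<close> would form an interval that contains \<open>k\<close>.\<close>
      have side: False if "v \<in> T" "w \<in> T" "v x - v y \<le> of_int k" "of_int k \<le> w x - w y" for v w
      proof -
        have "of_int k \<in> (\<lambda>v. v x - v y) ` T"
          by (rule connectedD_interval[OF con, of "v x - v y" "w x - w y"]) (use that in auto)
        then show False using avoid by blast
      qed
      show ?thesis
        using side[OF T(3,4)] side[OF T(4,3)] by (meson less_imp_le not_le)
    qed
    then show "b \<in> cell n K a" using T unfolding cell_def by auto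
  qed
next
  show "cell n K a \<subseteq> connected_component_set (arrangement_complement n K) a"
  proof
    fix b assume b: "b \<in> cell n K a"
    then have bc: "b \<in> arrangement_complement n K"
      and side: "\<And>x y k. (x, y) \<in> pairs n \<Longrightarrow> k \<in> K \<Longrightarrow> of_int k < b x - b y \<longleftrightarrow> of_int k < a x - a y"
      unfolding cell_def by auto
    define p where "p t = (\<lambda>i. (1 - t) * a i + t * b i)" for t :: real
    have cont: "continuous_on {0..1} p"
      unfolding p_def by (intro continuous_on_coordinatewise_then_product continuous_intros)
    have "p t \<in> arrangement_complement n K" if t: "t \<in> {0..1}" for t
    proof -
      have "(\<Sum>i=1..n. p t i) = (1 - t) * (\<Sum>i=1..n. a i) + t * (\<Sum>i=1..n. b i)"
        unfolding p_def by (simp add: sum.distrib sum_distrib_left)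
      then have "p t \<in> V n" using a bc unfolding arrangement_complement_def V_def by (auto simp: p_def)
      moreover have "p t x - p t y \<noteq> of_int k" if xy: "(x, y) \<in> pairs n" "k \<in> K" for x y k
      proof -
        have e: "p t x - p t y = (1 - t) * (a x - a y) + t * (b x - b y)"
          unfolding p_def by (simp add: algebra_simps)
        have ne: "a x - a y \<noteq> of_int k" "b x - b y \<noteq> of_int k"
          using a bc xy unfolding arrangement_complement_def by auto
        show ?thesis
        proof (cases "of_int k < a x - a y")
          case True
          then have "of_int k < b x - b y" using side[OF xy] by simp
          then have "(1 - t) * (- (a x - a y)) + t * (- (b x - b y)) < - of_int k"
            using True t by (intro convex_bound_lt) auto
          then show ?thesis unfolding e by (simp add: algebra_simps)
        next
          case False
          then have "a x - a y < of_int k" "b x - b y < of_int k" using side[OF xy] ne by auto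
          then have "(1 - t) * (a x - a y) + t * (b x - b y) < of_int k"
            using t by (intro convex_bound_lt) auto
          then show ?thesis unfolding e by simp
        qed
      qed
      ultimately show ?thesis unfolding arrangement_complement_def by auto
    qed
    then have "p ` {0..1} \<subseteq> arrangement_complement n K" by blast
    moreover have "connected (p ` {0..1})" by (rule connected_continuous_image[OF cont]) simp
    moreover have "a \<in> p ` {0..1}" by (rule image_eqI[of _ _ 0]) (auto simp: p_def)
    moreover have "b \<in> p ` {0..1}" by (rule image_eqI[of _ _ 1]) (auto simp: p_def)
    ultimately show "b \<in> connected_component_set (arrangement_complement n K) a"
      unfolding connected_component_def by auto
  qed
qed

lemma components_complement: "components (arrangement_complement n K) = cell n K ` arrangement_complement n K"
  unfolding components_def using connected_component_complement by (intro image_cong) auto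

lemma alcoves_eq: "alcoves n = cell n UNIV ` arrangement_complement n UNIV"
  unfolding alcoves_def complement_eq components_complement ..

lemma shi_regions_eq: "shi_regions n m = cell n {- int m<..int m} ` arrangement_complement n {- int m<..int m}"
  unfolding shi_regions_def complement_eq components_complement ..

lemma cell_refl: "a \<in> arrangement_complement n K \<Longrightarrow> a \<in> cell n K a"
  unfolding cell_def by auto

lemma cell_eqI:
  assumes "b \<in> cell n K a" shows "cell n K b = cell n K a"
proof -
  have side: "of_int k < b x - b y \<longleftrightarrow> of_int k < a x - a y" if "(x, y) \<in> pairs n" "k \<in> K" for x y k
    using assms that unfolding cell_def by auto
  have "v \<in> cell n K b \<longleftrightarrow> v \<in> cell n K a" for v
    unfolding cell_def using side by auto
  then show ?thesis by blast
qed

lemma cell_antimono: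
  assumes "K \<subseteq> L" shows "cell n L a \<subseteq> cell n K a"
  unfolding cell_def arrangement_complement_def using assms by blast

lemma complement_UNIV: "arrangement_complement n UNIV = regular n"
proof -
  have "(\<forall>(x, y)\<in>pairs n. \<forall>k\<in>UNIV. v x - v y \<noteq> of_int k) \<longleftrightarrow>
      (\<forall>x\<in>{1..n}. \<forall>y\<in>{1..n}. x \<noteq> y \<longrightarrow> v x - v y \<notin> \<int>)" for v :: vec
  proof
    assume L: "\<forall>(x, y)\<in>pairs n. \<forall>k\<in>UNIV. v x - v y \<noteq> of_int k"
    have less: "v x - v y \<notin> \<int>" if "x \<in> {1..n}" "y \<in> {1..n}" "x < y" for x y
      using L that by (force simp: pairs_def elim!: Ints_cases)
    have "v x - v y \<notin> \<int>" if "x \<in> {1..n}" "y \<in> {1..n}" "x \<noteq> y" for x y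
    proof (cases "x < y")
      case False
      then have "v y - v x \<notin> \<int>" using less that by simp
      then show ?thesis by (metis Ints_minus minus_diff_eq)
    qed (use less that in blast)
    then show "\<forall>x\<in>{1..n}. \<forall>y\<in>{1..n}. x \<noteq> y \<longrightarrow> v x - v y \<notin> \<int>" by blast
  next
    assume R: "\<forall>x\<in>{1..n}. \<forall>y\<in>{1..n}. x \<noteq> y \<longrightarrow> v x - v y \<notin> \<int>"
    have "v x - v y \<noteq> of_int k" if "(x, y) \<in> pairs n" for x y k
    proof -
      have "x \<in> {1..n}" "y \<in> {1..n}" "x \<noteq> y" using that unfolding pairs_def by auto
      then have "v x - v y \<notin> \<int>" using R by blast
      then show ?thesis by (metis Ints_of_int)
    qed
    then show "\<forall>(x, y)\<in>pairs n. \<forall>k\<in>UNIV. v x - v y \<noteq> of_int k" by blast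
  qed
  then show ?thesis unfolding arrangement_complement_def regular_def by blast
qed

lemma regular_nonint:
  assumes "a \<in> regular n" "x \<in> {1..n}" "y \<in> {1..n}" "x \<noteq> y" shows "a x - a y \<notin> \<int>"
  using assms unfolding regular_def by blast

lemma of_int_less_nonint:
  fixes r :: real
  assumes "r \<notin> \<int>" shows "of_int k < r \<longleftrightarrow> k \<le> \<lfloor>r\<rfloor>"
proof -
  have "r \<noteq> of_int k" using assms by (metis Ints_of_int)
  then show ?thesis by (simp add: le_floor_iff order_less_le)
qed

text \<open>
  The position of a regular point with respect to all hyperplanes is recorded by the floors of its
  coordinate differences.
\<close>

lemma alcove_iff_floor:
  assumes a: "a \<in> regular n"
  shows "b \<in> cell n UNIV a \<longleftrightarrow> b \<in> regular n \<and>
    (\<forall>x\<in>{1..n}. \<forall>y\<in>{1..n}. \<lfloor>b x - b y\<rfloor> = \<lfloor>a x - a y\<rfloor>)"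
proof (cases "b \<in> regular n")
  case b: True
  have pair: "(\<forall>k. of_int k < b x - b y \<longleftrightarrow> of_int k < a x - a y) \<longleftrightarrow> \<lfloor>b x - b y\<rfloor> = \<lfloor>a x - a y\<rfloor>"
    if "x \<in> {1..n}" "y \<in> {1..n}" "x \<noteq> y" for x y
    unfolding of_int_less_nonint[OF regular_nonint[OF a that]] of_int_less_nonint[OF regular_nonint[OF b that]]
    by (metis order_antisym order_refl)
  have "b \<in> cell n UNIV a \<longleftrightarrow> (\<forall>(x, y)\<in>pairs n. \<lfloor>b x - b y\<rfloor> = \<lfloor>a x - a y\<rfloor>)"
  proof -
    have "(\<forall>k. of_int k < b x - b y \<longleftrightarrow> of_int k < a x - a y) \<longleftrightarrow> \<lfloor>b x - b y\<rfloor> = \<lfloor>a x - a y\<rfloor>"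
      if "(x, y) \<in> pairs n" for x y
      by (rule pair) (use that in \<open>auto simp: pairs_def\<close>)
    then have "(\<forall>(x, y)\<in>pairs n. \<forall>k\<in>UNIV. of_int k < b x - b y \<longleftrightarrow> of_int k < a x - a y) \<longleftrightarrow>
        (\<forall>(x, y)\<in>pairs n. \<lfloor>b x - b y\<rfloor> = \<lfloor>a x - a y\<rfloor>)"
    proof (intro ball_cong HOL.refl)
      fix p assume iff: "\<And>x y. (x, y) \<in> pairs n \<Longrightarrow> (\<forall>k. of_int k < b x - b y \<longleftrightarrow> of_int k < a x - a y) \<longleftrightarrow> \<lfloor>b x - b y\<rfloor> = \<lfloor>a x - a y\<rfloor>"
        and p: "p \<in> pairs n"
      obtain x y where xy: "p = (x, y)" by (cases p)
      show "(case p of (x, y) \<Rightarrow> \<forall>k\<in>UNIV. of_int k < b x - b y \<longleftrightarrow> of_int k < a x - a y) \<longleftrightarrow>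
          (case p of (x, y) \<Rightarrow> \<lfloor>b x - b y\<rfloor> = \<lfloor>a x - a y\<rfloor>)"
        using iff[of x y] p unfolding xy by simp
    qed
    then show ?thesis unfolding cell_def complement_UNIV using b by blast
  qed
  also have "\<dots> \<longleftrightarrow> (\<forall>x\<in>{1..n}. \<forall>y\<in>{1..n}. \<lfloor>b x - b y\<rfloor> = \<lfloor>a x - a y\<rfloor>)"
  proof
    assume L: "\<forall>(x, y)\<in>pairs n. \<lfloor>b x - b y\<rfloor> = \<lfloor>a x - a y\<rfloor>"
    have "\<lfloor>b x - b y\<rfloor> = \<lfloor>a x - a y\<rfloor>" if xy: "x \<in> {1..n}" "y \<in> {1..n}" for x y
    proof (cases x y rule: linorder_cases)
      case less
      then show ?thesis using L xy by (auto simp: pairs_def)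
    next
      case greater
      then have "\<lfloor>b y - b x\<rfloor> = \<lfloor>a y - a x\<rfloor>" using L xy by (auto simp: pairs_def)
      moreover have "\<lfloor>- (v y - v x)\<rfloor> = - \<lfloor>v y - v x\<rfloor> - 1" if "v \<in> regular n" for v
        by (rule floor_minus_not_int[OF regular_nonint[OF that]]) (use xy greater in auto)
      ultimately show ?thesis using a b by (metis minus_diff_eq)
    qed simp
    then show "\<forall>x\<in>{1..n}. \<forall>y\<in>{1..n}. \<lfloor>b x - b y\<rfloor> = \<lfloor>a x - a y\<rfloor>" by blast
  qed (auto simp: pairs_def)
  finally show ?thesis using b by blast
qed (simp add: cell_def complement_UNIV)

lemma gen_vec_alcove:
  assumes n: "2 \<le> n" and i: "i < n" and a: "a \<in> regular n" and b: "b \<in> cell n UNIV a"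
  shows "gen_vec n i b \<in> cell n UNIV (gen_vec n i a)"
proof -
  obtain \<tau> :: "nat \<Rightarrow> nat" and \<kappa> :: "nat \<Rightarrow> int" where t: "\<tau> ` {1..n} \<subseteq> {1..n}" "inj_on \<tau> {1..n}"
    "\<And>a x. gen_vec n i a x = a (\<tau> x) + of_int (\<kappa> x)"
    using gen_vec_coordinates[OF n i] by blast
  have b': "b \<in> regular n" "\<And>x y. x \<in> {1..n} \<Longrightarrow> y \<in> {1..n} \<Longrightarrow> \<lfloor>b x - b y\<rfloor> = \<lfloor>a x - a y\<rfloor>"
    using b alcove_iff_floor[OF a] by auto
  have "\<lfloor>gen_vec n i b x - gen_vec n i b y\<rfloor> = \<lfloor>gen_vec n i a x - gen_vec n i a y\<rfloor>"
    if xy: "x \<in> {1..n}" "y \<in> {1..n}" for x y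
  proof -
    have "gen_vec n i v x - gen_vec n i v y = (v (\<tau> x) - v (\<tau> y)) + of_int (\<kappa> x - \<kappa> y)" for v
      by (simp add: t(3))
    moreover have "\<tau> x \<in> {1..n}" "\<tau> y \<in> {1..n}" using t(1) xy by blast+
    ultimately show ?thesis using b'(2)[of "\<tau> x" "\<tau> y"] by (simp only: floor_add_int[symmetric])
  qed
  then show ?thesis
    unfolding alcove_iff_floor[OF gen_vec_regular[OF n i a]] using gen_vec_regular[OF n i b'(1)] by blast
qed

lemma act_vec_cell:
  assumes n: "2 \<le> n" and g: "g \<in> carrier (affine_sym n)" and a: "a \<in> regular n" and b: "b \<in> cell n UNIV a"
  shows "act_vec n g b \<in> cell n UNIV (act_vec n g a)"
proof -
  obtain u where u: "u \<in> lists {..<n}" "g = coxeter_rel n `` {u}" using g unfolding carrier_affine_sym by blast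
  have "word_act n u b \<in> cell n UNIV (word_act n u a)"
    using u(1)
  proof (induction u)
    case (Cons i u)
    then show ?case using gen_vec_alcove[OF n _ word_act_regular[OF n _ a], of i u] by auto
  qed (use b in simp)
  then show ?thesis unfolding u(2) act_vec_class[OF n u(1)] .
qed

text \<open>
  On the fundamental alcove all differences \<open>v\<^sub>x - v\<^sub>y\<close> with \<open>x < y\<close> lie strictly between \<open>0\<close> and
  \<open>v\<^sub>1 - v\<^sub>n < 1\<close>.
\<close>

lemma fundamental_alcove_eq:
  assumes n: "2 \<le> n" shows "fundamental_alcove n = cell n UNIV (base_point n)"
proof -
  have reg: "base_point n \<in> regular n" using base_centre n by (intro centres_regular) simp
  have fund: "v \<in> fundamental_alcove n \<longleftrightarrow> v \<in> V n \<and> decreasing n v \<and> v 1 - v n < 1" for v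
  proof -
    have "ip n v (simple_root i) = v i - v (i + 1)" if "i \<in> {1..n - 1}" for i
      unfolding simple_root_def by (rule ip_eps_diff) (use that in auto)
    moreover have "ip n v (theta n) = v 1 - v n"
      unfolding theta_def by (rule ip_eps_diff) (use n in auto)
    moreover have "{1..<n} = {1..n - 1}" using n by auto
    ultimately show ?thesis unfolding fundamental_alcove_def decreasing_def by auto
  qed
  have base_side: "of_int k < base_point n x - base_point n y \<longleftrightarrow> k \<le> 0" if "(x, y) \<in> pairs n" for x y k
  proof -
    have "base_point n x - base_point n y \<notin> \<int>" by (rule regular_nonint[OF reg]) (use that in \<open>auto simp: pairs_def\<close>)
    then show ?thesis unfolding of_int_less_nonint[OF \<open>_ \<notin> _\<close>] floor_base_diff[OF that] by simp
  qed
  show ?thesis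
  proof (intro Set.set_eqI iffI)
    fix v assume "v \<in> fundamental_alcove n"
    then have v: "v \<in> V n" "decreasing n v" "v 1 - v n < 1" using fund by auto
    have unit: "0 < v x - v y \<and> v x - v y < 1" if xy: "(x, y) \<in> pairs n" for x y
    proof -
      have "v y < v x" using decreasing_less[OF v(2), of x y] xy unfolding pairs_def by auto
      moreover have "v x \<le> v 1" using decreasing_less[OF v(2), of 1 x] xy unfolding pairs_def
        by (cases "x = 1") auto
      moreover have "v n \<le> v y" using decreasing_less[OF v(2), of y n] xy unfolding pairs_def
        by (cases "y = n") auto
      ultimately show ?thesis using v(3) by linarith
    qed
    have "of_int k < v x - v y \<longleftrightarrow> k \<le> 0" if xy: "(x, y) \<in> pairs n" for x y k
    proof (cases "k \<le> 0")
      case True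
      then have "real_of_int k \<le> 0" by simp
      then show ?thesis using unit[OF xy] True by linarith
    next
      case False
      then have "1 \<le> real_of_int k" by simp
      then show ?thesis using unit[OF xy] False by linarith
    qed
    moreover have "v x - v y \<noteq> of_int k" if xy: "(x, y) \<in> pairs n" for x y k
    proof
      assume "v x - v y = of_int k"
      then have "0 < real_of_int k" "real_of_int k < 1" using unit[OF xy] by simp_all
      then show False by simp
    qed
    ultimately show "v \<in> cell n UNIV (base_point n)"
      unfolding cell_def arrangement_complement_def using v(1) base_side by auto
  next
    fix v assume "v \<in> cell n UNIV (base_point n)"
    then have v: "v \<in> V n" "\<And>x y k. (x, y) \<in> pairs n \<Longrightarrow> of_int k < v x - v y \<longleftrightarrow> k \<le> 0"
      "\<And>x y k. (x, y) \<in> pairs n \<Longrightarrow> v x - v y \<noteq> of_int k"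
      using base_side unfolding cell_def arrangement_complement_def by auto
    have "decreasing n v"
      unfolding decreasing_def using v(2)[of _ _ 0] by (auto simp: pairs_def)
    moreover have "(1, n) \<in> pairs n" using n unfolding pairs_def by simp
    then have "v 1 - v n < 1" using v(2)[of 1 n 1] v(3)[of 1 n 1] by simp
    ultimately show "v \<in> fundamental_alcove n" using v(1) fund by blast
  qed
qed

lemma act_vec_fundamental_alcove:
  assumes n: "2 \<le> n" and g: "g \<in> carrier (affine_sym n)"
  shows "act_vec n g ` fundamental_alcove n = cell n UNIV (act_vec n g (base_point n))"
proof -
  have b: "base_point n \<in> regular n" using base_centre n by (intro centres_regular) simp
  have gb: "act_vec n g (base_point n) \<in> regular n" by (rule centres_regular[OF act_vec_base_centre[OF n g]])
  show ?thesis
    unfolding fundamental_alcove_eq[OF n]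
  proof
    show "act_vec n g ` cell n UNIV (base_point n) \<subseteq> cell n UNIV (act_vec n g (base_point n))"
      using act_vec_cell[OF n g b] by blast
    show "cell n UNIV (act_vec n g (base_point n)) \<subseteq> act_vec n g ` cell n UNIV (base_point n)"
    proof
      fix v assume "v \<in> cell n UNIV (act_vec n g (base_point n))"
      from act_vec_cell[OF n group.inv_closed[OF group_affine_sym g] gb this]
      have "act_vec n (inv\<^bsub>affine_sym n\<^esub> g) v \<in> cell n UNIV (base_point n)" unfolding act_vec_inv(1)[OF n g] .
      then show "v \<in> act_vec n g ` cell n UNIV (base_point n)"
        by (rule image_eqI[rotated]) (simp add: act_vec_inv(2)[OF n g])
    qed
  qed
qed

text \<open>
  Moving the alcove to \<open>\<A>\<^sub>0\<close> reduces this to the base point, the only centre without descents.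
\<close>

lemma centre_of_alcove_unique:
  assumes n: "2 \<le> n" and a: "a \<in> centres n" and b: "b \<in> centres n" and ba: "b \<in> cell n UNIV a"
  shows "b = a"
proof -
  obtain g where g: "g \<in> carrier (affine_sym n)" "act_vec n g (base_point n) = a" by (rule act_vec_base_surj[OF n a])
  note inv = group.inv_closed[OF group_affine_sym g(1)]
  define c where "c = act_vec n (inv\<^bsub>affine_sym n\<^esub> g) b"
  have c: "c \<in> centres n" unfolding c_def by (rule act_vec_centres[OF n inv b])
  have "c \<in> cell n UNIV (base_point n)"
    using act_vec_cell[OF n inv centres_regular[OF a] ba] act_vec_inv(1)[OF n g(1), of "base_point n"] g(2)
    unfolding c_def by simp
  then have "c \<in> fundamental_alcove n" unfolding fundamental_alcove_eq[OF n] .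
  then have ip: "\<And>i. i \<in> {1..n - 1} \<Longrightarrow> 0 < ip n c (simple_root i)" "ip n c (theta n) < 1"
    unfolding fundamental_alcove_def by auto
  have "\<not> descent n i c" if "i < n" for i
  proof (cases "i = 0")
    case True
    have "ip n c (theta n) = c 1 - c n" unfolding theta_def by (rule ip_eps_diff) (use n in auto)
    then show ?thesis using ip(2) True unfolding descent_def by simp
  next
    case False
    have i: "i \<in> {1..n - 1}" using that False by auto
    have "ip n c (simple_root i) = c i - c (i + 1)"
      unfolding simple_root_def by (rule ip_eps_diff) (use that False in auto)
    then show ?thesis using ip(1)[OF i] False unfolding descent_def by simp
  qed
  then have "c = base_point n" by (rule centre_without_descent[OF n c])
  then show ?thesis using act_vec_inv(2)[OF n g(1), of b] g(2) unfolding c_def by simp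
qed

lemma alcove_dominant_iff:
  assumes a: "a \<in> regular n"
  shows "cell n UNIV a \<subseteq> dominant_chamber n \<longleftrightarrow> decreasing n a"
proof -
  have dom: "v \<in> dominant_chamber n \<longleftrightarrow> v \<in> V n \<and> (\<forall>i\<in>{1..<n}. v (i + 1) \<le> v i)" for v
  proof -
    have "ip n v (simple_root i) = v i - v (i + 1)" if "i \<in> {1..n - 1}" for i
      unfolding simple_root_def by (rule ip_eps_diff) (use that in auto)
    moreover have "{1..<n} = {1..n - 1}" by auto
    ultimately show ?thesis unfolding dominant_chamber_def by auto
  qed
  show ?thesis
  proof
    assume "cell n UNIV a \<subseteq> dominant_chamber n"
    then have "a \<in> dominant_chamber n" using cell_refl[of a n UNIV] a unfolding complement_UNIV by blast
    then have le: "\<forall>i\<in>{1..<n}. a (i + 1) \<le> a i" using dom by blast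
    show "decreasing n a"
      unfolding decreasing_def
    proof
      fix i assume i: "i \<in> {1..<n}"
      have "a i - a (i + 1) \<notin> \<int>" by (rule regular_nonint[OF a]) (use i in auto)
      then have "a i \<noteq> a (i + 1)" by (metis Ints_0 diff_self)
      then show "a (i + 1) < a i" using le i by (simp add: order_less_le)
    qed
  next
    assume dec: "decreasing n a"
    show "cell n UNIV a \<subseteq> dominant_chamber n"
    proof
      fix v assume v: "v \<in> cell n UNIV a"
      have "v (i + 1) \<le> v i" if i: "i \<in> {1..<n}" for i
      proof -
        have "(i, i + 1) \<in> pairs n" using i unfolding pairs_def by auto
        then have "of_int 0 < v i - v (i + 1) \<longleftrightarrow> of_int 0 < a i - a (i + 1)" using v unfolding cell_def by blast
        moreover have "a (i + 1) < a i" using dec i unfolding decreasing_def by blast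
        ultimately show ?thesis by simp
      qed
      then show "v \<in> dominant_chamber n" using v dom unfolding cell_def arrangement_complement_def by blast
    qed
  qed
qed

text \<open>
  Alcoves are replaced by their centres and lengths by depths.
\<close>

lemma m_minimal_iff:
  assumes n: "2 \<le> n" and a: "a \<in> centres n"
  shows "cell n UNIV a \<in> m_minimal_alcoves n m \<longleftrightarrow>
    (\<forall>b\<in>centres n. b \<in> cell n {- int m<..int m} a \<longrightarrow> depth n a \<le> depth n b)"
proof -
  let ?K = "{- int m<..int m}" and ?G = "affine_sym n"
  have in_shi: "c \<in> arrangement_complement n ?K" if "c \<in> centres n" for c
  proof -
    have "c \<in> arrangement_complement n UNIV" using centres_regular[OF that] unfolding complement_UNIV .
    then show ?thesis unfolding arrangement_complement_def by auto
  qed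
  have sub: "cell n UNIV c \<subseteq> cell n ?K c" for c by (rule cell_antimono) simp
  have self: "c \<in> cell n UNIV c" if "c \<in> centres n" for c
    using cell_refl[of c n UNIV] centres_regular[OF that] unfolding complement_UNIV by blast
  show ?thesis
  proof
    assume "cell n UNIV a \<in> m_minimal_alcoves n m"
    then obtain R w where R: "R \<in> shi_regions n m" and w: "w \<in> carrier ?G"
      and aw: "cell n UNIV a = act_vec n w ` fundamental_alcove n" and aR: "cell n UNIV a \<subseteq> R"
      and min: "\<And>u. u \<in> carrier ?G \<Longrightarrow> act_vec n u ` fundamental_alcove n \<subseteq> R \<Longrightarrow> cox_length w \<le> cox_length u"
      unfolding m_minimal_alcoves_def by blast
    have "a \<in> cell n UNIV (act_vec n w (base_point n))"
      using self[OF a] aw act_vec_fundamental_alcove[OF n w] by simp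
    then have aw': "a = act_vec n w (base_point n)" by (rule centre_of_alcove_unique[OF n act_vec_base_centre[OF n w] a])
    obtain c where c: "R = cell n ?K c" using R unfolding shi_regions_eq by blast
    have "a \<in> cell n ?K c" using aR self[OF a] c by blast
    then have Ra: "R = cell n ?K a" using cell_eqI c by metis
    show "\<forall>b\<in>centres n. b \<in> cell n ?K a \<longrightarrow> depth n a \<le> depth n b"
    proof (intro ballI impI)
      fix b assume b: "b \<in> centres n" "b \<in> cell n ?K a"
      obtain u where u: "u \<in> carrier ?G" "act_vec n u (base_point n) = b" by (rule act_vec_base_surj[OF n b(1)])
      have "act_vec n u ` fundamental_alcove n = cell n UNIV b"
        using act_vec_fundamental_alcove[OF n u(1)] u(2) by simp
      also have "\<dots> \<subseteq> R" using sub[of b] cell_eqI[OF b(2)] Ra by simp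
      finally have "cox_length w \<le> cox_length u" by (rule min[OF u(1)])
      then show "depth n a \<le> depth n b"
        using cox_length_eq_depth[OF n w] cox_length_eq_depth[OF n u(1)] u(2) aw' by simp
    qed
  next
    assume min: "\<forall>b\<in>centres n. b \<in> cell n ?K a \<longrightarrow> depth n a \<le> depth n b"
    obtain w where w: "w \<in> carrier ?G" "act_vec n w (base_point n) = a" by (rule act_vec_base_surj[OF n a])
    have "cell n UNIV a \<in> alcoves n"
      unfolding alcoves_eq complement_UNIV using centres_regular[OF a] by blast
    moreover have "cell n ?K a \<in> shi_regions n m" unfolding shi_regions_eq using in_shi[OF a] by blast
    moreover have "cell n UNIV a = act_vec n w ` fundamental_alcove n"
      using act_vec_fundamental_alcove[OF n w(1)] w(2) by simp
    moreover have "cox_length w \<le> cox_length u"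
      if u: "u \<in> carrier ?G" "act_vec n u ` fundamental_alcove n \<subseteq> cell n ?K a" for u
    proof -
      note c = act_vec_base_centre[OF n u(1)]
      have "act_vec n u (base_point n) \<in> cell n ?K a"
        using u(2) self[OF c] unfolding act_vec_fundamental_alcove[OF n u(1)] by blast
      then have "depth n a \<le> depth n (act_vec n u (base_point n))" using min c by blast
      then show ?thesis using cox_length_eq_depth[OF n w(1)] cox_length_eq_depth[OF n u(1)] w(2) by simp
    qed
    ultimately show "cell n UNIV a \<in> m_minimal_alcoves n m"
      unfolding m_minimal_alcoves_def using w(1) sub[of a] by blast
  qed
qed


section \<open>Minimal dominant alcoves and the bijection\<close>

text \<open>
  For the set \<open>S\<close> of coordinates of a centre, the equations \<open>s - t = k + 1 / n\<close> describe the walls of its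
  alcove: all other differences of distinct coordinates exceed their floors by at least \<open>2 / n\<close>.
\<close>

definition steps_bounded :: "nat \<Rightarrow> nat \<Rightarrow> real set \<Rightarrow> bool" where
  "steps_bounded n m S \<longleftrightarrow> (\<forall>s\<in>S. \<forall>t\<in>S. \<forall>k::int. s - t = of_int k + 1 / real n \<longrightarrow> k \<le> int m)"

text \<open>
  Modulo integers the \<open>n\<close> coordinates of a centre are distinct translates by multiples of \<open>1 / n\<close>, so each
  of the \<open>n\<close> classes occurs.
\<close>

lemma centre_residue:
  assumes n: "1 \<le> n" and a: "a \<in> centres n" and y: "y \<in> {1..n}"
  obtains z where "z \<in> {1..n}" "a z - a y - of_int t / real n \<in> \<int>"
proof -
  have int: "real n * (a z - a y) \<in> \<int>" if "z \<in> {1..n}" for z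
    using a that y unfolding centres_def by blast
  define \<phi> where "\<phi> z = \<lfloor>real n * (a z - a y)\<rfloor> mod int n" for z
  have fl: "of_int \<lfloor>real n * (a z - a y)\<rfloor> = real n * (a z - a y)" if "z \<in> {1..n}" for z
    using int[OF that] by simp
  have "inj_on \<phi> {1..n}"
  proof (rule inj_onI, rule ccontr)
    fix u v assume uv: "u \<in> {1..n}" "v \<in> {1..n}" "\<phi> u = \<phi> v" "u \<noteq> v"
    then obtain j where "\<lfloor>real n * (a u - a y)\<rfloor> - \<lfloor>real n * (a v - a y)\<rfloor> = int n * j"
      unfolding \<phi>_def by (metis mod_eq_dvd_iff dvdE)
    then have "real_of_int (\<lfloor>real n * (a u - a y)\<rfloor> - \<lfloor>real n * (a v - a y)\<rfloor>) = real_of_int (int n * j)" by simp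
    then have "real n * (a u - a y) - real n * (a v - a y) = real n * of_int j"
      using fl[OF uv(1)] fl[OF uv(2)] by simp
    then have "real n * (a u - a v) = real n * of_int j" by (simp add: algebra_simps)
    then have "a u - a v = of_int j" using n by simp
    then have "a u - a v \<in> \<int>" by simp
    then show False using a uv unfolding centres_def regular_def by blast
  qed
  moreover have "\<phi> ` {1..n} \<subseteq> {0..<int n}" using n unfolding \<phi>_def by auto
  ultimately have "\<phi> ` {1..n} = {0..<int n}" by (intro card_subset_eq) (auto simp: card_image)
  moreover have "t mod int n \<in> {0..<int n}" using n by simp
  ultimately obtain z where z: "z \<in> {1..n}" "t mod int n = \<phi> z" by (metis imageE)
  then obtain j where "\<lfloor>real n * (a z - a y)\<rfloor> - t = int n * j"
    unfolding \<phi>_def by (metis mod_eq_dvd_iff dvdE)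
  then have "real_of_int (\<lfloor>real n * (a z - a y)\<rfloor> - t) = real_of_int (int n * j)" by simp
  then have "real n * (a z - a y) - of_int t = real n * of_int j" using fl[OF z(1)] by simp
  then have "a z - a y - of_int t / real n = of_int j" using n by (simp add: field_simps)
  then show ?thesis using z(1) by (intro that[of z]) simp_all
qed

text \<open>
  A non-integral multiple of \<open>1 / n\<close> exceeds its floor by at least \<open>1 / n\<close>.
\<close>

lemma floor_shift_down:
  fixes d :: real
  assumes n: "1 \<le> n" and d: "d \<notin> \<int>" "real n * d \<in> \<int>"
  shows "\<lfloor>d - 1 / real n\<rfloor> = \<lfloor>d\<rfloor>"
proof -
  obtain j :: int where j: "real n * d = of_int j" using d(2) by (auto elim: Ints_cases)
  then have dj: "d = of_int j / of_int (int n)" using n by (simp add: field_simps)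
  have "\<not> int n dvd j"
  proof
    assume "int n dvd j"
    then obtain i where "j = int n * i" by (elim dvdE)
    then have "d = of_int i" using dj n by simp
    then show False using d(1) by simp
  qed
  then have "(j - 1) div int n = j div int n" using div_minus_one[of "int n" j] n by simp
  moreover have "d - 1 / real n = of_int (j - 1) / of_int (int n)" unfolding dj by (simp add: diff_divide_distrib)
  ultimately show ?thesis unfolding dj by (simp only: floor_divide_of_int_eq)
qed

lemma floor_shift_up:
  fixes d :: real
  assumes n: "1 \<le> n" and d: "d + 1 / real n \<notin> \<int>" "real n * d \<in> \<int>"
  shows "\<lfloor>d + 1 / real n\<rfloor> = \<lfloor>d\<rfloor>"
proof -
  have "real n * (d + 1 / real n) = real n * d + 1" using n by (simp add: algebra_simps)
  then have "real n * (d + 1 / real n) \<in> \<int>" using d(2) by (metis Ints_1 Ints_add)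
  from floor_shift_down[OF n d(1) this] show ?thesis by simp
qed

text \<open>
  If \<open>a\<^sub>x - a\<^sub>y = k + 1 / n\<close> with \<open>k > m\<close>, then the reflection of \<open>a\<close> in the wall \<open>v\<^sub>x - v\<^sub>y = k\<close> is a centre that
  differs from \<open>a\<close> in the floor of this one difference only. That floor drops from \<open>k\<close> to \<open>k - 1 \<ge> m\<close>, so
  the Shi region stays the same and the depth decreases.
\<close>

lemma m_minimal_imp_steps_bounded:
  assumes n: "2 \<le> n" and m: "1 \<le> m" and a: "a \<in> centres n" and dec: "decreasing n a"
    and min: "\<And>b. b \<in> centres n \<Longrightarrow> b \<in> cell n {- int m<..int m} a \<Longrightarrow> depth n a \<le> depth n b"
  shows "steps_bounded n m (a ` {1..n})"
proof (rule ccontr)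
  assume "\<not> steps_bounded n m (a ` {1..n})"
  then obtain x y k where xy: "x \<in> {1..n}" "y \<in> {1..n}" and k: "a x - a y = of_int k + 1 / real n" "int m < k"
    unfolding steps_bounded_def by force
  have n1: "1 \<le> n" using n by simp
  have reg: "a \<in> regular n" and aV: "a \<in> V n" using a unfolding centres_def regular_def by auto
  have frac: "0 < 1 / real n" "1 / real n < 1" using n by auto
  have nint: "a u - a v \<notin> \<int>" if "u \<in> {1..n}" "v \<in> {1..n}" "u \<noteq> v" for u v
    by (rule regular_nonint[OF reg that])
  have nmult: "real n * (a u - a v) \<in> \<int>" if "u \<in> {1..n}" "v \<in> {1..n}" for u v
    using a that unfolding centres_def by blast
  have "0 < a x - a y" using k m frac by (simp add: order_less_trans[of 0 "real_of_int k"] add_pos_pos)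
  then have "x < y" using decreasing_less_iff[OF dec xy(1,2)] by simp
  then have p: "(x, y) \<in> pairs n" and ne: "x \<noteq> y" using xy unfolding pairs_def by auto
  \<comment> \<open>The reflection exchanges the two coordinates up to the shift by \<open>k\<close>.\<close>
  define b where "b = a(x := a x - 1 / real n, y := a y + 1 / real n)"
  have bx: "b x = a y + of_int k" and by': "b y = a x - of_int k"
    using k(1) ne unfolding b_def by auto
  have bother: "b u = a u" if "u \<noteq> x" "u \<noteq> y" for u using that unfolding b_def by simp
  have "b \<in> centres n"
  proof (rule centres_reindex[OF a, of _ "id(x := y, y := x)"])
    have "sum b {1..n} = sum a {1..n}"
      by (rule sum_change_two[OF xy ne]) (simp_all add: bx by' bother)
    then have "sum b {1..n} = 0" using aV unfolding V_def by simp
    then show "b \<in> V n" using aV xy unfolding V_def b_def by auto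
    show "id(x := y, y := x) ` {1..n} \<subseteq> {1..n}" using xy by auto
    show "inj_on (id(x := y, y := x)) {1..n}" by (auto simp: inj_on_def)
    show "b u - a ((id(x := y, y := x)) u) \<in> \<int>" for u
      using bx by' bother ne by (cases "u = x \<or> u = y") auto
  qed
  then have breg: "b \<in> regular n" by (rule centres_regular)
  have floors: "\<lfloor>b u - b v\<rfloor> = \<lfloor>a u - a v\<rfloor>" if uv: "(u, v) \<in> pairs n" "(u, v) \<noteq> (x, y)" for u v
  proof -
    have r: "u \<in> {1..n}" "v \<in> {1..n}" "u < v" using uv(1) unfolding pairs_def by auto
    have bn: "b u - b v \<notin> \<int>" by (rule regular_nonint[OF breg r(1,2)]) (use r in simp)
    consider "u = x" "v \<noteq> y" | "v = x" "u \<noteq> y" | "u = y" "v \<noteq> x" | "v = y" "u \<noteq> x"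
      | "u \<noteq> x" "u \<noteq> y" "v \<noteq> x" "v \<noteq> y"
      using uv(2) r(3) \<open>x < y\<close> by fastforce
    then show ?thesis
    proof cases
      case 1
      then have "b u - b v = (a u - a v) - 1 / real n" using r(3) ne unfolding b_def by auto
      then show ?thesis using floor_shift_down[OF n1 nint nmult] r by simp
    next
      case 2
      then have "b u - b v = (a u - a v) + 1 / real n" using r(3) ne unfolding b_def by auto
      then show ?thesis using floor_shift_up[OF n1 _ nmult] r bn by simp
    next
      case 3
      then have "b u - b v = (a u - a v) + 1 / real n" using r(3) ne unfolding b_def by auto
      then show ?thesis using floor_shift_up[OF n1 _ nmult] r bn by simp
    next
      case 4
      then have "b u - b v = (a u - a v) - 1 / real n" using r(3) ne unfolding b_def by auto
      then show ?thesis using floor_shift_down[OF n1 nint nmult] r by simp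
    next
      case 5
      then show ?thesis by (simp add: bother)
    qed
  qed
  have diff: "b x - b y = of_int (k - 1) + (1 - 1 / real n)" using k(1) ne unfolding b_def by simp
  have fb: "\<lfloor>b x - b y\<rfloor> = k - 1" unfolding floor_eq_iff diff using frac by simp
  have fa: "\<lfloor>a x - a y\<rfloor> = k" unfolding floor_eq_iff k(1) using frac by simp
  have "b \<in> cell n {- int m<..int m} a"
  proof -
    have "b \<in> arrangement_complement n UNIV" using breg unfolding complement_UNIV .
    then have "b \<in> arrangement_complement n {- int m<..int m}" unfolding arrangement_complement_def by auto
    moreover have "of_int l < b u - b v \<longleftrightarrow> of_int l < a u - a v"
      if uv: "(u, v) \<in> pairs n" and l: "l \<in> {- int m<..int m}" for u v l
    proof -
      have r: "u \<in> {1..n}" "v \<in> {1..n}" "u \<noteq> v" using uv unfolding pairs_def by auto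
      have "l \<le> \<lfloor>b u - b v\<rfloor> \<longleftrightarrow> l \<le> \<lfloor>a u - a v\<rfloor>"
        using floors[OF uv] fa fb l k(2) by (cases "(u, v) = (x, y)") auto
      then show ?thesis
        using of_int_less_nonint[OF regular_nonint[OF breg r]] of_int_less_nonint[OF nint[OF r]] by simp
    qed
    ultimately show ?thesis unfolding cell_def by auto
  qed
  then have "depth n a \<le> depth n b" by (rule min[OF \<open>b \<in> centres n\<close>])
  moreover have "depth n b < depth n a"
  proof -
    have "sum (\<lambda>(u, v). nat \<bar>\<lfloor>b u - b v\<rfloor>\<bar>) (pairs n - {(x, y)}) = sum (\<lambda>(u, v). nat \<bar>\<lfloor>a u - a v\<rfloor>\<bar>) (pairs n - {(x, y)})"
    proof (rule sum.cong[OF HOL.refl])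
      fix p assume p: "p \<in> pairs n - {(x, y)}"
      obtain u v where "p = (u, v)" by (cases p)
      then show "(case p of (u, v) \<Rightarrow> nat \<bar>\<lfloor>b u - b v\<rfloor>\<bar>) = (case p of (u, v) \<Rightarrow> nat \<bar>\<lfloor>a u - a v\<rfloor>\<bar>)"
        using floors[of u v] p by simp
    qed
    moreover have "nat \<bar>\<lfloor>b x - b y\<rfloor>\<bar> < nat \<bar>\<lfloor>a x - a y\<rfloor>\<bar>" unfolding fa fb using k(2) m by simp
    ultimately show ?thesis unfolding depth_def sum.remove[OF finite_pairs p] by simp
  qed
  ultimately show False by simp
qed

text \<open>
  Write \<open>a\<^sub>x - a\<^sub>y = k + s / n\<close> with \<open>0 \<le> s < n\<close>, and let \<open>z t\<close> be the index of the coordinate that is congruent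
  to \<open>a\<^sub>y + t / n\<close> modulo integers, so that \<open>z\<close> leads from \<open>z 0 = y\<close> to \<open>z s = x\<close>. An index \<open>z t\<close> strictly
  between \<open>x\<close> and \<open>y\<close> is what is wanted, as the fractional parts \<open>(s - t) / n\<close> and \<open>t / n\<close> add up without a
  carry. Otherwise some step jumps from \<open>z t \<ge> y\<close> to \<open>z (t + 1) \<le> x\<close>; as \<open>a\<close> is decreasing, it increases
  the coordinate by at least \<open>a\<^sub>x - a\<^sub>y > m + 1\<close>, against the bound on steps.
\<close>

lemma floor_splits:
  assumes n: "2 \<le> n" and a: "a \<in> centres n" and dec: "decreasing n a"
    and sb: "steps_bounded n m (a ` {1..n})" and xy: "(x, y) \<in> pairs n" and big: "int m < \<lfloor>a x - a y\<rfloor>"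
  shows "\<exists>l. x < l \<and> l < y \<and> \<lfloor>a x - a y\<rfloor> = \<lfloor>a x - a l\<rfloor> + \<lfloor>a l - a y\<rfloor>"
proof (rule ccontr)
  assume none: "\<nexists>l. x < l \<and> l < y \<and> \<lfloor>a x - a y\<rfloor> = \<lfloor>a x - a l\<rfloor> + \<lfloor>a l - a y\<rfloor>"
  have n1: "1 \<le> n" and rn: "0 < real n" using n by auto
  have r: "x \<in> {1..n}" "y \<in> {1..n}" "x < y" using xy unfolding pairs_def by auto
  have reg: "a \<in> regular n" by (rule centres_regular[OF a])
  define k where "k = \<lfloor>a x - a y\<rfloor>"
  have "real n * (a x - a y) \<in> \<int>" using a r unfolding centres_def by blast
  then obtain j :: int where j: "real n * (a x - a y) = of_int j" by (auto elim: Ints_cases)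
  define s where "s = j - int n * k"
  have s: "a x - a y = of_int k + of_int s / real n"
    unfolding s_def using j rn by (simp add: field_simps)
  have frac: "of_int s / real n = a x - a y - of_int k" using s by simp
  have "0 \<le> of_int s / real n" "of_int s / real n < 1" unfolding frac k_def by linarith+
  then have s_bounds: "0 \<le> s" "s < int n" using rn by (simp_all add: field_simps)
  have "\<exists>z. z \<in> {1..n} \<and> a z - a y - of_int t / real n \<in> \<int>" for t
    using centre_residue[OF n1 a r(2), of t] by metis
  then obtain z where z: "\<And>t. z t \<in> {1..n}" "\<And>t. a (z t) - a y - of_int t / real n \<in> \<int>" by metis
  have same: "u = v" if "u \<in> {1..n}" "v \<in> {1..n}" "a u - a v \<in> \<int>" for u v
    using reg that unfolding regular_def by blast
  have z0: "z 0 = y" using same[OF z(1) r(2)] z(2)[of 0] by simp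
  have zs: "z s = x"
  proof (rule same[OF z(1) r(1)])
    have "a (z s) - a y - of_int s / real n - of_int k \<in> \<int>"
      by (rule Ints_diff[OF z(2)[of s] Ints_of_int])
    then show "a (z s) - a x \<in> \<int>" using s by (simp add: algebra_simps)
  qed
  define d where "d t = \<lfloor>a (z t) - a y - of_int t / real n\<rfloor>" for t
  have d: "a (z t) - a y = of_int (d t) + of_int t / real n" for t
    using z(2)[of t] unfolding d_def by (simp add: algebra_simps)
  have ds: "d s = k" using d[of s] s zs by simp
  \<comment> \<open>An index strictly between \<open>x\<close> and \<open>y\<close> would split the floor.\<close>
  have outside: "z t \<le> x \<or> y \<le> z t" if t: "0 \<le> t" "t \<le> s" for t
  proof (rule ccontr)
    assume "\<not> (z t \<le> x \<or> y \<le> z t)"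
    then have btw: "x < z t" "z t < y" by auto
    have "of_int t / real n < 1" using t s_bounds rn by (simp add: field_simps)
    then have f1: "\<lfloor>a (z t) - a y\<rfloor> = d t" unfolding floor_eq_iff d using t rn by simp
    have e: "a x - a (z t) = of_int (k - d t) + of_int (s - t) / real n"
      using d[of t] s by (simp add: diff_divide_distrib)
    have "of_int (s - t) / real n < 1" "0 \<le> of_int (s - t) / real n" using t s_bounds rn by (simp_all add: field_simps)
    then have f2: "\<lfloor>a x - a (z t)\<rfloor> = k - d t" unfolding floor_eq_iff e by simp
    have "\<lfloor>a x - a y\<rfloor> = \<lfloor>a x - a (z t)\<rfloor> + \<lfloor>a (z t) - a y\<rfloor>" unfolding f1 f2 k_def[symmetric] by simp
    then show False using none btw by blast
  qed
  obtain t where t: "y \<le> z t" "\<not> y \<le> z (t + 1)" "0 \<le> t" "t < s"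
    by (rule int_cut[of "\<lambda>t. y \<le> z t" 0 s]) (use z0 zs r s_bounds in auto)
  have zx: "z (t + 1) \<le> x" using outside[of "t + 1"] t by auto
  have ge: "a x - a y \<le> a (z (t + 1)) - a (z t)"
  proof -
    have "a x \<le> a (z (t + 1))"
      using decreasing_less_iff[OF dec z(1) r(1), of "t + 1"] zx by (cases "z (t + 1) = x") auto
    moreover have "a (z t) \<le> a y"
      using decreasing_less_iff[OF dec r(2) z(1), of t] t(1) by (cases "z t = y") auto
    ultimately show ?thesis by simp
  qed
  have step: "a (z (t + 1)) - a (z t) = of_int (d (t + 1) - d t) + 1 / real n"
    using d[of "t + 1"] d[of t] by (simp add: add_divide_distrib)
  then have "d (t + 1) - d t \<le> int m" using sb z(1) unfolding steps_bounded_def by blast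
  moreover have "int m + 1 \<le> k" using big unfolding k_def by simp
  ultimately have "of_int (d (t + 1) - d t) + 1 \<le> real_of_int k" by linarith
  moreover have "of_int k < a x - a y"
    using of_int_less_nonint[OF regular_nonint[OF reg r(1,2)]] r(3) unfolding k_def by simp
  moreover have "1 / real n < 1" using n by simp
  ultimately show False using ge step by linarith
qed

text \<open>
  Floors up to \<open>m\<close> are common to all points of the region. Larger floors of \<open>a\<close> split into floors over
  shorter pairs, so by induction they are lower bounds for the floors of \<open>b\<close>.
\<close>

lemma steps_bounded_imp_m_minimal:
  assumes n: "2 \<le> n" and m: "1 \<le> m" and a: "a \<in> centres n" and dec: "decreasing n a"
    and sb: "steps_bounded n m (a ` {1..n})"
    and b: "b \<in> centres n" "b \<in> cell n {- int m<..int m} a"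
  shows "depth n a \<le> depth n b"
proof -
  have areg: "a \<in> regular n" and breg: "b \<in> regular n" using a b by (auto intro: centres_regular)
  have pos: "0 \<le> \<lfloor>a x - a y\<rfloor>" if "(x, y) \<in> pairs n" for x y
    using decreasing_less[OF dec, of x y] that unfolding pairs_def by auto
  have lower: "of_int \<lfloor>a x - a y\<rfloor> < b x - b y" if "(x, y) \<in> pairs n" for x y
    using that
  proof (induction "y - x" arbitrary: x y rule: less_induct)
    case less
    then have r: "x \<in> {1..n}" "y \<in> {1..n}" "x < y" unfolding pairs_def by auto
    show ?case
    proof (cases "\<lfloor>a x - a y\<rfloor> \<le> int m")
      case True
      then have "\<lfloor>a x - a y\<rfloor> \<in> {- int m<..int m}"
        unfolding greaterThanAtMost_iff using pos[OF less.prems] m by linarith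
      then have "of_int \<lfloor>a x - a y\<rfloor> < b x - b y \<longleftrightarrow> of_int \<lfloor>a x - a y\<rfloor> < a x - a y"
        using b(2) less.prems unfolding cell_def by blast
      then show ?thesis
        using of_int_less_nonint[OF regular_nonint[OF areg r(1,2)], of "\<lfloor>a x - a y\<rfloor>"] r(3) by simp
    next
      case False
      then obtain l where l: "x < l" "l < y" "\<lfloor>a x - a y\<rfloor> = \<lfloor>a x - a l\<rfloor> + \<lfloor>a l - a y\<rfloor>"
        using floor_splits[OF n a dec sb less.prems] by (auto simp: not_le)
      have "of_int \<lfloor>a x - a l\<rfloor> < b x - b l" "of_int \<lfloor>a l - a y\<rfloor> < b l - b y"
        using less.hyps[of l x] less.hyps[of y l] l r by (auto simp: pairs_def)
      then show ?thesis unfolding l(3) by simp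
    qed
  qed
  have "nat \<bar>\<lfloor>a x - a y\<rfloor>\<bar> \<le> nat \<bar>\<lfloor>b x - b y\<rfloor>\<bar>" if xy: "(x, y) \<in> pairs n" for x y
  proof -
    have "\<lfloor>a x - a y\<rfloor> \<le> \<lfloor>b x - b y\<rfloor>" using lower[OF xy] by (simp add: le_floor_iff)
    then show ?thesis using pos[OF xy] by simp
  qed
  then show ?thesis unfolding depth_def by (intro sum_mono) auto
qed

text \<open>
  The difference of two coordinates of \<open>p - c\<close> is \<open>(y - x) / n\<close> minus an integer. It is \<open>1 / n\<close> modulo
  integers only for \<open>y = x + 1\<close> and for the pair \<open>x = n, y = 1\<close>; in the latter case \<open>p\<close> contributes
  \<open>1 / n - 1\<close>, which accounts for \<open>m + 1\<close> in place of \<open>m\<close>.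
\<close>

lemma steps_bounded_lattice:
  assumes n: "2 \<le> n" and c: "c \<in> int_lattice n"
  shows "steps_bounded n m ((\<lambda>k. base_point n k - c k) ` {1..n}) \<longleftrightarrow>
    (\<forall>i\<in>{1..<n}. c (i + 1) - c i \<le> real m) \<and> c 1 - c n \<le> real m + 1"
proof -
  have f: "c r = of_int \<lfloor>c r\<rfloor>" for r using c unfolding int_lattice_def by simp
  have rn: "0 < real n" using n by simp
  have diff: "(base_point n x - c x) - (base_point n y - c y) = (real y - real x) / real n - (c x - c y)"
    if "x \<in> {1..n}" "y \<in> {1..n}" for x y
    using base_diff[OF that] by simp
  show ?thesis
  proof
    assume sb: "steps_bounded n m ((\<lambda>k. base_point n k - c k) ` {1..n})"
    have use: "k \<le> int m" if "x \<in> {1..n}" "y \<in> {1..n}"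
      "(real y - real x) / real n - (c x - c y) = of_int k + 1 / real n" for x y and k :: int
      using sb that diff[OF that(1,2)] unfolding steps_bounded_def by (metis (no_types, lifting) image_eqI)
    have "c (i + 1) - c i \<le> real m" if i: "i \<in> {1..<n}" for i
    proof -
      have "\<lfloor>c (i + 1)\<rfloor> - \<lfloor>c i\<rfloor> \<le> int m"
        by (rule use[of i "i + 1"]) (use i f[of i] f[of "i + 1"] in auto)
      then show ?thesis using f[of i] f[of "i + 1"] by linarith
    qed
    moreover have "c 1 - c n \<le> real m + 1"
    proof -
      have "\<lfloor>c 1\<rfloor> - \<lfloor>c n\<rfloor> - 1 \<le> int m"
        by (rule use[of n 1]) (use n f[of 1] f[of n] in \<open>auto simp: diff_divide_distrib\<close>)
      then show ?thesis using f[of 1] f[of n] by linarith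
    qed
    ultimately show "(\<forall>i\<in>{1..<n}. c (i + 1) - c i \<le> real m) \<and> c 1 - c n \<le> real m + 1" by blast
  next
    assume bounds: "(\<forall>i\<in>{1..<n}. c (i + 1) - c i \<le> real m) \<and> c 1 - c n \<le> real m + 1"
    have "k \<le> int m" if xy: "x \<in> {1..n}" "y \<in> {1..n}"
      and k: "(base_point n x - c x) - (base_point n y - c y) = of_int k + 1 / real n" for x y and k :: int
    proof -
      define j where "j = k + \<lfloor>c x\<rfloor> - \<lfloor>c y\<rfloor>"
      have "(real y - real x) / real n - 1 / real n = of_int j"
        using k diff[OF xy] f[of x] f[of y] unfolding j_def by simp
      then have "(real y - real x - 1) / real n = of_int j" by (simp add: diff_divide_distrib)
      then have "real y - real x - 1 = real n * of_int j" using rn by (simp add: divide_eq_eq)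
      then have "real_of_int (int y - int x - 1) = of_int (int n * j)" by simp
      then have yx: "int y - int x - 1 = int n * j" by (simp only: of_int_eq_iff)
      have "\<not> 1 \<le> j"
      proof
        assume "1 \<le> j"
        then have "int n * 1 \<le> int n * j" by (intro mult_left_mono) auto
        then have "int n * 1 \<le> int y - int x - 1" unfolding yx .
        then show False using xy by auto
      qed
      moreover have "\<not> j \<le> - 2"
      proof
        assume "j \<le> - 2"
        then have "int n * j \<le> int n * - 2" by (intro mult_left_mono) auto
        then have "int y - int x - 1 \<le> int n * - 2" unfolding yx .
        then show False using xy n by auto
      qed
      ultimately consider "j = 0" | "j = - 1" by linarith
      then show ?thesis
      proof cases
        case 1
        then have "y = x + 1" "x \<in> {1..<n}" using yx xy by auto
        then have "c y - c x \<le> real m" using bounds by blast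
        then show ?thesis using 1 f[of x] f[of y] unfolding j_def by linarith
      next
        case 2
        then have "x = n" "y = 1" using yx xy by auto
        then have "c y - c x \<le> real m + 1" using bounds by blast
        then show ?thesis using 2 f[of x] f[of y] unfolding j_def by linarith
      qed
    qed
    then show "steps_bounded n m ((\<lambda>k. base_point n k - c k) ` {1..n})" unfolding steps_bounded_def by blast
  qed
qed

text \<open>
  Both actions evaluate the same word, and the generators act on vectors as they do on their cores.
\<close>

lemma act_core_empty:
  assumes n: "2 \<le> n" and g: "g \<in> carrier (affine_sym n)"
  shows "act_core n g {} = core_of n (act_vec n g (\<lambda>_. 0))"
proof -
  have "foldr (gen_core n) u {} = core_of n (word_act n u (\<lambda>_. 0)) \<and> word_act n u (\<lambda>_. 0) \<in> int_lattice n"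
    if "u \<in> lists {..<n}" for u
    using that
  proof (induction u)
    case Nil
    then show ?case using core_of_zero[of n] zero_int_lattice n by simp
  next
    case (Cons i u)
    then show ?case using gen_core_core_of[OF n] gen_vec_int_lattice[OF n] by auto
  qed
  then show ?thesis
    unfolding act_core_def act_vec_def induced_action_def using some_word(1)[OF g] by blast
qed

lemma min_rep_core_of:
  assumes n: "2 \<le> n" and g: "g \<in> min_coset_reps n" "act_vec n g (\<lambda>_. 0) = c"
  shows "min_rep n (core_of n c) = g"
  unfolding min_rep_def
proof (rule the_equality)
  have carr: "h \<in> carrier (affine_sym n)" if "h \<in> min_coset_reps n" for h
    using that min_coset_reps_iff[OF n] by blast
  show "g \<in> min_coset_reps n \<and> act_core n g {} = core_of n c"
    using g act_core_empty[OF n carr] by simp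
  fix h assume h: "h \<in> min_coset_reps n \<and> act_core n h {} = core_of n c"
  then have "core_of n (act_vec n h (\<lambda>_. 0)) = core_of n c" using act_core_empty[OF n carr[of h]] by simp
  moreover have "act_vec n h (\<lambda>_. 0) \<in> int_lattice n" "c \<in> int_lattice n"
    using act_vec_int_lattice[OF n carr zero_int_lattice] g h by auto
  ultimately have "act_vec n h (\<lambda>_. 0) = c" using core_of_inj[of n] n by (auto dest: inj_onD)
  then show "h = g" using min_coset_rep_unique[OF n] g h by blast
qed

lemma Phi_core_of:
  assumes n: "2 \<le> n" and g: "g \<in> min_coset_reps n" "act_vec n g (\<lambda>_. 0) = c"
  shows "Phi n (core_of n c) = cell n UNIV (act_vec n (inv\<^bsub>affine_sym n\<^esub> g) (base_point n))"
proof -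
  have "g \<in> carrier (affine_sym n)" using g min_coset_reps_iff[OF n] by blast
  then show ?thesis
    unfolding Phi_def min_rep_core_of[OF n g]
    by (intro act_vec_fundamental_alcove[OF n] group.inv_closed[OF group_affine_sym])
qed

lemma simultaneous_core_iff_m_minimal:
  assumes n: "2 \<le> n" and m: "1 \<le> m" and g: "g \<in> min_coset_reps n" "act_vec n g (\<lambda>_. 0) = c"
  shows "core_of n c \<in> cores (m * n + 1) \<longleftrightarrow>
    cell n UNIV (act_vec n (inv\<^bsub>affine_sym n\<^esub> g) (base_point n)) \<in> m_minimal_alcoves n m"
proof -
  define q where "q = act_vec n (inv\<^bsub>affine_sym n\<^esub> g) (base_point n)"
  have gc: "g \<in> carrier (affine_sym n)" and dec: "decreasing n q"
    using g min_coset_reps_iff[OF n] unfolding q_def by auto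
  have c: "c \<in> int_lattice n" using act_vec_int_lattice[OF n gc zero_int_lattice] g(2) by simp
  have q: "q \<in> centres n"
    unfolding q_def by (rule act_vec_base_centre[OF n group.inv_closed[OF group_affine_sym gc]])
  have "core_of n c \<in> cores (m * n + 1) \<longleftrightarrow> steps_bounded n m ((\<lambda>k. base_point n k - c k) ` {1..n})"
    unfolding core_of_simultaneous_core[OF n c] steps_bounded_lattice[OF n c] ..
  also have "(\<lambda>k. base_point n k - c k) ` {1..n} = q ` {1..n}"
    unfolding q_def inverse_act_image[OF n gc] g(2) ..
  also have "steps_bounded n m (q ` {1..n}) \<longleftrightarrow> cell n UNIV q \<in> m_minimal_alcoves n m"
    unfolding m_minimal_iff[OF n q]
    using m_minimal_imp_steps_bounded[OF n m q dec] steps_bounded_imp_m_minimal[OF n m q dec] by blast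
  finally show ?thesis unfolding q_def .
qed

theorem theorem6p1:
  fixes n m :: nat
  assumes "n \<ge> 2" and "m \<ge> 1"
  shows "bij_betw (Phi n) (cores n \<inter> cores (m * n + 1))
           {A \<in> m_minimal_alcoves n m. A \<subseteq> dominant_chamber n}"
proof -
  note n = assms(1) and m = assms(2)
  note inv = group.inv_closed[OF group_affine_sym[of n]]
  have carr: "g \<in> carrier (affine_sym n)" if "g \<in> min_coset_reps n" for g
    using that min_coset_reps_iff[OF n] by blast
  have ctr: "act_vec n (inv\<^bsub>affine_sym n\<^esub> g) (base_point n) \<in> centres n" if "g \<in> min_coset_reps n" for g
    by (rule act_vec_base_centre[OF n inv[OF carr[OF that]]])
  have rep: "\<exists>g. g \<in> min_coset_reps n \<and> D = core_of n (act_vec n g (\<lambda>_. 0))" if D: "D \<in> cores n" for D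
  proof -
    obtain c where c: "c \<in> int_lattice n" "D = core_of n c" using core_of_surj[OF _ D] n by auto
    obtain g where "g \<in> min_coset_reps n" "act_vec n g (\<lambda>_. 0) = c" by (rule min_coset_rep_exists[OF n c(1)])
    then show ?thesis using c(2) by blast
  qed
  show ?thesis
  proof (rule bij_betw_imageI)
    show "inj_on (Phi n) (cores n \<inter> cores (m * n + 1))"
    proof (rule inj_onI)
      fix D E assume D: "D \<in> cores n \<inter> cores (m * n + 1)" and E: "E \<in> cores n \<inter> cores (m * n + 1)"
        and eq: "Phi n D = Phi n E"
      obtain g where g: "g \<in> min_coset_reps n" "D = core_of n (act_vec n g (\<lambda>_. 0))" using rep D by blast
      obtain h where h: "h \<in> min_coset_reps n" "E = core_of n (act_vec n h (\<lambda>_. 0))" using rep E by blast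
      let ?p = "act_vec n (inv\<^bsub>affine_sym n\<^esub> g) (base_point n)" and ?q = "act_vec n (inv\<^bsub>affine_sym n\<^esub> h) (base_point n)"
      have "cell n UNIV ?p = cell n UNIV ?q"
        using eq unfolding g(2) h(2) Phi_core_of[OF n g(1) HOL.refl] Phi_core_of[OF n h(1) HOL.refl] .
      moreover have "?p \<in> cell n UNIV ?p"
        by (rule cell_refl) (use centres_regular[OF ctr[OF g(1)]] in \<open>simp add: complement_UNIV\<close>)
      ultimately have "?p \<in> cell n UNIV ?q" by simp
      then have "?p = ?q" by (rule centre_of_alcove_unique[OF n ctr[OF h(1)] ctr[OF g(1)]])
      then have "inv\<^bsub>affine_sym n\<^esub> g = inv\<^bsub>affine_sym n\<^esub> h"
        by (rule act_vec_base_inj[OF n inv[OF carr[OF g(1)]] inv[OF carr[OF h(1)]]])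
      then have "g = h" using group.inv_inv[OF group_affine_sym] carr g(1) h(1) by metis
      then show "D = E" using g(2) h(2) by simp
    qed
    show "Phi n ` (cores n \<inter> cores (m * n + 1)) = {A \<in> m_minimal_alcoves n m. A \<subseteq> dominant_chamber n}"
    proof (intro subset_antisym subsetI)
      fix A assume "A \<in> Phi n ` (cores n \<inter> cores (m * n + 1))"
      then obtain D where D: "D \<in> cores n" "D \<in> cores (m * n + 1)" "A = Phi n D" by blast
      obtain g where g: "g \<in> min_coset_reps n" "D = core_of n (act_vec n g (\<lambda>_. 0))" using rep D(1) by blast
      let ?q = "act_vec n (inv\<^bsub>affine_sym n\<^esub> g) (base_point n)"
      have A: "A = cell n UNIV ?q" unfolding D(3) g(2) by (rule Phi_core_of[OF n g(1) HOL.refl])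
      have "A \<in> m_minimal_alcoves n m"
        using simultaneous_core_iff_m_minimal[OF n m g(1) HOL.refl] D(2) unfolding A g(2) by blast
      moreover have "A \<subseteq> dominant_chamber n"
        unfolding A alcove_dominant_iff[OF centres_regular[OF ctr[OF g(1)]]]
        using g(1) min_coset_reps_iff[OF n] by blast
      ultimately show "A \<in> {A \<in> m_minimal_alcoves n m. A \<subseteq> dominant_chamber n}" by blast
    next
      fix A assume "A \<in> {A \<in> m_minimal_alcoves n m. A \<subseteq> dominant_chamber n}"
      then have A: "A \<in> m_minimal_alcoves n m" "A \<subseteq> dominant_chamber n" by auto
      obtain w where w: "w \<in> carrier (affine_sym n)" "A = act_vec n w ` fundamental_alcove n"
        using A(1) unfolding m_minimal_alcoves_def by blast
      let ?g = "inv\<^bsub>affine_sym n\<^esub> w"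
      have invg: "inv\<^bsub>affine_sym n\<^esub> ?g = w" by (rule group.inv_inv[OF group_affine_sym w(1)])
      have Aw: "A = cell n UNIV (act_vec n w (base_point n))" unfolding w(2) by (rule act_vec_fundamental_alcove[OF n w(1)])
      have "decreasing n (act_vec n w (base_point n))"
        using A(2) unfolding Aw alcove_dominant_iff[OF centres_regular[OF act_vec_base_centre[OF n w(1)]]] .
      then have g: "?g \<in> min_coset_reps n" unfolding min_coset_reps_iff[OF n] invg using inv[OF w(1)] by blast
      let ?D = "core_of n (act_vec n ?g (\<lambda>_. 0))"
      have "?D \<in> cores n"
        by (rule core_of_in_cores[OF _ act_vec_int_lattice[OF n inv[OF w(1)] zero_int_lattice]]) (use n in simp)
      moreover have "?D \<in> cores (m * n + 1)"
        using simultaneous_core_iff_m_minimal[OF n m g HOL.refl] A(1) unfolding invg Aw by blast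
      moreover have "A = Phi n ?D" using Phi_core_of[OF n g HOL.refl] unfolding invg Aw by simp
      ultimately show "A \<in> Phi n ` (cores n \<inter> cores (m * n + 1))" by blast
    qed
  qed
qed

end
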